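(* Let $X$ be an Asplund space, $\{\Lambda_t\}_{t\in T}$ an arbitrary nonempty family of closed subsets of $X$, and $\Lambda:=\bigcap_{t\in T}\Lambda_t$. Then for any $\bar x\in X$, $x^*\in\hat N(\Lambda,\bar x)$, $\epsilon>0$ and weak$^*$-neighborhood $V$ of $0$ in $X^*$, there are a finite set $F\subseteq T$, points $w_t\in\mathbb{B}(\bar x,\epsilon)$ and $w_t^*\in\hat N(\Lambda_t,w_t)$, $t\in F$, such that $$x^*\in\sum_{t\in F}w_t^*+V.$$ Consequently, if $\{\Lambda_t\}_{t\in T}$ is a family of closed cones, then $\hat N(\Lambda_t,w_t)\subseteq N(\Lambda_t,0)$ for all $t\in T$ and all $w_t\in\Lambda_t$, and for every $\bar x\in X$ $$\hat N(\Lambda,\bar x)\subseteq\mathrm{cl}^{w^*}\Big\{\sum_{t\in F}w_t^*\ :\ F\subseteq T\text{ finite},\ w_t^*\in N(\Lambda_t,0)\ \text{for } t\in F\Big\}.$$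
   Context: An Asplund space is a Banach space all of whose separable subspaces have separable dual. $\mathbb{B}(\bar x,\epsilon)$ is the closed ball; $\mathrm{cl}^{w^*}$ is weak$^*$ closure. For a set $A$, $\delta_A$ is its indicator function ($0$ on $A$, $+\infty$ off $A$). $\hat N(A,x):=\hat\partial\delta_A(x)$ and $N(A,x):=\partial\delta_A(x)$ (both empty if $x\notin A$), where, for $g$ lsc and finite at $x$, $\hat\partial g(x)=\{x^*:\liminf_{h\to0}\frac{g(x+h)-g(x)-\langle x^*,h\rangle}{\|h\|}\ge0\}$ and $\partial g(x)=\{w^*\text{-}\lim x_n^*:x_n^*\in\hat\partial g(x_n),\ x_n\to x,\ g(x_n)\to g(x)\}$ (sequential limits). A cone is a set stable under multiplication by positive scalars. *)

theory Defs
  imports "HOL-Analysis.Analysis"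
begin

section \<open>Asplund spaces\<close>

text \<open>A subspace \<open>Y\<close> is not a type, so its dual is a set of functions on \<open>Y\<close>; extensionality
  (value \<open>undefined\<close> off \<open>Y\<close>) makes each functional a unique HOL function.\<close>

definition dual_on :: "'a::real_normed_vector set \<Rightarrow> ('a \<Rightarrow> real) set" where
  "dual_on Y = {f \<in> extensional Y.
     (\<forall>x\<in>Y. \<forall>y\<in>Y. f (x + y) = f x + f y) \<and>
     (\<forall>c. \<forall>x\<in>Y. f (c *\<^sub>R x) = c * f x) \<and>
     (\<exists>K. \<forall>x\<in>Y. \<bar>f x\<bar> \<le> K * norm x)}"

definition dual_norm_on :: "'a::real_normed_vector set \<Rightarrow> ('a \<Rightarrow> real) \<Rightarrow> real" where
  "dual_norm_on Y f = (SUP x\<in>{x \<in> Y. norm x \<le> 1}. \<bar>f x\<bar>)"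

definition separable_dual_on :: "'a::real_normed_vector set \<Rightarrow> bool" where
  "separable_dual_on Y \<longleftrightarrow>
     (\<exists>D. countable D \<and> D \<subseteq> dual_on Y \<and>
        (\<forall>f\<in>dual_on Y. \<forall>e>0. \<exists>g\<in>D. dual_norm_on Y (\<lambda>x. f x - g x) < e))"

definition asplund_space :: "'a::banach itself \<Rightarrow> bool" where
  "asplund_space _ \<longleftrightarrow>
     (\<forall>Y :: 'a set. subspace Y \<and> separable_space (top_of_set Y) \<longrightarrow> separable_dual_on Y)"

section \<open>Weak-star topology\<close>

text \<open>The strong operator topology is that of pointwise convergence, which for real-valued
  functionals is the weak-star topology.\<close>

abbreviation weak_star :: "('a::real_normed_vector \<Rightarrow>\<^sub>L real) topology" where
  "weak_star \<equiv> strong_operator_topology"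

section \<open>Subdifferentials and normal cones\<close>

text \<open>The finiteness conditions make both subdifferentials empty where \<open>g\<close> is not finite.
  Lower semicontinuity of \<open>g\<close> is not part of the definitions; indicators of closed sets have it.\<close>

definition frechet_subdiff ::
    "('a::real_normed_vector \<Rightarrow> ereal) \<Rightarrow> 'a \<Rightarrow> ('a \<Rightarrow>\<^sub>L real) set" where
  "frechet_subdiff g x = {xs. \<bar>g x\<bar> \<noteq> \<infinity> \<and>
     Liminf (at 0) (\<lambda>h. (g (x + h) - g x - ereal (blinfun_apply xs h)) / ereal (norm h)) \<ge> 0}"

definition limiting_subdiff ::
    "('a::real_normed_vector \<Rightarrow> ereal) \<Rightarrow> 'a \<Rightarrow> ('a \<Rightarrow>\<^sub>L real) set" where
  "limiting_subdiff g x = {xs. \<bar>g x\<bar> \<noteq> \<infinity> \<and>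
     (\<exists>u us. (\<forall>n::nat. us n \<in> frechet_subdiff g (u n)) \<and>
        u \<longlonglongrightarrow> x \<and> (\<lambda>n. g (u n)) \<longlonglongrightarrow> g x \<and> limitin weak_star us xs sequentially)}"

definition ind_fun :: "'a set \<Rightarrow> 'a \<Rightarrow> ereal" where
  "ind_fun A x = (if x \<in> A then 0 else \<infinity>)"

definition frechet_normal :: "'a::real_normed_vector set \<Rightarrow> 'a \<Rightarrow> ('a \<Rightarrow>\<^sub>L real) set" where
  "frechet_normal A x = frechet_subdiff (ind_fun A) x"

definition limiting_normal :: "'a::real_normed_vector set \<Rightarrow> 'a \<Rightarrow> ('a \<Rightarrow>\<^sub>L real) set" where
  "limiting_normal A x = limiting_subdiff (ind_fun A) x"

text \<open>Unlike the library's \<open>cone\<close>, only positive scalars are required.\<close>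

definition pos_cone :: "'a::real_vector set \<Rightarrow> bool" where
  "pos_cone A \<longleftrightarrow> (\<forall>x\<in>A. \<forall>c>0. c *\<^sub>R x \<in> A)"

end

theory Submission
  imports Defs
begin

text \<open>A weak-star neighbourhood of \<open>0\<close> only constrains the values on a finite set \<open>E\<close>, so a Frechet normal
  \<open>xs\<close> to the intersection can be tested on the finite-dimensional space \<open>span E\<close>. The points of a small sphere
  in \<open>xbar + span E\<close> at which \<open>xs\<close> is too large form a compact set, so finitely many of the sets
  \<open>\<Lambda>t t\<close> already exclude all of them; this reduces the claim to finite families and, by induction, to two sets.

  For two sets \<open>A\<close>, \<open>C\<close> one minimises over \<open>x \<in> A\<close>, \<open>y \<in> C\<close>, \<open>h \<in> span E\<close> the function
  \<open>\<gamma> * norm h - xs h\<close> plus a penalty for \<open>x\<close> and \<open>y\<close> differing from \<open>x0 + h\<close>. When the penalty and the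
  perturbations of a variational principle are Frechet differentiable, optimality in \<open>x\<close> and \<open>y\<close>
  produces Frechet normals, and optimality in \<open>h\<close> says that they add up to \<open>xs\<close> on \<open>span E\<close> approximately.

  A differentiable penalty exists on a subspace \<open>Y\<close> with separable dual, but in general not on an Asplund
  space. One therefore intersects with a separable \<open>Y\<close>, whose dual is separable by assumption, that is rich in the following sense: by
  Hahn-Banach, the nonexistence of a Frechet normal at \<open>w\<close> with prescribed approximate values on \<open>E\<close> is witnessed
  by finitely many points of the set, the same points are witnesses for all nearby \<open>w\<close>, and countably
  many choices suffice to put witnesses into \<open>Y\<close> whenever they exist.\<close>

section \<open>The Hahn-Banach theorem\<close>

text \<open>After the reduction to finitely many sets, \<open>xs\<close> may fail to be a Frechet
  normal to their larger intersection; only the strict inequality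
  \<open>xs h < \<gamma> * norm h\<close> on one sphere of \<open>span E\<close> survives. The
  two-set problem is therefore posed with that inequality alone. In it, \<open>x\<close> and
  \<open>y\<close> range over sets without compactness, so minimisers come from a variational
  principle, while \<open>h\<close> is confined to a compact ball. As the penalty grows,
  \<open>x\<close> and \<open>y\<close> approach \<open>x0 + h\<close>; a limit of the
  \<open>h\<close> then gives a point of both sets, and the strict inequality keeps it off the
  sphere. This makes the minimisers interior. The derivatives of the penalty may grow like the
  square of its parameter. This is harmless: they cancel between the optimality conditions in
  \<open>x\<close>, \<open>y\<close> and in \<open>h\<close>, and errors are measured on
  \<open>E\<close> only. The induction can continue because the functional found for the second set,
  itself an intersection, is an exact Frechet normal at a nearby point, where a new sphere can be
  chosen.\<close>

definition sublinear :: "('a::real_vector \<Rightarrow> real) \<Rightarrow> bool" where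
  "sublinear p \<longleftrightarrow> (\<forall>x y. p (x + y) \<le> p x + p y) \<and> (\<forall>t\<ge>0. \<forall>x. p (t *\<^sub>R x) = t * p x)"

text \<open>Using the inequality for \<open>inverse t\<close> at \<open>t *\<^sub>R x\<close> yields
  the reverse one. One-sided homogeneity is convenient because the functionals below are infima, for
  which upper bounds are the easy direction.\<close>

lemma sublinearI:
  assumes "\<And>x y. p (x + y) \<le> p x + p y" "\<And>t x. t > 0 \<Longrightarrow> p (t *\<^sub>R x) \<le> t * p x" "p 0 = 0"
  shows "sublinear p"
proof -
  have "p (t *\<^sub>R x) = t * p x" if "t \<ge> 0" for t x
  proof (cases "t = 0")
    case True then show ?thesis using assms(3) by simp
  next
    case False
    then have t: "t > 0" using that by simp
    have "p (inverse t *\<^sub>R (t *\<^sub>R x)) \<le> inverse t * p (t *\<^sub>R x)" using assms(2)[of "inverse t" "t *\<^sub>R x"] t by simp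
    then have "t * p x \<le> p (t *\<^sub>R x)" using t by (simp add: field_simps)
    then show ?thesis using assms(2)[OF t, of x] by linarith
  qed
  then show ?thesis unfolding sublinear_def using assms(1) by auto
qed

lemma sublinear_add: "sublinear p \<Longrightarrow> p (x + y) \<le> p x + p y"
  and sublinear_scale: "sublinear p \<Longrightarrow> t \<ge> 0 \<Longrightarrow> p (t *\<^sub>R x) = t * p x"
  unfolding sublinear_def by blast+

lemma sublinear_zero: "sublinear p \<Longrightarrow> p 0 = 0"
  using sublinear_scale[of p 0 0] by simp

lemma sublinear_neg: "sublinear p \<Longrightarrow> - p (- x) \<le> p x"
  using sublinear_add[of p x "- x"] sublinear_zero[of p] by simp

text \<open>The common lower bound \<open>- p (- x)\<close> keeps the infimum finite, and of two
  members of a chain the smaller can replace both, which yields subadditivity. This is the chain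
  condition for Zorn's lemma.\<close>

lemma sublinear_chain_Inf:
  assumes ne: "C \<noteq> {}" and sub: "\<And>q. q \<in> C \<Longrightarrow> sublinear q"
    and le: "\<And>q x. q \<in> C \<Longrightarrow> q x \<le> p x"
    and ch: "\<And>q r. q \<in> C \<Longrightarrow> r \<in> C \<Longrightarrow> (\<forall>x. q x \<le> r x) \<or> (\<forall>x. r x \<le> q x)"
  shows "sublinear (\<lambda>x. INF q\<in>C. q x)" "q \<in> C \<Longrightarrow> (INF q\<in>C. q x) \<le> q x"
proof -
  have bdd: "bdd_below ((\<lambda>q. q x) ` C)" for x
  proof (rule bdd_belowI2)
    fix q assume "q \<in> C"
    then show "- p (- x) \<le> q x" using sublinear_neg[OF sub, of q x] le[of q "- x"] by linarith
  qed
  show low: "(INF q\<in>C. q x) \<le> q x" if "q \<in> C" for q x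
    by (rule cINF_lower[OF bdd that])
  show "sublinear (\<lambda>x. INF q\<in>C. q x)"
  proof (rule sublinearI)
    fix x y
    have *: "(INF q\<in>C. q (x + y)) \<le> q1 x + q2 y" if "q1 \<in> C" "q2 \<in> C" for q1 q2
    proof -
      obtain q where "q \<in> C" "q x \<le> q1 x" "q y \<le> q2 y" using ch[OF \<open>q1 \<in> C\<close> \<open>q2 \<in> C\<close>] \<open>q1 \<in> C\<close> \<open>q2 \<in> C\<close> by blast
      then show ?thesis using low[of q "x + y"] sublinear_add[OF sub, of q x y] by linarith
    qed
    have "(INF q\<in>C. q (x + y)) - q1 x \<le> (INF q\<in>C. q y)" if "q1 \<in> C" for q1
      proof (rule cINF_greatest[OF ne])
      fix r assume "r \<in> C"
      from *[OF that this] show "(INF q\<in>C. q (x + y)) - q1 x \<le> r y" by linarith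
    qed
    then have "(INF q\<in>C. q (x + y)) - (INF q\<in>C. q y) \<le> (INF q\<in>C. q x)"
      using ne by (intro cINF_greatest) (auto simp: algebra_simps)
    then show "(INF q\<in>C. q (x + y)) \<le> (INF q\<in>C. q x) + (INF q\<in>C. q y)" by linarith
  next
    fix t :: real and x assume t: "t > 0"
    have "(INF q\<in>C. q (t *\<^sub>R x)) / t \<le> (INF q\<in>C. q x)"
    proof (rule cINF_greatest[OF ne])
      fix q assume q: "q \<in> C"
      have "(INF q\<in>C. q (t *\<^sub>R x)) \<le> t * q x" using low[OF q, of "t *\<^sub>R x"] sublinear_scale[OF sub[OF q], of t x] t by simp
      then show "(INF q\<in>C. q (t *\<^sub>R x)) / t \<le> q x" using t by (simp add: field_simps)
    qed
    then show "(INF q\<in>C. q (t *\<^sub>R x)) \<le> t * (INF q\<in>C. q x)" using t by (simp add: field_simps)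
  next
    have "(INF q\<in>C. q 0) = (INF q\<in>C. (0::real))" using sub sublinear_zero by (intro INF_cong) auto
    then show "(INF q\<in>C. q 0) = 0" using ne by simp
  qed
qed

text \<open>The auxiliary \<open>r\<close> is sublinear and, by the choice \<open>t = 0\<close>,
  lies below \<open>q\<close>; minimality makes it equal to \<open>q\<close>. The choice
  \<open>t = 1\<close> then reads \<open>q x \<le> q (x + y) - q y\<close>, the missing half of
  additivity.\<close>

lemma minimal_sublinear_additive:
  assumes q: "sublinear q" and min: "\<And>r. sublinear r \<Longrightarrow> (\<And>x. r x \<le> q x) \<Longrightarrow> r = q"
  shows "q (x + y) = q x + q y"
proof -
  define r where "r x = (INF t\<in>{0..}. q (x + t *\<^sub>R y) - t * q y)" for x
  have bdd: "bdd_below ((\<lambda>t. q (x + t *\<^sub>R y) - t * q y) ` {0..})" for x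
  proof (rule bdd_belowI2)
    fix t :: real assume "t \<in> {0..}"
    then have "t * q y = q (t *\<^sub>R y)" using sublinear_scale[OF q, of t y] by simp
    also have "\<dots> \<le> q (x + t *\<^sub>R y) + q (- x)" using sublinear_add[OF q, of "x + t *\<^sub>R y" "- x"] by simp
    finally show "- q (- x) \<le> q (x + t *\<^sub>R y) - t * q y" by linarith
  qed
  have low: "r x \<le> q (x + t *\<^sub>R y) - t * q y" if "t \<ge> 0" for t x
    unfolding r_def by (rule cINF_lower[OF bdd]) (use that in simp)
  have sub: "sublinear r"
  proof (rule sublinearI)
    fix a b
    have *: "r (a + b) \<le> (q (a + s *\<^sub>R y) - s * q y) + (q (b + t *\<^sub>R y) - t * q y)" if "s \<ge> 0" "t \<ge> 0" for s t
      using low[of "s + t" "a + b"] sublinear_add[OF q, of "a + s *\<^sub>R y" "b + t *\<^sub>R y"] that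
      by (simp add: algebra_simps)
    have "r (a + b) - (q (a + s *\<^sub>R y) - s * q y) \<le> r b" if "s \<ge> 0" for s
      unfolding r_def[of b] by (rule cINF_greatest) (use *[OF that] in \<open>auto simp: algebra_simps\<close>)
    then have "r (a + b) - r b \<le> r a"
      unfolding r_def[of a] by (intro cINF_greatest) (auto simp: algebra_simps)
    then show "r (a + b) \<le> r a + r b" by linarith
  next
    fix t :: real and a assume t: "t > 0"
    have "r (t *\<^sub>R a) / t \<le> r a"
      unfolding r_def[of a]
    proof (rule cINF_greatest)
      fix s :: real assume "s \<in> {0..}"
      then have "r (t *\<^sub>R a) \<le> q (t *\<^sub>R a + (t * s) *\<^sub>R y) - (t * s) * q y" using low t by simp
      also have "t *\<^sub>R a + (t * s) *\<^sub>R y = t *\<^sub>R (a + s *\<^sub>R y)" by (simp add: algebra_simps)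
      also have "q \<dots> = t * q (a + s *\<^sub>R y)" using sublinear_scale[OF q] t by simp
      finally show "r (t *\<^sub>R a) / t \<le> q (a + s *\<^sub>R y) - s * q y" using t by (simp add: field_simps)
    qed simp
    then show "r (t *\<^sub>R a) \<le> t * r a" using t by (simp add: field_simps)
  next
    have "r 0 = (INF t\<in>{0::real..}. (0::real))" unfolding r_def
      by (rule INF_cong) (use sublinear_scale[OF q] in auto)
    then show "r 0 = 0" by simp
  qed
  have "r = q" using min[OF sub] low[of 0] by simp
  then have "q x + q y \<le> q (x + y)" using low[of 1 x] by simp
  then show ?thesis using sublinear_add[OF q, of x y] by linarith
qed

theorem Hahn_Banach_sublinear:
  assumes p: "sublinear p"
  obtains f where "linear f" "\<And>x. f x \<le> p x"
proof -
  define A where "A = {q. sublinear q \<and> (\<forall>x. q x \<le> p x)}"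
  \<comment> \<open>The order is reversed, so that a maximal element for \<open>P\<close> is a
    pointwise minimal functional.\<close>
  define P where "P q r = (\<forall>x. r x \<le> q x)" for q r :: "'a \<Rightarrow> real"
  have "\<exists>m\<in>A. \<forall>a\<in>A. P m a \<longrightarrow> a = m"
  proof (rule predicate_Zorn)
    show "partial_order_on A (relation_of P A)"
      by (rule partial_order_on_relation_ofI) (auto simp: P_def intro!: ext intro: order_trans order_antisym)
    fix C assume C: "C \<in> Chains (relation_of P A)"
    show "\<exists>u\<in>A. \<forall>a\<in>C. P a u"
    proof (cases "C = {}")
      case True then show ?thesis using p by (auto simp: A_def)
    next
      case False
      have CA: "C \<subseteq> A" and ch: "\<And>q r. q \<in> C \<Longrightarrow> r \<in> C \<Longrightarrow> P q r \<or> P r q"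
        using C unfolding Chains_def relation_of_def by auto
      note I = sublinear_chain_Inf[OF False, of p]
      have "sublinear (\<lambda>x. INF q\<in>C. q x)" "\<And>q x. q \<in> C \<Longrightarrow> (INF q\<in>C. q x) \<le> q x"
        by (rule I; use CA ch in \<open>force simp: A_def P_def\<close>)+
      moreover from this(2) False CA have "(INF q\<in>C. q x) \<le> p x" for x
        unfolding A_def by (metis (no_types, lifting) ex_in_conv in_mono mem_Collect_eq order_trans)
      ultimately show ?thesis by (intro bexI[of _ "\<lambda>x. INF q\<in>C. q x"]) (simp_all add: A_def P_def)
    qed
  qed
  then obtain q where q: "sublinear q" "\<And>x. q x \<le> p x"
    and min: "\<And>r. sublinear r \<Longrightarrow> (\<And>x. r x \<le> p x) \<Longrightarrow> (\<And>x. r x \<le> q x) \<Longrightarrow> r = q"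
    unfolding A_def P_def by blast
  have add: "q (x + y) = q x + q y" for x y
    by (rule minimal_sublinear_additive[OF q(1)]) (meson min order_trans q(2))
  have neg: "q (- x) = - q x" for x using add[of x "- x"] sublinear_zero[OF q(1)] by simp
  have "q (t *\<^sub>R x) = t * q x" for t x
  proof (cases "t \<ge> 0")
    case True then show ?thesis using sublinear_scale[OF q(1)] by simp
  next
    case False
    then have "q ((- t) *\<^sub>R x) = (- t) * q x" using sublinear_scale[OF q(1), of "- t" x] by simp
    then show ?thesis using neg[of "t *\<^sub>R x"] by simp
  qed
  then have "linear q" using add by (intro linearI) auto
  then show ?thesis using that q(2) by blast
qed

section \<open>Solvability of systems of linear inequalities\<close>

inductive_set generated_cone :: "'b::real_vector set \<Rightarrow> 'b set" for G where
  zero: "0 \<in> generated_cone G"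
| step: "x \<in> G \<Longrightarrow> t \<ge> 0 \<Longrightarrow> y \<in> generated_cone G \<Longrightarrow> t *\<^sub>R x + y \<in> generated_cone G"

lemma generated_cone_add: "x \<in> generated_cone G \<Longrightarrow> y \<in> generated_cone G \<Longrightarrow> x + y \<in> generated_cone G"
  by (induction rule: generated_cone.induct) (auto simp: add.assoc intro: generated_cone.step)

lemma generated_cone_scale: "x \<in> generated_cone G \<Longrightarrow> s \<ge> 0 \<Longrightarrow> s *\<^sub>R x \<in> generated_cone G"
proof (induction rule: generated_cone.induct)
  case (step x t y)
  then have "(s * t) *\<^sub>R x + s *\<^sub>R y \<in> generated_cone G" by (intro generated_cone.step) auto
  then show ?case by (simp add: algebra_simps)
qed (simp add: generated_cone.zero)

lemma generated_cone_superset: "x \<in> G \<Longrightarrow> x \<in> generated_cone G"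
  using generated_cone.step[of x G 1 0] generated_cone.zero[of G] by simp

lemma generated_cone_mono: "x \<in> generated_cone G \<Longrightarrow> G \<subseteq> H \<Longrightarrow> x \<in> generated_cone H"
  by (induction rule: generated_cone.induct) (auto intro: generated_cone.intros)

text \<open>A Farkas-type criterion: a pair \<open>(x, b)\<close> in \<open>G\<close> is the
  constraint \<open>g x \<le> b\<close>, and the hypothesis says that no nonnegative combination of
  constraints contradicts \<open>- c * norm x \<le> g x\<close>. The functional \<open>p\<close> is
  built so that every linear minorant of it obeys both the norm bound and all constraints.\<close>

theorem exists_blinfun_constraints:
  fixes G :: "('a::real_normed_vector \<times> real) set"
  assumes c: "\<And>z. z \<in> generated_cone G \<Longrightarrow> snd z + c * norm (fst z) \<ge> 0" and c0: "c \<ge> 0"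
  obtains g :: "'a \<Rightarrow>\<^sub>L real" where "norm g \<le> c" "\<And>x b. (x, b) \<in> G \<Longrightarrow> g x \<le> b"
proof -
  define p where "p x = (INF z\<in>generated_cone G. snd z + c * norm (x - fst z))" for x :: 'a
  have ne: "generated_cone G \<noteq> {}" using generated_cone.zero by blast
  have lowb: "- c * norm x \<le> snd z + c * norm (x - fst z)" if "z \<in> generated_cone G" for x z
  proof -
    have "norm (fst z) \<le> norm (x - fst z) + norm x" by norm
    then have "c * norm (fst z) \<le> c * norm (x - fst z) + c * norm x"
      using c0 by (metis distrib_left mult_left_mono)
    then show ?thesis using c[OF that] by simp
  qed
  have bdd: "bdd_below ((\<lambda>z. snd z + c * norm (x - fst z)) ` generated_cone G)" for x
    by (rule bdd_belowI2[OF lowb])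
  have low: "p x \<le> snd z + c * norm (x - fst z)" if "z \<in> generated_cone G" for x z
    unfolding p_def by (rule cINF_lower[OF bdd that])
  have pc: "p x \<le> c * norm x" for x using low[OF generated_cone.zero, of x] by simp
  have "sublinear p"
  proof (rule sublinearI)
    fix x y
    have *: "p (x + y) \<le> (snd z + c * norm (x - fst z)) + (snd w + c * norm (y - fst w))"
      if "z \<in> generated_cone G" "w \<in> generated_cone G" for z w
    proof -
      have "norm ((x + y) - fst (z + w)) \<le> norm (x - fst z) + norm (y - fst w)"
        using norm_triangle_ineq[of "x - fst z" "y - fst w"] by (simp add: algebra_simps)
      then have "c * norm ((x + y) - fst (z + w)) \<le> c * norm (x - fst z) + c * norm (y - fst w)"
        using c0 by (metis distrib_left mult_left_mono)
      then show ?thesis using low[OF generated_cone_add[OF that], of "x + y"] by simp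
    qed
    have "p (x + y) - (snd z + c * norm (x - fst z)) \<le> p y" if "z \<in> generated_cone G" for z
      unfolding p_def[of y] by (rule cINF_greatest[OF ne]) (use *[OF that] in \<open>simp add: algebra_simps\<close>)
    then have "p (x + y) - p y \<le> p x"
      unfolding p_def[of x] by (intro cINF_greatest[OF ne]) (simp add: algebra_simps)
    then show "p (x + y) \<le> p x + p y" by linarith
  next
    fix t :: real and x assume t: "t > 0"
    have "p (t *\<^sub>R x) / t \<le> p x"
      unfolding p_def[of x]
    proof (rule cINF_greatest[OF ne])
      fix z assume "z \<in> generated_cone G"
      then have "p (t *\<^sub>R x) \<le> snd (t *\<^sub>R z) + c * norm (t *\<^sub>R x - fst (t *\<^sub>R z))"
        using t by (intro low generated_cone_scale) auto
      also have "norm (t *\<^sub>R x - fst (t *\<^sub>R z)) = t * norm (x - fst z)"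
        using t by (simp flip: scaleR_diff_right)
      finally show "p (t *\<^sub>R x) / t \<le> snd z + c * norm (x - fst z)" using t by (simp add: field_simps)
    qed
    then show "p (t *\<^sub>R x) \<le> t * p x" using t by (simp add: field_simps)
  next
    have "0 \<le> p 0" unfolding p_def by (rule cINF_greatest[OF ne]) (use lowb[of _ 0] in simp)
    then show "p 0 = 0" using pc[of 0] by simp
  qed
  then obtain f where f: "linear f" "\<And>x. f x \<le> p x" by (rule Hahn_Banach_sublinear) blast
  have fc: "\<bar>f x\<bar> \<le> c * norm x" for x
    using f(2)[of x] pc[of x] f(2)[of "- x"] pc[of "- x"] linear_neg[OF f(1), of x] by auto
  have bl: "bounded_linear f"
    using f(1) fc by (intro bounded_linear.intro bounded_linear_axioms.intro) (auto intro!: exI[of _ c] simp: mult.commute)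
  show ?thesis
  proof (rule that[of "Blinfun f"])
    show "norm (Blinfun f) \<le> c"
      using fc by (intro norm_blinfun_bound[OF c0]) (simp add: bounded_linear_Blinfun_apply[OF bl])
    fix x b assume "(x, b) \<in> G"
    then have "f x \<le> b" using f(2)[of x] low[OF generated_cone_superset, of "(x, b)" x] by simp
    then show "Blinfun f x \<le> b" by (simp add: bounded_linear_Blinfun_apply[OF bl])
  qed
qed

text \<open>The constraints are the graph of \<open>a\<close>, which is its own generated cone; the
  inequalities at \<open>x\<close> and \<open>- x\<close> together force equality.\<close>

corollary blinfun_extension:
  fixes a :: "'a::real_normed_vector \<Rightarrow> real"
  assumes Y: "subspace Y" and add: "\<And>x y. x \<in> Y \<Longrightarrow> y \<in> Y \<Longrightarrow> a (x + y) = a x + a y"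
    and scale: "\<And>t x. x \<in> Y \<Longrightarrow> a (t *\<^sub>R x) = t * a x"
    and bound: "\<And>x. x \<in> Y \<Longrightarrow> \<bar>a x\<bar> \<le> c * norm x" and c0: "c \<ge> 0"
  obtains g :: "'a \<Rightarrow>\<^sub>L real" where "norm g \<le> c" "\<And>x. x \<in> Y \<Longrightarrow> g x = a x"
proof -
  define G where "G = {(x, a x) |x. x \<in> Y}"
  have 0: "a 0 = 0" using scale[of 0 0] subspace_0[OF Y] by simp
  have "z \<in> G" if "z \<in> generated_cone G" for z
    using that
  proof induction
    case zero then show ?case using subspace_0[OF Y] 0 by (auto simp: G_def zero_prod_def)
  next
    case (step x t y)
    then show ?case using subspace_add[OF Y] subspace_scale[OF Y] add scale by (auto simp: G_def)
  qed
  then have GG: "generated_cone G \<subseteq> G" by blast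
  have "snd z + c * norm (fst z) \<ge> 0" if z: "z \<in> generated_cone G" for z
  proof -
    obtain x where "x \<in> Y" "z = (x, a x)" using GG z unfolding G_def by blast
    then show ?thesis using bound[of x] by simp
  qed
  then obtain g :: "'a \<Rightarrow>\<^sub>L real" where g: "norm g \<le> c" "\<And>x b. (x, b) \<in> G \<Longrightarrow> g x \<le> b"
    using exists_blinfun_constraints[of G c] c0 by blast
  have "g x = a x" if "x \<in> Y" for x
  proof -
    have "g (- x) \<le> a (- x)" "g x \<le> a x" using g(2) that subspace_neg[OF Y] by (auto simp: G_def)
    moreover have "a (- x) = - a x" using scale[OF that, of "- 1"] by simp
    ultimately show ?thesis by (simp add: blinfun.minus_right)
  qed
  then show ?thesis using that g(1) by blast
qed

text \<open>The single constraint \<open>g (- x) \<le> - norm x\<close> suffices, since the bound on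
  \<open>norm g\<close> gives the other inequality.\<close>

corollary norming_functional:
  fixes x :: "'a::real_normed_vector"
  obtains g :: "'a \<Rightarrow>\<^sub>L real" where "norm g \<le> 1" "g x = norm x"
proof -
  have "\<exists>t\<ge>0. z = t *\<^sub>R (- x, - norm x)" if "z \<in> generated_cone {(- x, - norm x)}" for z
    using that
  proof induction
    case zero then show ?case by (intro exI[of _ 0]) (simp add: zero_prod_def)
  next
    case (step u t y)
    then obtain s where "s \<ge> 0" "y = s *\<^sub>R (- x, - norm x)" "u = (- x, - norm x)" by auto
    then show ?case using step.hyps by (intro exI[of _ "t + s"]) (simp add: algebra_simps)
  qed
  then have "snd z + 1 * norm (fst z) \<ge> 0" if "z \<in> generated_cone {(- x, - norm x)}" for z
    using that by fastforce
  then obtain g :: "'a \<Rightarrow>\<^sub>L real" where g: "norm g \<le> 1" "g (- x) \<le> - norm x"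
    using exists_blinfun_constraints[of "{(- x, - norm x)}" 1] by (metis insertI1 zero_le_one)
  moreover have "g x \<le> 1 * norm x"
    using norm_blinfun[of g x] g(1) mult_right_mono[OF g(1), of "norm x"] by auto
  ultimately show ?thesis using that[of g] by (simp add: blinfun.minus_right)
qed

section \<open>Frechet normals and weak-star neighbourhoods\<close>

text \<open>Off \<open>A\<close> the difference quotient is infinite and cannot lower the limit, so
  only points of \<open>A\<close> are tested. The non-strict inequality lets \<open>u = x\<close> be
  included.\<close>

lemma frechet_normal_iff:
  "xs \<in> frechet_normal A x \<longleftrightarrow>
    x \<in> A \<and> (\<forall>e>0. \<exists>d>0. \<forall>u\<in>A. norm (u - x) < d \<longrightarrow> blinfun_apply xs (u - x) \<le> e * norm (u - x))"
proof (cases "x \<in> A")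
  case False then show ?thesis by (simp add: frechet_normal_def frechet_subdiff_def ind_fun_def)
next
  case True
  define Q where "Q h = (ind_fun A (x + h) - ind_fun A x - ereal (blinfun_apply xs h)) / ereal (norm h)" for h
  have Q: "Q h = (if x + h \<in> A then ereal (- blinfun_apply xs h / norm h) else \<infinity>)" if "h \<noteq> 0" for h
    using True that by (auto simp: Q_def ind_fun_def)
  have "xs \<in> frechet_normal A x \<longleftrightarrow> (\<forall>y<0. \<forall>\<^sub>F h in at 0. y < Q h)"
    using True by (auto simp: frechet_normal_def frechet_subdiff_def Q_def le_Liminf_iff ind_fun_def)
  also have "\<dots> \<longleftrightarrow> (\<forall>e>0. \<forall>\<^sub>F h in at 0. ereal (- e) < Q h)" (is "?L \<longleftrightarrow> ?R")
  proof
    assume R: ?R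
    show ?L
    proof (intro allI impI)
      fix y :: ereal assume "y < 0"
      then obtain r where r: "y < ereal r" "ereal r < 0" using ereal_dense2 by blast
      then have "- r > 0" by simp
      from R[rule_format, OF this] have "\<forall>\<^sub>F h in at 0. ereal r < Q h" by simp
      then show "\<forall>\<^sub>F h in at 0. y < Q h" by eventually_elim (use r in auto)
    qed
  qed simp
  also have "\<dots> \<longleftrightarrow> (\<forall>e>0. \<exists>d>0. \<forall>h. h \<noteq> 0 \<and> norm h < d \<longrightarrow> x + h \<in> A \<longrightarrow> blinfun_apply xs h < e * norm h)"
    proof -
    have *: "(h \<noteq> 0 \<and> dist h 0 < d \<longrightarrow> ereal (- e) < Q h) \<longleftrightarrow>
      (h \<noteq> 0 \<and> norm h < d \<longrightarrow> x + h \<in> A \<longrightarrow> blinfun_apply xs h < e * norm h)" for h e d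
      by (cases "h = 0") (auto simp: Q field_simps)
    show ?thesis unfolding eventually_at by (simp only: * UNIV_I ball_simps simp_thms ball_UNIV)
  qed
  also have "\<dots> \<longleftrightarrow> (\<forall>e>0. \<exists>d>0. \<forall>u\<in>A. norm (u - x) < d \<longrightarrow> blinfun_apply xs (u - x) \<le> e * norm (u - x))" (is "?L \<longleftrightarrow> ?R")
  proof
    assume L: ?L
    show ?R
    proof (intro allI impI)
      fix e :: real assume "e > 0"
      then obtain d where "d > 0" and d: "\<And>h. h \<noteq> 0 \<Longrightarrow> norm h < d \<Longrightarrow> x + h \<in> A \<Longrightarrow> blinfun_apply xs h < e * norm h"
        using L by blast
      have "blinfun_apply xs (u - x) \<le> e * norm (u - x)" if "u \<in> A" "norm (u - x) < d" for u
        using d[of "u - x"] that by (cases "u = x") auto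
      then show "\<exists>d>0. \<forall>u\<in>A. norm (u - x) < d \<longrightarrow> blinfun_apply xs (u - x) \<le> e * norm (u - x)"
        using \<open>d > 0\<close> by blast
    qed
  next
    assume R: ?R
    show ?L
    proof (intro allI impI)
      fix e :: real assume "e > 0"
      \<comment> \<open>Half the slope turns the non-strict inequality into the strict one.\<close>
      then obtain d where "d > 0" and d: "\<And>u. u \<in> A \<Longrightarrow> norm (u - x) < d \<Longrightarrow> blinfun_apply xs (u - x) \<le> e / 2 * norm (u - x)"
        using R[rule_format, of "e / 2"] by auto
      have "blinfun_apply xs h < e * norm h" if "h \<noteq> 0" "norm h < d" "x + h \<in> A" for h
      proof -
        have "blinfun_apply xs h \<le> e / 2 * norm h" using d[of "x + h"] that by simp
        also have "\<dots> < e * norm h" using that \<open>e > 0\<close> by simp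
        finally show ?thesis .
      qed
      then show "\<exists>d>0. \<forall>h. h \<noteq> 0 \<and> norm h < d \<longrightarrow> x + h \<in> A \<longrightarrow> blinfun_apply xs h < e * norm h"
        using \<open>d > 0\<close> by blast
    qed
  qed
  finally show ?thesis using True by simp
qed

lemma weak_star_basic_nhd:
  assumes "openin weak_star U" "xs \<in> U"
  obtains E and \<eta> :: real where "finite E" "\<eta> > 0"
    "\<And>ys. (\<And>e. e \<in> E \<Longrightarrow> \<bar>blinfun_apply ys e - blinfun_apply xs e\<bar> < \<eta>) \<Longrightarrow> ys \<in> U"
proof -
  obtain W where W: "open W" "U = blinfun_apply -` W"
    using assms(1) unfolding strong_operator_topology_def openin_pullback_topology by auto
  have "openin (product_topology (\<lambda>i. euclidean) UNIV) W" using W(1) by (simp add: open_fun_def)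
  from product_topology_open_contains_basis[OF this, of "blinfun_apply xs"] assms(2) W(2)
  obtain B where B: "blinfun_apply xs \<in> Pi\<^sub>E UNIV B" "\<And>i. open (B i)" "finite {i. B i \<noteq> UNIV}" "Pi\<^sub>E UNIV B \<subseteq> W"
    by auto
  define E where "E = {i. B i \<noteq> UNIV}"
  have "\<exists>r>0. \<forall>y. \<bar>y - blinfun_apply xs e\<bar> < r \<longrightarrow> y \<in> B e" for e
    using B(1,2) unfolding open_dist PiE_UNIV_domain by (auto simp: dist_real_def)
  then obtain r where r: "\<And>e. r e > 0" "\<And>e y. \<bar>y - blinfun_apply xs e\<bar> < r e \<Longrightarrow> y \<in> B e" by metis
  show ?thesis
  \<comment> \<open>The inserted \<open>1\<close> keeps the minimum defined and positive when
    \<open>E\<close> is empty.\<close>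
  proof (rule that[of E "Min (insert 1 (r ` E))"])
    show "finite E" using B(3) E_def by simp
    then show "0 < Min (insert 1 (r ` E))" using r(1) by auto
    fix ys assume ys: "\<And>e. e \<in> E \<Longrightarrow> \<bar>blinfun_apply ys e - blinfun_apply xs e\<bar> < Min (insert 1 (r ` E))"
    have "blinfun_apply ys e \<in> B e" for e
    proof (cases "e \<in> E")
      case True
      then have "\<bar>blinfun_apply ys e - blinfun_apply xs e\<bar> < r e" using ys[OF True] \<open>finite E\<close> by auto
      then show ?thesis by (rule r)
    qed (auto simp: E_def)
    then show "ys \<in> U" using B(4) W(2) by (auto simp: PiE_UNIV_domain)
  qed
qed

text \<open>If \<open>e\<close> is not in the closed space \<open>span E\<close>, its distance
  \<open>d\<close> to that space is positive and bounds the coefficient of \<open>e\<close> in a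
  vector \<open>x\<close> by \<open>norm x / d\<close>. The ball is then a closed part of the
  continuous image of a compact product.\<close>

lemma compact_ball_span_finite:
  fixes E :: "'a::real_normed_vector set"
  assumes "finite E"
  shows "compact (cball 0 r \<inter> span E)"
  using assms
proof (induction E arbitrary: r)
  case empty
  have "cball 0 r \<inter> {0::'a} \<in> {{}, {0}}" by auto
  then show ?case by auto
next
  case (insert e E)
  \<comment> \<open>A convergent sequence is bounded, so it stays in one of the compact balls; the
    induction hypothesis for all radii therefore gives closedness of the span.\<close>
  have closed: "closed (span S)" if S: "\<And>r. compact (cball 0 r \<inter> span S)" for S :: "'a set"
    unfolding closed_sequential_limits
  proof (intro allI impI)
    fix x l assume xl: "(\<forall>n. x n \<in> span S) \<and> x \<longlonglongrightarrow> l"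
    then have "Bseq x" using convergent_imp_Bseq convergentI by blast
    then obtain K where "\<And>n. norm (x n) \<le> K" unfolding Bseq_def by blast
    then have "x n \<in> cball 0 K \<inter> span S" for n using xl by auto
    then have "l \<in> cball 0 K \<inter> span S"
      using compact_imp_closed[OF S, of K] xl unfolding closed_sequential_limits by blast
    then show "l \<in> span S" by simp
  qed
  show ?case
  proof (cases "e \<in> span E")
    case True then show ?thesis using insert.IH by (simp add: span_redundant)
  next
    case False
    have cl: "closed (span E)" by (rule closed) (rule insert.IH)
    define d where "d = infdist e (span E)"
    have d: "d > 0" unfolding d_def using infdist_pos_not_in_closed[OF cl _ False] span_zero by blast
    define M where "M = \<bar>r\<bar> / d"
    define K where "K = (\<lambda>(t, y). t *\<^sub>R e + y) ` ({-M..M} \<times> (cball 0 (\<bar>r\<bar> + M * norm e) \<inter> span E))"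
    have K: "compact K" unfolding K_def
      by (intro compact_continuous_image compact_Times insert.IH compact_Icc)
        (auto intro!: continuous_intros simp: case_prod_unfold)
    have sub: "cball 0 r \<inter> span (insert e E) \<subseteq> K"
    proof
      fix x assume x: "x \<in> cball 0 r \<inter> span (insert e E)"
      then obtain t where t: "x - t *\<^sub>R e \<in> span E" using span_breakdown_eq by blast
      have "\<bar>t\<bar> * d \<le> norm x"
      proof (cases "t = 0")
        case False
        have "- (1 / t) *\<^sub>R (x - t *\<^sub>R e) \<in> span E" by (rule span_scale[OF t])
        then have "d \<le> dist e (- (1 / t) *\<^sub>R (x - t *\<^sub>R e))" unfolding d_def by (rule infdist_le)
        also have "\<dots> = norm ((1 / t) *\<^sub>R x)"
          using False by (simp add: dist_norm algebra_simps)
        finally show ?thesis using False by (simp add: field_simps)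
      qed simp
      moreover have xr: "norm x \<le> \<bar>r\<bar>" using x abs_ge_self[of r] by (simp del: abs_ge_self)
      ultimately have "\<bar>t\<bar> * d \<le> \<bar>r\<bar>" by linarith
      then have tM: "\<bar>t\<bar> \<le> M" using d by (simp add: M_def pos_le_divide_eq)
      have "norm (x - t *\<^sub>R e) \<le> norm x + \<bar>t\<bar> * norm e" by (metis norm_scaleR norm_triangle_ineq4)
      also have "\<dots> \<le> \<bar>r\<bar> + M * norm e" using add_mono[OF xr mult_right_mono[OF tM norm_ge_zero[of e]]] by simp
      finally have "(t, x - t *\<^sub>R e) \<in> {-M..M} \<times> (cball 0 (\<bar>r\<bar> + M * norm e) \<inter> span E)"
        using tM t by auto
      then show "x \<in> K" unfolding K_def by (rule rev_image_eqI) simp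
    qed
    have Ksub: "K \<subseteq> span (insert e E)"
      unfolding K_def using span_mono[of E "insert e E"] span_base[of e "insert e E"] by (auto intro!: span_add span_scale)
    have "cball 0 r \<inter> span (insert e E) = cball 0 r \<inter> K" using sub Ksub by blast
    then show ?thesis using K by (simp add: closed_Int_compact)
  qed
qed

section \<open>A variational principle\<close>

lemma exists_near_minimizer:
  fixes h :: "'b \<Rightarrow> real"
  assumes "M \<noteq> {}" "\<And>u. u \<in> M \<Longrightarrow> L \<le> h u" "e > 0"
  obtains p where "p \<in> M" "\<And>u. u \<in> M \<Longrightarrow> h p \<le> h u + e"
proof -
  have bdd: "bdd_below (h ` M)" using assms(2) by (rule bdd_belowI2)
  have "\<not> (\<forall>p\<in>M. (INF u\<in>M. h u) + e \<le> h p)"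
  proof
    assume "\<forall>p\<in>M. (INF u\<in>M. h u) + e \<le> h p"
    then have "(INF u\<in>M. h u) + e \<le> (INF u\<in>M. h u)" by (intro cINF_greatest assms(1)) auto
    then show False using assms(3) by simp
  qed
  then obtain p where p: "p \<in> M" "h p < (INF u\<in>M. h u) + e" by (auto simp: not_le)
  have "h p \<le> h u + e" if "u \<in> M" for u
    using p(2) cINF_lower[OF bdd that] by linarith
  then show ?thesis using that p(1) by blast
qed

lemma Cauchy_geometric:
  fixes P :: "nat \<Rightarrow> 'a::metric_space"
  assumes d: "\<And>n. dist (P (Suc n)) (P n) \<le> C * (1/2)^n"
  shows "Cauchy P"
proof -
  have C: "0 \<le> C" using order_trans[OF zero_le_dist d[of 0]] by simp
  \<comment> \<open>The bound telescopes: \<open>C * (1/2)^n\<close> is the difference of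
    \<open>2 * C * (1/2)^n\<close> and the same term at \<open>Suc n\<close>.\<close>
  have step: "dist (P m) (P (m + k)) \<le> 2 * C * (1/2)^m - 2 * C * (1/2)^(m + k)" for m k
  proof (induction k)
    case (Suc k)
    have "dist (P m) (P (m + Suc k)) \<le> dist (P m) (P (m + k)) + dist (P (Suc (m + k))) (P (m + k))"
      by (metis add_Suc_right dist_commute dist_triangle)
    also have "\<dots> \<le> (2 * C * (1/2)^m - 2 * C * (1/2)^(m + k)) + C * (1/2)^(m + k)"
      using Suc d by (intro add_mono)
    finally show ?case by simp
  qed simp
  show ?thesis
  proof (rule metric_CauchyI)
    fix e :: real assume e: "e > 0"
    have "(\<lambda>m. 2 * C * (1/2)^m) \<longlonglongrightarrow> 2 * C * 0"
      by (intro tendsto_intros LIMSEQ_power_zero) simp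
    then have "\<forall>\<^sub>F m in sequentially. 2 * C * (1/2)^m < e / 2" using e by (intro order_tendstoD) auto
    then obtain N where N: "2 * C * (1/2)^N < e / 2" by (auto simp: eventually_sequentially)
    have "dist (P N) (P n) < e / 2" if "n \<ge> N" for n
    proof -
      have "0 \<le> 2 * C * (1/2)^n" using C by simp
      then show ?thesis using step[of N "n - N"] N that by simp
    qed
    then have "dist (P m) (P n) < e" if "m \<ge> N" "n \<ge> N" for m n
      using that dist_triangle_half_r by blast
    then show "\<exists>N. \<forall>m\<ge>N. \<forall>n\<ge>N. dist (P m) (P n) < e" by blast
  qed
qed

text \<open>Each \<open>P n\<close> almost minimises the function perturbed so far; the next perturbation, centred at
  \<open>P n\<close>, then confines \<open>P (Suc n)\<close> to a small ball around \<open>P n\<close>.\<close>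

theorem perturbed_minimizer:
  fixes f :: "'m::metric_space \<Rightarrow> real" and \<rho> :: "nat \<Rightarrow> 'm \<Rightarrow> 'm \<Rightarrow> real"
  assumes M: "complete M" "M \<noteq> {}" and cont: "continuous_on M f" and L: "\<And>u. u \<in> M \<Longrightarrow> L \<le> f u"
    and nonneg: "\<And>n u v. u \<in> M \<Longrightarrow> v \<in> M \<Longrightarrow> 0 \<le> \<rho> n u v" and refl: "\<And>n u. u \<in> M \<Longrightarrow> \<rho> n u u = 0"
    and bound: "\<And>n u v. u \<in> M \<Longrightarrow> v \<in> M \<Longrightarrow> \<rho> n u v \<le> B * (1/2)^n"
    and lip: "\<And>n u v w. u \<in> M \<Longrightarrow> v \<in> M \<Longrightarrow> w \<in> M \<Longrightarrow> \<bar>\<rho> n u w - \<rho> n v w\<bar> \<le> K * (1/2)^n * dist u v"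
    and sep: "\<And>n u v. u \<in> M \<Longrightarrow> v \<in> M \<Longrightarrow> \<rho> n u v < \<eta> n \<Longrightarrow> dist u v \<le> C * (1/2)^n"
    and eta: "\<And>n. 0 < \<eta> n" "\<And>n. \<eta> (Suc n) \<le> \<eta> n" "\<eta> \<longlonglongrightarrow> 0"
  obtains P p where "\<And>n. P n \<in> M" "p \<in> M"
    "\<And>u. u \<in> M \<Longrightarrow> f p + (\<Sum>n. \<rho> n p (P n)) \<le> f u + (\<Sum>n. \<rho> n u (P n))"
proof -
  \<comment> \<open>The state of the recursion pairs the function perturbed so far with a point
    minimising it up to \<open>\<eta> n / 3\<close>.\<close>
  have "\<exists>S. \<forall>n. (snd (S n) \<in> M \<and> (\<forall>u\<in>M. fst (S n) (snd (S n)) \<le> fst (S n) u + \<eta> n / 3) \<and> (\<forall>u\<in>M. L \<le> fst (S n) u) \<and>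
      (n = 0 \<longrightarrow> fst (S n) = f)) \<and> fst (S (Suc n)) = (\<lambda>u. fst (S n) u + \<rho> n u (snd (S n)))"
  proof (rule dependent_nat_choice)
    obtain p where "p \<in> M" "\<And>u. u \<in> M \<Longrightarrow> f p \<le> f u + \<eta> 0 / 3"
      using exists_near_minimizer[of M L f "\<eta> 0 / 3"] M(2) L eta(1)[of 0] by auto
    then show "\<exists>s. snd s \<in> M \<and> (\<forall>u\<in>M. fst s (snd s) \<le> fst s u + \<eta> 0 / 3) \<and> (\<forall>u\<in>M. L \<le> fst s u) \<and> ((0::nat) = 0 \<longrightarrow> fst s = f)"
      using L by (intro exI[of _ "(f, p)"]) simp
  next
    fix s n
    assume s: "snd s \<in> M \<and> (\<forall>u\<in>M. fst s (snd s) \<le> fst s u + \<eta> n / 3) \<and> (\<forall>u\<in>M. L \<le> fst s u) \<and> (n = 0 \<longrightarrow> fst s = f)"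
    define h where "h = (\<lambda>u. fst s u + \<rho> n u (snd s))"
    have hL: "L \<le> h u" if "u \<in> M" for u using s nonneg[OF that, of "snd s" n] that unfolding h_def by force
    obtain p where "p \<in> M" "\<And>u. u \<in> M \<Longrightarrow> h p \<le> h u + \<eta> (Suc n) / 3"
      using exists_near_minimizer[of M L h "\<eta> (Suc n) / 3"] M(2) hL eta(1)[of "Suc n"] by auto
    then show "\<exists>t. (snd t \<in> M \<and> (\<forall>u\<in>M. fst t (snd t) \<le> fst t u + \<eta> (Suc n) / 3) \<and> (\<forall>u\<in>M. L \<le> fst t u) \<and> (Suc n = 0 \<longrightarrow> fst t = f)) \<and>
        fst t = (\<lambda>u. fst s u + \<rho> n u (snd s))"
      using hL by (intro exI[of _ "(h, p)"]) (simp add: h_def)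
  qed
  then obtain S where S: "\<And>n. snd (S n) \<in> M" "\<And>n u. u \<in> M \<Longrightarrow> fst (S n) (snd (S n)) \<le> fst (S n) u + \<eta> n / 3"
    "fst (S 0) = f" "\<And>n. fst (S (Suc n)) = (\<lambda>u. fst (S n) u + \<rho> n u (snd (S n)))" by blast
  define P where "P n = snd (S n)" for n
  have P: "P n \<in> M" for n unfolding P_def by (rule S(1))
  have H: "fst (S n) u = f u + (\<Sum>i<n. \<rho> i u (P i))" for n u
    by (induction n) (simp_all add: S(3,4) P_def)
  have near: "f (P n) + (\<Sum>i<n. \<rho> i (P n) (P i)) \<le> f u + (\<Sum>i<n. \<rho> i u (P i)) + \<eta> n / 3" if "u \<in> M" for n u
    using S(2)[OF that, of n] unfolding H P_def[symmetric] .
  have "Cauchy P"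
  proof (rule Cauchy_geometric)
    fix n
    \<comment> \<open>Sum of two near-minimality inequalities: \<open>P n\<close> tested against
      \<open>P (Suc n)\<close> at stage \<open>n\<close>, and conversely at stage
      \<open>Suc n\<close>, where the new term vanishes at its own centre. The thirds leave the sum
      below \<open>\<eta> n\<close>.\<close>
    have "\<rho> n (P (Suc n)) (P n) \<le> \<eta> n / 3 + \<eta> (Suc n) / 3"
      using near[OF P[of n], of "Suc n"] near[OF P[of "Suc n"], of n] refl[OF P[of n], of n] by simp
    then have "\<rho> n (P (Suc n)) (P n) < \<eta> n" using eta(1)[of n] eta(2)[of n] by linarith
    then show "dist (P (Suc n)) (P n) \<le> C * (1/2)^n" by (intro sep P)
  qed
  then obtain p where p: "p \<in> M" "P \<longlonglongrightarrow> p" using M(1) P unfolding complete_def by blast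
  have summ: "summable (\<lambda>n. \<rho> n u (P n))" if "u \<in> M" for u
  proof (rule summable_comparison_test')
    show "summable (\<lambda>n. B * (1/2)^n)" by (intro summable_mult summable_geometric) simp
    show "norm (\<rho> n u (P n)) \<le> B * (1/2)^n" for n using nonneg[OF that P] bound[OF that P] by simp
  qed
  have K: "0 \<le> K * dist u v" if "u \<in> M" "v \<in> M" for u v using order_trans[OF abs_ge_zero lip[OF that that(1), of 0]] by simp
  have dist0: "(\<lambda>n. dist (P n) p) \<longlonglongrightarrow> 0" using p(2) by (rule tendsto_dist_iff[THEN iffD1])
  \<comment> \<open>Both the points and the number of summands vary with \<open>n\<close>. The
    Lipschitz constants are summable, so replacing \<open>P n\<close> by \<open>p\<close> in the
    partial sum costs at most \<open>2 * K * dist (P n) p\<close>.\<close>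
  have diff: "(\<lambda>n. (\<Sum>i<n. \<rho> i (P n) (P i)) - (\<Sum>i<n. \<rho> i p (P i))) \<longlonglongrightarrow> 0"
  proof (rule Lim_null_comparison)
    show "(\<lambda>n. 2 * K * dist (P n) p) \<longlonglongrightarrow> 0" using tendsto_mult[OF tendsto_const dist0, of "2 * K"] by simp
    show "\<forall>\<^sub>F n in sequentially. norm ((\<Sum>i<n. \<rho> i (P n) (P i)) - (\<Sum>i<n. \<rho> i p (P i))) \<le> 2 * K * dist (P n) p"
    proof (rule always_eventually, rule allI)
      fix n
      have "norm ((\<Sum>i<n. \<rho> i (P n) (P i)) - (\<Sum>i<n. \<rho> i p (P i))) = norm (\<Sum>i<n. \<rho> i (P n) (P i) - \<rho> i p (P i))"
        by (simp add: sum_subtractf)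
      also have "\<dots> \<le> (\<Sum>i<n. K * (1/2)^i * dist (P n) p)"
        by (rule sum_norm_le) (use lip[OF P p(1) P] in simp)
      also have "\<dots> = (K * dist (P n) p) * (\<Sum>i<n. (1/2)^i)" by (simp add: sum_distrib_left mult_ac)
      also have "\<dots> \<le> (K * dist (P n) p) * 2"
        by (rule mult_left_mono[OF _ K[OF P p(1)]]) (simp add: geometric_sum)
      finally show "norm ((\<Sum>i<n. \<rho> i (P n) (P i)) - (\<Sum>i<n. \<rho> i p (P i))) \<le> 2 * K * dist (P n) p" by simp
    qed
  qed
  have "(\<lambda>n. f (P n)) \<longlonglongrightarrow> f p" using cont p P unfolding continuous_on_sequentially comp_def by blast
  from tendsto_add[OF this tendsto_add[OF diff summable_LIMSEQ[OF summ[OF p(1)]]]]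
  have lim: "(\<lambda>n. f (P n) + (\<Sum>i<n. \<rho> i (P n) (P i))) \<longlonglongrightarrow> f p + (\<Sum>n. \<rho> n p (P n))" by simp
  have "f p + (\<Sum>n. \<rho> n p (P n)) \<le> f u + (\<Sum>n. \<rho> n u (P n))" if u: "u \<in> M" for u
  proof (rule LIMSEQ_le[OF lim])
    show "(\<lambda>n. f u + (\<Sum>i<n. \<rho> i u (P i)) + \<eta> n / 3) \<longlonglongrightarrow> f u + (\<Sum>n. \<rho> n u (P n))"
      by (rule tendsto_eq_intros summable_LIMSEQ[OF summ[OF u]] eta(3) refl | simp)+
  qed (use near[OF u] in auto)
  then show ?thesis using that P p(1) by blast
qed

section \<open>Smooth gauges on spaces with separable dual\<close>

lemma dual_norm_on_le:
  assumes "subspace Y" "\<And>x. x \<in> Y \<Longrightarrow> norm x \<le> 1 \<Longrightarrow> \<bar>f x\<bar> \<le> K"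
  shows "dual_norm_on Y f \<le> K"
proof -
  have "(0::'a) \<in> {x \<in> Y. norm x \<le> 1}" using assms(1) by (simp add: subspace_0)
  then show ?thesis unfolding dual_norm_on_def using assms(2) by (intro cSUP_least) auto
qed

lemma dual_norm_on_ge:
  assumes "x \<in> Y" "norm x \<le> 1" and b: "\<And>x. x \<in> Y \<Longrightarrow> \<bar>f x\<bar> \<le> K * norm x"
  shows "\<bar>f x\<bar> \<le> dual_norm_on Y f"
  unfolding dual_norm_on_def
proof (rule cSUP_upper)
  show "bdd_above ((\<lambda>x. \<bar>f x\<bar>) ` {x \<in> Y. norm x \<le> 1})"
  proof (rule bdd_aboveI2)
    fix x assume "x \<in> {x \<in> Y. norm x \<le> 1}"
    then have "\<bar>f x\<bar> \<le> K * norm x" "\<bar>K\<bar> * norm x \<le> \<bar>K\<bar> * 1" "K * norm x \<le> \<bar>K\<bar> * norm x"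
      using b mult_left_mono[of "norm x" 1 "\<bar>K\<bar>"] mult_right_mono[OF abs_ge_self norm_ge_zero] by auto
    then show "\<bar>f x\<bar> \<le> \<bar>K\<bar>" by linarith
  qed
qed (use assms in auto)

lemma dual_norm_on_bound:
  assumes Y: "subspace Y" and "x \<in> Y" and b: "\<And>x. x \<in> Y \<Longrightarrow> \<bar>f x\<bar> \<le> K * norm x"
    and s: "\<And>t x. x \<in> Y \<Longrightarrow> f (t *\<^sub>R x) = t * f x"
  shows "\<bar>f x\<bar> \<le> dual_norm_on Y f * norm x"
proof (cases "x = 0")
  case True then show ?thesis using s[of x 0] assms(2) by simp
next
  case False
  have "\<bar>f ((1 / norm x) *\<^sub>R x)\<bar> \<le> dual_norm_on Y f"
    by (rule dual_norm_on_ge[OF _ _ b]) (use False assms(1,2) in \<open>auto simp: subspace_scale\<close>)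
  then show ?thesis using False s[OF assms(2)] by (simp add: abs_mult field_simps)
qed

locale separable_dual =
  fixes Y :: "'a::real_normed_vector set" and g :: "nat \<Rightarrow> 'a \<Rightarrow> real"
  assumes subspace: "subspace Y"
    and g_dual: "g n \<in> dual_on Y"
    and g_dense: "f \<in> dual_on Y \<Longrightarrow> e > 0 \<Longrightarrow> \<exists>n. dual_norm_on Y (\<lambda>x. f x - g n x) < e"
begin

text \<open>The closed unit ball of the dual of \<open>Y\<close>. A pointwise bound and
  extensionality place it inside a product of intervals and singletons, where Tychonoff's theorem
  applies.\<close>

definition dual_ball :: "('a \<Rightarrow> real) set" where
  "dual_ball = {f \<in> extensional Y. (\<forall>x\<in>Y. \<forall>y\<in>Y. f (x + y) = f x + f y) \<and>
     (\<forall>c. \<forall>x\<in>Y. f (c *\<^sub>R x) = c * f x) \<and> (\<forall>x\<in>Y. \<bar>f x\<bar> \<le> norm x)}"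

definition dst :: "('a \<Rightarrow> real) \<Rightarrow> nat \<Rightarrow> real" where
  "dst f n = dual_norm_on Y (\<lambda>x. f x - g n x)"

text \<open>On the dual ball \<open>dst f n\<close> is at most
  \<open>1 + dual_norm_on Y (g n)\<close>, so this weight makes the \<open>n\<close>-th term of
  \<open>\<Theta>\<close> at most \<open>(1/2)^n\<close>.\<close>

definition wt :: "nat \<Rightarrow> real" where
  "wt n = (1/2)^n / (1 + dual_norm_on Y (g n))^2"

text \<open>Strict convexity of \<open>\<Theta>\<close> is quantified by the distances to the dense sequence \<open>g\<close>, which
  forces maximising sequences of \<open>f x - \<Theta> f\<close> to converge in norm; this makes the conjugate \<open>q\<close>
  Frechet differentiable.\<close>

definition \<Theta> :: "('a \<Rightarrow> real) \<Rightarrow> real" where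
  "\<Theta> f = (\<Sum>n. wt n * (dst f n)^2)"

definition q :: "'a \<Rightarrow> real" where
  "q x = (SUP f\<in>dual_ball. f x - \<Theta> f)"

lemma g_bound: obtains K where "\<And>x. x \<in> Y \<Longrightarrow> \<bar>g n x\<bar> \<le> K * norm x"
  using g_dual[of n] unfolding dual_on_def by blast

lemma g_scale: "x \<in> Y \<Longrightarrow> g n (t *\<^sub>R x) = t * g n x"
  using g_dual[of n] unfolding dual_on_def by blast

lemma dual_ballD:
  assumes "f \<in> dual_ball"
  shows "x \<in> Y \<Longrightarrow> y \<in> Y \<Longrightarrow> f (x + y) = f x + f y" "x \<in> Y \<Longrightarrow> f (t *\<^sub>R x) = t * f x"
    "x \<in> Y \<Longrightarrow> \<bar>f x\<bar> \<le> norm x" "f \<in> dual_on Y"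
  using assms unfolding dual_ball_def dual_on_def by (auto intro: exI[of _ 1])

lemma dual_ball_minus: "f \<in> dual_ball \<Longrightarrow> x \<in> Y \<Longrightarrow> f (- x) = - f x"
  using dual_ballD(2)[of f x "- 1"] by simp

lemma norm_g_nonneg: "0 \<le> dual_norm_on Y (g n)"
proof -
  obtain K where "\<And>x. x \<in> Y \<Longrightarrow> \<bar>g n x\<bar> \<le> K * norm x" using g_bound by blast
  from dual_norm_on_ge[OF subspace_0[OF subspace] _ this] show ?thesis by fastforce
qed

lemma diff_bound:
  assumes "f \<in> dual_ball"
  obtains K where "\<And>x. x \<in> Y \<Longrightarrow> \<bar>f x - g n x\<bar> \<le> K * norm x"
proof -
  obtain K where K: "\<And>x. x \<in> Y \<Longrightarrow> \<bar>g n x\<bar> \<le> K * norm x" using g_bound by blast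
  have "\<bar>f x - g n x\<bar> \<le> (1 + K) * norm x" if "x \<in> Y" for x
    using K[OF that] dual_ballD(3)[OF assms that] by (simp add: algebra_simps)
  then show ?thesis by (rule that)
qed

lemma dst_ge:
  assumes "f \<in> dual_ball" "x \<in> Y"
  shows "\<bar>f x - g n x\<bar> \<le> dst f n * norm x"
proof -
  obtain K where K: "\<And>x. x \<in> Y \<Longrightarrow> \<bar>f x - g n x\<bar> \<le> K * norm x" using diff_bound[OF assms(1)] by blast
  show ?thesis unfolding dst_def
    by (rule dual_norm_on_bound[OF subspace assms(2) K])
      (simp_all add: dual_ballD(2)[OF assms(1)] g_scale algebra_simps)
qed

lemma dst_ge1:
  assumes "f \<in> dual_ball" "x \<in> Y" "norm x \<le> 1"
  shows "\<bar>f x - g n x\<bar> \<le> dst f n"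
proof -
  obtain K where K: "\<And>x. x \<in> Y \<Longrightarrow> \<bar>f x - g n x\<bar> \<le> K * norm x" using diff_bound[OF assms(1)] by blast
  show ?thesis unfolding dst_def by (rule dual_norm_on_ge[OF assms(2,3) K])
qed

lemma dst_le: "(\<And>x. x \<in> Y \<Longrightarrow> norm x \<le> 1 \<Longrightarrow> \<bar>f x - g n x\<bar> \<le> K) \<Longrightarrow> dst f n \<le> K"
  unfolding dst_def by (rule dual_norm_on_le[OF subspace])

lemma dst_nonneg: "f \<in> dual_ball \<Longrightarrow> 0 \<le> dst f n"
  using dst_ge1[of f 0 n] subspace_0[OF subspace] by simp

lemma wt_pos: "wt n > 0"
  using norm_g_nonneg[of n] unfolding wt_def by (intro divide_pos_pos zero_less_power) auto

lemma wt_dst_le: assumes "f \<in> dual_ball" shows "wt n * (dst f n)^2 \<le> (1/2)^n"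
proof -
  have "\<bar>f x - g n x\<bar> \<le> 1 + dual_norm_on Y (g n)" if "x \<in> Y" "norm x \<le> 1" for x
  proof -
    obtain K where "\<And>x. x \<in> Y \<Longrightarrow> \<bar>g n x\<bar> \<le> K * norm x" using g_bound by blast
    from dual_norm_on_ge[OF that this] dual_ballD(3)[OF assms that(1)] that(2) show ?thesis by linarith
  qed
  then have "dst f n \<le> 1 + dual_norm_on Y (g n)" by (rule dst_le)
  then have "(dst f n)^2 \<le> (1 + dual_norm_on Y (g n))^2" using dst_nonneg[OF assms] by (intro power_mono)
  then show ?thesis unfolding wt_def using norm_g_nonneg[of n] by (simp add: divide_le_eq mult_left_mono)
qed

lemma wt_dst_nonneg: "f \<in> dual_ball \<Longrightarrow> 0 \<le> wt n * (dst f n)^2"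
  using wt_pos[of n] by simp

lemma summable_\<Theta>: assumes "f \<in> dual_ball" shows "summable (\<lambda>n. wt n * (dst f n)^2)"
proof (rule summable_comparison_test')
  show "summable (\<lambda>n. (1/2::real)^n)" by (rule summable_geometric) simp
  show "norm (wt n * (dst f n)^2) \<le> (1/2)^n" for n
    using wt_dst_le[OF assms, of n] wt_dst_nonneg[OF assms, of n] by simp
qed

lemma \<Theta>_nonneg: "f \<in> dual_ball \<Longrightarrow> 0 \<le> \<Theta> f"
  unfolding \<Theta>_def by (intro suminf_nonneg summable_\<Theta> wt_dst_nonneg)

lemma \<Theta>_le_2: "f \<in> dual_ball \<Longrightarrow> \<Theta> f \<le> 2"
  using suminf_le[OF wt_dst_le summable_\<Theta> summable_geometric[of "1/2::real"], of f]
  unfolding \<Theta>_def by (simp add: suminf_geometric)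

text \<open>Weak-star lower semicontinuity in disguise: each condition on the right involves
  finitely many point evaluations of \<open>f\<close>, hence is closed for pointwise convergence,
  whereas \<open>dst\<close> is a supremum over the unit ball.\<close>

lemma \<Theta>_le_iff:
  assumes f: "f \<in> dual_ball"
  shows "\<Theta> f \<le> b \<longleftrightarrow>
    (\<forall>N. \<forall>v. (\<forall>n. v n \<in> Y \<and> norm (v n) \<le> 1) \<longrightarrow> (\<Sum>n<N. wt n * (f (v n) - g n (v n))^2) \<le> b)" (is "?L \<longleftrightarrow> ?R")
proof
  assume L: ?L
  show ?R
  proof (intro allI impI)
    fix N :: nat and v :: "nat \<Rightarrow> 'a" assume v: "\<forall>n. v n \<in> Y \<and> norm (v n) \<le> 1"
    have "(f (v n) - g n (v n))^2 \<le> (dst f n)^2" for n :: nat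
      using power_mono[OF dst_ge1[OF f, of "v n" n], of 2] v by simp
    then have "(\<Sum>n<N. wt n * (f (v n) - g n (v n))^2) \<le> (\<Sum>n<N. wt n * (dst f n)^2)"
      using wt_pos by (intro sum_mono mult_left_mono) (auto simp: less_imp_le)
    also have "\<dots> \<le> \<Theta> f" unfolding \<Theta>_def
      by (rule sum_le_suminf[OF summable_\<Theta>[OF f]]) (use wt_dst_nonneg[OF f] in auto)
    finally show "(\<Sum>n<N. wt n * (f (v n) - g n (v n))^2) \<le> b" using L by simp
  qed
next
  assume R: ?R
  \<comment> \<open>Near-maximising vectors turn the bound on point evaluations into one on each
    finite sum of squared distances.\<close>
  have "\<exists>v. v \<in> Y \<and> norm v \<le> 1 \<and> dst f n - inverse (real (Suc k)) \<le> \<bar>f v - g n v\<bar>" for n k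
  proof (rule ccontr)
    assume "\<not> ?thesis"
    then have "dst f n \<le> dst f n - inverse (real (Suc k))" by (intro dst_le) force
    then show False by simp
  qed
  then obtain v where v: "\<And>n k. v n k \<in> Y" "\<And>n k. norm (v n k) \<le> 1"
    "\<And>n k. dst f n - inverse (real (Suc k)) \<le> \<bar>f (v n k) - g n (v n k)\<bar>" by metis
  have lim: "(\<lambda>k. \<bar>f (v n k) - g n (v n k)\<bar>) \<longlonglongrightarrow> dst f n" for n
  proof (rule tendsto_sandwich[of "\<lambda>k. dst f n - inverse (real (Suc k))" _ _ "\<lambda>k. dst f n"])
    show "(\<lambda>k. dst f n - inverse (real (Suc k))) \<longlonglongrightarrow> dst f n"
      using tendsto_diff[OF tendsto_const LIMSEQ_inverse_real_of_nat] by simp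
  qed (use v dst_ge1[OF f] in auto)
  have "(\<Sum>n<N. wt n * (dst f n)^2) \<le> b" for N
  proof (rule LIMSEQ_le_const2)
    have "(\<lambda>k. \<Sum>n<N. wt n * \<bar>f (v n k) - g n (v n k)\<bar>^2) \<longlonglongrightarrow> (\<Sum>n<N. wt n * (dst f n)^2)"
      by (intro tendsto_intros lim)
    then show "(\<lambda>k. \<Sum>n<N. wt n * (f (v n k) - g n (v n k))^2) \<longlonglongrightarrow> (\<Sum>n<N. wt n * (dst f n)^2)"
      by simp
    show "\<exists>M. \<forall>k\<ge>M. (\<Sum>n<N. wt n * (f (v n k) - g n (v n k))^2) \<le> b"
      using R[rule_format, of "\<lambda>n. v n _" N] v by simp
  qed
  then show ?L unfolding \<Theta>_def by (intro suminf_le_const summable_\<Theta> f)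
qed

lemma zero_in_dual_ball: "restrict (\<lambda>x. 0) Y \<in> dual_ball"
  unfolding dual_ball_def using subspace by (auto simp: subspace_add subspace_scale)

lemma q_upper:
  assumes "x \<in> Y" "f \<in> dual_ball" shows "f x - \<Theta> f \<le> q x"
  unfolding q_def
proof (rule cSUP_upper[OF assms(2)])
  show "bdd_above ((\<lambda>f. f x - \<Theta> f) ` dual_ball)"
  proof (rule bdd_aboveI2)
    fix f assume "f \<in> dual_ball"
    then show "f x - \<Theta> f \<le> norm x" using dual_ballD(3)[of f x] \<Theta>_nonneg[of f] assms(1) by linarith
  qed
qed

lemma compact_dual_box:
  "compact {f. \<forall>x. f x \<in> (if x \<in> Y then {- norm x .. norm x} else {undefined})}" (is "compact ?K")
proof -
  have "?K = Pi\<^sub>E UNIV (\<lambda>x. if x \<in> Y then {- norm x .. norm x} else {undefined})"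
    by (simp add: PiE_UNIV_domain Pi_def)
  moreover have "compactin (product_topology (\<lambda>x. euclidean) UNIV)
      (Pi\<^sub>E UNIV (\<lambda>x. if x \<in> Y then {- norm x .. norm x :: real} else {undefined}))"
    by (auto simp: compactin_PiE compactin_euclidean_iff)
  ultimately show ?thesis by (simp add: euclidean_product_topology compactin_euclidean_iff)
qed

text \<open>The Banach-Alaoglu argument by hand: \<open>K \<inter> S e\<close> is the set of
  maximisers up to \<open>e\<close>, it is closed in a compact product, and it grows with
  \<open>e\<close>, so finite intersections are nonempty.\<close>

lemma q_attained:
  assumes x: "x \<in> Y"
  obtains a where "a \<in> dual_ball" "q x = a x - \<Theta> a"
proof -
  define K where "K = {f. \<forall>x. f x \<in> (if x \<in> Y then {- norm x .. norm x} else {undefined})}"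
  define S where "S e = {f. (\<forall>x\<in>Y. \<forall>y\<in>Y. f (x + y) = f x + f y) \<and> (\<forall>c. \<forall>x\<in>Y. f (c *\<^sub>R x) = c * f x) \<and>
    (\<forall>N. \<forall>v. (\<forall>n. v n \<in> Y \<and> norm (v n) \<le> 1) \<longrightarrow> (\<Sum>n<N. wt n * (f (v n) - g n (v n))^2) \<le> f x - (q x - e))}" for e
  have dual_ball_iff: "f \<in> K \<and> (\<forall>x\<in>Y. \<forall>y\<in>Y. f (x + y) = f x + f y) \<and> (\<forall>c. \<forall>x\<in>Y. f (c *\<^sub>R x) = c * f x) \<longleftrightarrow> f \<in> dual_ball" for f
  proof -
    have "f \<in> K \<longleftrightarrow> f \<in> extensional Y \<and> (\<forall>x\<in>Y. \<bar>f x\<bar> \<le> norm x)"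
      unfolding K_def extensional_def by (auto simp: abs_le_iff split: if_splits)
    then show ?thesis unfolding dual_ball_def by blast
  qed
  have KS: "f \<in> K \<inter> S e \<longleftrightarrow> f \<in> dual_ball \<and> q x - e \<le> f x - \<Theta> f" for f e
  proof -
    have "f \<in> K \<inter> S e \<longleftrightarrow> f \<in> dual_ball \<and> \<Theta> f \<le> f x - (q x - e)"
      using dual_ball_iff[of f] \<Theta>_le_iff[of f "f x - (q x - e)"] unfolding S_def by blast
    then show ?thesis by (auto simp: algebra_simps)
  qed
  have cont: "continuous_on UNIV (\<lambda>f::'a \<Rightarrow> real. f z)" for z
    by (rule continuous_on_product_coordinates)
  have closed: "closed (S e)" for e
    unfolding S_def Ball_def
    by (intro closed_Collect_conj closed_Collect_all closed_Collect_imp open_Collect_const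
        closed_Collect_eq closed_Collect_le continuous_intros cont)
  have "K \<inter> (\<Inter>e\<in>{0<..}. S e) \<noteq> {}"
  proof (rule compact_imp_fip_image)
    show "compact K" unfolding K_def by (rule compact_dual_box)
    show "closed (S e)" for e by (rule closed)
    fix I :: "real set" assume I: "finite I" "I \<subseteq> {0<..}"
    \<comment> \<open>The smallest tolerance works for all of \<open>I\<close>; the \<open>1\<close>
      covers empty \<open>I\<close>.\<close>
    define m where "m = Min (insert 1 I)"
    have m: "m > 0" "\<And>e. e \<in> I \<Longrightarrow> m \<le> e" unfolding m_def using I by (auto simp: subset_iff)
    have "\<exists>f\<in>dual_ball. q x - m < f x - \<Theta> f"
    proof (rule ccontr)
      assume "\<not> ?thesis"
      then have "q x \<le> q x - m" unfolding q_def using zero_in_dual_ball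
        by (intro cSUP_least) (auto simp: not_less q_def)
      then show False using m by simp
    qed
    then obtain f where "f \<in> dual_ball" "q x - m \<le> f x - \<Theta> f" by force
    then have "f \<in> K \<inter> S e" if "e \<in> I" for e using KS m(2)[OF that] by auto
    moreover have "f \<in> K" using KS[of f m] \<open>f \<in> dual_ball\<close> \<open>q x - m \<le> f x - \<Theta> f\<close> by blast
    ultimately show "K \<inter> (\<Inter>e\<in>I. S e) \<noteq> {}" by blast
  qed
  then obtain a where "a \<in> K \<inter> (\<Inter>e\<in>{0<..}. S e)" by blast
  then have a: "a \<in> K \<inter> S e" if "e > 0" for e using that by simp
  have "q x \<le> (a x - \<Theta> a) + e" if "e > 0" for e using a[OF that] KS[of a e] by auto
  then have "q x \<le> a x - \<Theta> a" by (rule field_le_epsilon)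
  moreover have "a \<in> dual_ball" using a[of 1] KS by auto
  ultimately show ?thesis using that[of a] q_upper[OF x, of a] by auto
qed

lemma midpoint_in_dual_ball:
  assumes "a \<in> dual_ball" "b \<in> dual_ball"
  shows "restrict (\<lambda>x. (a x + b x) / 2) Y \<in> dual_ball"
proof -
  have "\<bar>(a x + b x) / 2\<bar> \<le> norm x" if "x \<in> Y" for x
  proof -
    have "\<bar>a x + b x\<bar> \<le> 2 * norm x"
      using dual_ballD(3)[OF assms(1) that] dual_ballD(3)[OF assms(2) that] by linarith
    then show ?thesis by simp
  qed
  then show ?thesis
    unfolding dual_ball_def using subspace dual_ballD(1,2)[OF assms(1)] dual_ballD(1,2)[OF assms(2)]
    by (auto simp: subspace_add subspace_scale field_simps)
qed

text \<open>The parallelogram identity for \<open>dst a k\<close> and \<open>dst b k\<close>, summed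
  over \<open>k\<close>. The quadratic gain is discarded except at the index
  \<open>n\<close>.\<close>

lemma \<Theta>_midpoint:
  assumes a: "a \<in> dual_ball" and b: "b \<in> dual_ball"
  shows "\<Theta> (restrict (\<lambda>x. (a x + b x) / 2) Y) + wt n / 4 * (dst a n - dst b n)^2 \<le> (\<Theta> a + \<Theta> b) / 2"
proof -
  define m where "m = restrict (\<lambda>x. (a x + b x) / 2) Y"
  have m: "m \<in> dual_ball" unfolding m_def by (rule midpoint_in_dual_ball[OF assms])
  have dm: "dst m k \<le> (dst a k + dst b k) / 2" for k
  proof (rule dst_le)
    fix x assume x: "x \<in> Y" "norm x \<le> 1"
    then have "m x - g k x = ((a x - g k x) + (b x - g k x)) / 2" by (simp add: m_def field_simps)
    moreover have "\<bar>(a x - g k x) + (b x - g k x)\<bar> \<le> dst a k + dst b k"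
      using dst_ge1[OF a x, of k] dst_ge1[OF b x, of k] by linarith
    ultimately show "\<bar>m x - g k x\<bar> \<le> (dst a k + dst b k) / 2" by (simp only:) simp
  qed
  have step: "wt k * (dst m k)^2 + wt k / 4 * (dst a k - dst b k)^2 \<le> (wt k * (dst a k)^2 + wt k * (dst b k)^2) / 2" for k
  proof -
    have "(dst m k)^2 \<le> ((dst a k + dst b k) / 2)^2" using dm dst_nonneg[OF m] by (rule power_mono)
    then have "(dst m k)^2 + (dst a k - dst b k)^2 / 4 \<le> ((dst a k)^2 + (dst b k)^2) / 2"
      by (simp add: power2_eq_square field_simps)
    from mult_left_mono[OF this, of "wt k"] wt_pos[of k] show ?thesis by (simp add: field_simps)
  qed
  have "(\<Sum>k. wt k * (dst m k)^2 + (if k = n then wt n / 4 * (dst a n - dst b n)^2 else 0))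
      \<le> (\<Sum>k. (wt k * (dst a k)^2 + wt k * (dst b k)^2) / 2)"
  proof (rule suminf_le)
    fix k
    have "0 \<le> wt k / 4 * (dst a k - dst b k)^2" using wt_pos[of k] by simp
    then show "wt k * (dst m k)^2 + (if k = n then wt n / 4 * (dst a n - dst b n)^2 else 0)
        \<le> (wt k * (dst a k)^2 + wt k * (dst b k)^2) / 2" using step[of k] by auto
    show "summable (\<lambda>k. wt k * (dst m k)^2 + (if k = n then wt n / 4 * (dst a n - dst b n)^2 else 0))"
      by (intro summable_add summable_\<Theta>[OF m]) simp
    show "summable (\<lambda>k. (wt k * (dst a k)^2 + wt k * (dst b k)^2) / 2)"
      by (intro summable_divide summable_add summable_\<Theta> a b)
  qed
  moreover have "(\<Sum>k. wt k * (dst m k)^2 + (if k = n then wt n / 4 * (dst a n - dst b n)^2 else 0))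
      = \<Theta> m + wt n / 4 * (dst a n - dst b n)^2"
    unfolding \<Theta>_def using suminf_add[OF summable_\<Theta>[OF m], of "\<lambda>k. if k = n then wt n / 4 * (dst a n - dst b n)^2 else 0"]
      sums_unique[OF sums_single[of n "\<lambda>_. wt n / 4 * (dst a n - dst b n)^2"]] by auto
  moreover have "(\<Sum>k. (wt k * (dst a k)^2 + wt k * (dst b k)^2) / 2) = (\<Theta> a + \<Theta> b) / 2"
    unfolding \<Theta>_def using suminf_divide[OF summable_add[OF summable_\<Theta>[OF a] summable_\<Theta>[OF b]], of 2]
      suminf_add[OF summable_\<Theta>[OF a] summable_\<Theta>[OF b]] by simp
  ultimately show ?thesis unfolding m_def[symmetric] by linarith
qed

text \<open>Choose \<open>g n\<close> within \<open>t / 3\<close> of the maximiser \<open>a\<close>.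
  If \<open>dst b n\<close> differed much from \<open>dst a n\<close>, the midpoint of
  \<open>a\<close> and \<open>b\<close> would beat the supremum; so \<open>b\<close> is also close
  to \<open>g n\<close>, and hence to \<open>a\<close> in norm.\<close>

lemma near_maximizer_close:
  assumes x: "x \<in> Y" and a: "a \<in> dual_ball" "q x = a x - \<Theta> a" and t: "t > 0"
  obtains s where "s > 0"
    "\<And>b y. b \<in> dual_ball \<Longrightarrow> q x - s \<le> b x - \<Theta> b \<Longrightarrow> y \<in> Y \<Longrightarrow> \<bar>b y - a y\<bar> \<le> t * norm y"
proof -
  obtain n where n: "dst a n < t / 3" using g_dense[OF dual_ballD(4)[OF a(1)], of "t / 3"] t unfolding dst_def by auto
  \<comment> \<open>Near-maximality up to \<open>s\<close> costs \<open>s / 2\<close> at the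
    midpoint, and this equals \<open>wt n / 4 * (t / 3)^2\<close>, the gain at a difference of
    \<open>t / 3\<close>.\<close>
  define s where "s = wt n / 2 * (t / 3)^2"
  have s: "s > 0" unfolding s_def using wt_pos[of n] t by simp
  show ?thesis
  proof (rule that[OF s])
    fix b y assume b: "b \<in> dual_ball" "q x - s \<le> b x - \<Theta> b" and y: "y \<in> Y"
    define m where "m = restrict (\<lambda>x. (a x + b x) / 2) Y"
    have "m x - \<Theta> m \<le> q x" unfolding m_def by (rule q_upper[OF x midpoint_in_dual_ball[OF a(1) b(1)]])
    moreover have "m x = (a x + b x) / 2" using x by (simp add: m_def)
    ultimately have "wt n / 4 * (dst a n - dst b n)^2 \<le> s / 2"
      using \<Theta>_midpoint[OF a(1) b(1), of n] a(2) b(2) unfolding m_def[symmetric] by argo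
    then have "(dst a n - dst b n)^2 \<le> (t / 3)^2" unfolding s_def using wt_pos[of n] by (simp add: field_simps)
    then have "\<bar>dst a n - dst b n\<bar> \<le> \<bar>t / 3\<bar>" by (simp only: abs_le_square_iff)
    then have "dst b n - dst a n \<le> t / 3" using t by linarith
    then have "dst a n + dst b n \<le> t" using n by linarith
    then have "(dst a n + dst b n) * norm y \<le> t * norm y" by (rule mult_right_mono) simp
    moreover have "\<bar>b y - a y\<bar> \<le> (dst a n + dst b n) * norm y"
      using dst_ge[OF a(1) y, of n] dst_ge[OF b(1) y, of n] by (simp add: distrib_right)
    ultimately show "\<bar>b y - a y\<bar> \<le> t * norm y" by linarith
  qed
qed

text \<open>It allows a maximiser at a neighbouring point to compete at \<open>x\<close>.\<close>

lemma q_shift: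
  assumes "x \<in> Y" "h \<in> Y" "b \<in> dual_ball" "q (x + h) = b (x + h) - \<Theta> b"
  shows "b x - \<Theta> b = q (x + h) - b h"
  using dual_ballD(1)[OF assms(3,1,2)] assms(4) by linarith

lemma q_Lipschitz:
  assumes "x \<in> Y" "y \<in> Y" shows "\<bar>q x - q y\<bar> \<le> norm (x - y)"
proof -
  have "q v - q u \<le> norm (v - u)" if u: "u \<in> Y" and v: "v \<in> Y" for u v
  proof -
    obtain b where b: "b \<in> dual_ball" "q v = b v - \<Theta> b" using q_attained[OF v] by blast
    have "v - u \<in> Y" using u v subspace by (simp add: subspace_diff)
    then show ?thesis using q_shift[of u "v - u" b] q_upper[OF u b(1)] dual_ballD(3)[OF b(1), of "v - u"] b u by simp
  qed
  from this[of x y] this[of y x] show ?thesis using assms by (simp add: norm_minus_commute abs_le_iff)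
qed

text \<open>The derivative is the maximiser \<open>a\<close> at \<open>x\<close>. From below,
  \<open>a\<close> competes at \<open>y\<close>; from above, the maximiser \<open>b\<close> at
  \<open>y\<close> is nearly maximal at \<open>x\<close> and therefore close to \<open>a\<close>.
  The extension \<open>G\<close> is there because \<open>Y\<close> is not a type.\<close>

lemma q_has_derivative:
  assumes x: "x \<in> Y"
  obtains G :: "'a \<Rightarrow>\<^sub>L real" where "norm G \<le> 1" "(q has_derivative blinfun_apply G) (at x within Y)"
proof -
  obtain a where a: "a \<in> dual_ball" "q x = a x - \<Theta> a" using q_attained[OF x] by blast
  obtain G :: "'a \<Rightarrow>\<^sub>L real" where G: "norm G \<le> 1" "\<And>y. y \<in> Y \<Longrightarrow> G y = a y"
    by (rule blinfun_extension[OF subspace, of a 1]) (use dual_ballD[OF a(1)] in auto)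
  have "\<exists>d>0. \<forall>y\<in>Y. norm (y - x) < d \<longrightarrow> norm (q y - q x - G (y - x)) \<le> e * norm (y - x)" if "e > 0" for e
  proof -
    obtain s where s: "s > 0"
      "\<And>b y. b \<in> dual_ball \<Longrightarrow> q x - s \<le> b x - \<Theta> b \<Longrightarrow> y \<in> Y \<Longrightarrow> \<bar>b y - a y\<bar> \<le> e * norm y"
      using near_maximizer_close[OF x a \<open>e > 0\<close>] by blast
    \<comment> \<open>Both \<open>a\<close> and \<open>b\<close> have norm at most one, so
      \<open>b\<close> loses at most \<open>2 * norm (y - x)\<close> at \<open>x\<close>; the radius
      \<open>s / 2\<close> keeps this below \<open>s\<close>.\<close>
    have "norm (q y - q x - G (y - x)) \<le> e * norm (y - x)" if y: "y \<in> Y" "norm (y - x) < s / 2" for y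
    proof -
      obtain b where b: "b \<in> dual_ball" "q y = b y - \<Theta> b" using q_attained[OF y(1)] by blast
      have h: "y - x \<in> Y" using x y subspace by (simp add: subspace_diff)
      have bx: "b x - \<Theta> b = q y - b (y - x)" using q_shift[OF x h b(1)] b by simp
      have "a (x + (y - x)) = a x + a (y - x)" by (rule dual_ballD(1)[OF a(1) x h])
      then have ya: "a y - \<Theta> a = q x + a (y - x)" unfolding a(2) by simp
      have low: "q x + a (y - x) \<le> q y" using q_upper[OF y(1) a(1)] unfolding ya .
      have "- a (y - x) \<le> norm (y - x)" "b (y - x) \<le> norm (y - x)"
        using dual_ballD(3)[OF a(1) h] dual_ballD(3)[OF b(1) h] by (auto simp: abs_le_iff)
      then have "q x - s \<le> b x - \<Theta> b" unfolding bx using low y(2) by linarith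
      from s(2)[OF b(1) this h] have "\<bar>b (y - x) - a (y - x)\<bar> \<le> e * norm (y - x)" .
      then have "b (y - x) - a (y - x) \<le> e * norm (y - x)" by (rule abs_le_D1)
      moreover have "q y - b (y - x) \<le> q x" using q_upper[OF x b(1)] unfolding bx .
      ultimately have "\<bar>q y - q x - a (y - x)\<bar> \<le> e * norm (y - x)" using low by linarith
      then show ?thesis unfolding G(2)[OF h] real_norm_def .
    qed
    then show ?thesis using s(1) by (intro exI[of _ "s / 2"]) auto
  qed
  then have "(q has_derivative blinfun_apply G) (at x within Y)"
    unfolding has_derivative_within_alt by (simp add: blinfun.bounded_linear_right)
  then show ?thesis using that G(1) by blast
qed

lemma q_zero_le: "q 0 \<le> 0"
proof -
  have 0: "0 \<in> Y" using subspace by (rule subspace_0)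
  obtain a where "a \<in> dual_ball" "q 0 = a 0 - \<Theta> a" using q_attained[OF 0] by blast
  then show ?thesis using dual_ballD(3)[of a 0] 0 \<Theta>_nonneg[of a] by simp
qed

lemma q_ge: assumes "x \<in> Y" shows "norm x - 2 \<le> q x"
proof -
  obtain f :: "'a \<Rightarrow>\<^sub>L real" where f: "norm f \<le> 1" "f x = norm x" using norming_functional by blast
  have "\<bar>f y\<bar> \<le> norm y" for y
    using norm_blinfun[of f y] mult_right_mono[OF f(1), of "norm y"] by simp
  then have "restrict (blinfun_apply f) Y \<in> dual_ball"
    unfolding dual_ball_def using subspace
    by (auto simp: subspace_add subspace_scale blinfun.add_right blinfun.scaleR_right)
  from q_upper[OF assms this] \<Theta>_le_2[OF this] show ?thesis using f(2) assms by simp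
qed

lemma q_convex_zero: assumes "x \<in> Y" shows "2 * q 0 \<le> q x + q (- x)"
proof -
  have 0: "0 \<in> Y" using subspace by (rule subspace_0)
  obtain a where a: "a \<in> dual_ball" "q 0 = a 0 - \<Theta> a" using q_attained[OF 0] by blast
  have "a 0 = 0" using dual_ballD(3)[OF a(1) 0] by simp
  then show ?thesis
    using q_upper[OF assms a(1)] q_upper[OF _ a(1), of "- x"] assms subspace_neg[OF subspace assms] dual_ball_minus[OF a(1) assms] a(2)
    by simp
qed

end

text \<open>A substitute for a smooth norm, without homogeneity: small values only confine the
  argument to the ball of radius \<open>3\<close>, so finer control needs rescaled arguments. The
  constants are those of \<open>q x + q (- x) - 2 * q 0\<close>: \<open>q\<close> is 1-Lipschitz and
  at least \<open>norm x - 2\<close>.\<close>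

definition smooth_gauge :: "'a::real_normed_vector set \<Rightarrow> ('a \<Rightarrow> real) \<Rightarrow> bool" where
  "smooth_gauge Y Q \<longleftrightarrow> Q 0 = 0 \<and> (\<forall>x\<in>Y. 0 \<le> Q x) \<and> (\<forall>x\<in>Y. norm x \<ge> 3 \<longrightarrow> Q x \<ge> 2) \<and>
     (\<forall>x\<in>Y. \<forall>y\<in>Y. \<bar>Q x - Q y\<bar> \<le> 2 * norm (x - y)) \<and>
     (\<forall>x\<in>Y. \<exists>G :: 'a \<Rightarrow>\<^sub>L real. norm G \<le> 2 \<and> (Q has_derivative blinfun_apply G) (at x within Y))"

theorem exists_smooth_gauge:
  assumes "subspace Y" "separable_dual_on Y"
  obtains Q where "smooth_gauge Y Q"
proof -
  obtain D where D: "countable D" "D \<subseteq> dual_on Y"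
    "\<forall>f\<in>dual_on Y. \<forall>e>0. \<exists>g\<in>D. dual_norm_on Y (\<lambda>x. f x - g x) < e"
    using assms(2) unfolding separable_dual_on_def by blast
  have "restrict (\<lambda>x. 0) Y \<in> dual_on Y"
    unfolding dual_on_def using assms(1) by (auto simp: subspace_add subspace_scale intro: exI[of _ 0])
  then have ne: "D \<noteq> {}" using D(3) by (metis ex_in_conv zero_less_one)
  interpret separable_dual Y "from_nat_into D"
  proof
    show "from_nat_into D n \<in> dual_on Y" for n using from_nat_into[OF ne] D(2) by blast
    show "\<exists>n. dual_norm_on Y (\<lambda>x. f x - from_nat_into D n x) < e" if "f \<in> dual_on Y" "e > 0" for f e
      using D(3) that from_nat_into_surj[OF D(1)] by metis
  qed (rule assms(1))
  \<comment> \<open>Symmetrising moves the minimum to \<open>0\<close>; \<open>q\<close> alone may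
    have a nonzero slope there.\<close>
  define Q where "Q x = q x + q (- x) - 2 * q 0" for x
  have "Q 0 = 0" by (simp add: Q_def)
  moreover have "0 \<le> Q x" if "x \<in> Y" for x using q_convex_zero[OF that] by (simp add: Q_def)
  moreover have "Q x \<ge> 2" if "x \<in> Y" "norm x \<ge> 3" for x
    using q_ge[OF that(1)] q_ge[OF subspace_neg[OF subspace that(1)]] q_zero_le that(2) by (simp add: Q_def)
  moreover have "\<bar>Q x - Q y\<bar> \<le> 2 * norm (x - y)" if "x \<in> Y" "y \<in> Y" for x y
    using q_Lipschitz[OF that] q_Lipschitz[of "- x" "- y"] that subspace_neg[OF subspace]
    by (simp add: Q_def norm_minus_commute)
  moreover have "\<exists>G :: 'a \<Rightarrow>\<^sub>L real. norm G \<le> 2 \<and> (Q has_derivative blinfun_apply G) (at x within Y)" if x: "x \<in> Y" for x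
  proof -
    obtain G1 :: "'a \<Rightarrow>\<^sub>L real" where G1: "norm G1 \<le> 1" "(q has_derivative blinfun_apply G1) (at x within Y)"
      using q_has_derivative[OF x] by blast
    have nx: "- x \<in> Y" using x subspace by (simp add: subspace_neg)
    obtain G2 :: "'a \<Rightarrow>\<^sub>L real" where G2: "norm G2 \<le> 1" "(q has_derivative blinfun_apply G2) (at (- x) within Y)"
      using q_has_derivative[OF nx] by blast
    have "((\<lambda>x. q (- x)) has_derivative (\<lambda>h. G2 (- h))) (at x within Y)"
    proof (rule has_derivative_in_compose[of uminus uminus, unfolded comp_def])
      show "(q has_derivative blinfun_apply G2) (at (- x) within uminus ` Y)"
        by (rule has_derivative_subset[OF G2(2)]) (use subspace in \<open>auto simp: subspace_neg\<close>)
    qed (intro derivative_intros)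
    then have "(Q has_derivative (\<lambda>h. G1 h + G2 (- h) - 0)) (at x within Y)"
      unfolding Q_def by (intro derivative_intros G1)
    moreover have "(\<lambda>h. G1 h + G2 (- h) - 0) = blinfun_apply (G1 - G2)"
      by (auto simp: blinfun.diff_left blinfun.minus_right)
    moreover have "norm (G1 - G2) \<le> 2" using norm_triangle_ineq4[of G1 G2] G1(1) G2(1) by linarith
    ultimately show ?thesis by metis
  qed
  ultimately have "smooth_gauge Y Q" unfolding smooth_gauge_def by blast
  then show ?thesis by (rule that)
qed

section \<open>Separable reduction\<close>

lemma isCont_tendsto_nhds: "isCont f x \<Longrightarrow> (f \<longlongrightarrow> f x) (nhds x)"
  unfolding isCont_def tendsto_at_iff_tendsto_nhds .

text \<open>The defining condition of Frechet normals at \<open>w\<close> in countably many parameters: a pair \<open>(j, d)\<close> in \<open>J\<close>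
  demands slope at most \<open>1 / Suc j\<close> on the points of \<open>U\<close> within distance \<open>1 / Suc d\<close> of \<open>w\<close>.\<close>

definition normal_constraints ::
    "(nat \<times> nat) set \<Rightarrow> ('a::real_normed_vector \<times> real) set \<Rightarrow> 'a set \<Rightarrow> 'a \<Rightarrow> ('a \<times> real) set" where
  "normal_constraints J R U w =
     {(u - w, norm (u - w) / real (Suc j)) |u j d. u \<in> U \<and> (j, d) \<in> J \<and> norm (u - w) < 1 / real (Suc d)} \<union> R"

text \<open>This negates the hypothesis of \<open>exists_blinfun_constraints\<close>. The element
  \<open>z\<close> is a certificate that no functional of norm at most \<open>c\<close> satisfies
  the constraints.\<close>

definition infeasible ::
    "real \<Rightarrow> (nat \<times> nat) set \<Rightarrow> ('a::real_normed_vector \<times> real) set \<Rightarrow> 'a set \<Rightarrow> 'a \<Rightarrow> bool" where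
  "infeasible c J R U w \<longleftrightarrow> (\<exists>z\<in>generated_cone (normal_constraints J R U w). snd z + c * norm (fst z) < 0)"

lemma generated_cone_normal_constraints_mono:
  assumes "z \<in> generated_cone (normal_constraints J R U w)" "J \<subseteq> J'" "U \<subseteq> U'"
  shows "z \<in> generated_cone (normal_constraints J' R U' w)"
  by (rule generated_cone_mono[OF assms(1)]) (use assms(2,3) in \<open>unfold normal_constraints_def, blast\<close>)

lemma infeasible_mono:
  "infeasible c J R U w \<Longrightarrow> J \<subseteq> J' \<Longrightarrow> U \<subseteq> U' \<Longrightarrow> infeasible c J' R U' w"
  unfolding infeasible_def using generated_cone_normal_constraints_mono by blast

text \<open>A cone element uses finitely many \<open>u\<close> and \<open>(j, d)\<close>. The same
  combination with \<open>w'\<close> in place of \<open>w\<close> depends continuously on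
  \<open>w'\<close>, and the strict inequality \<open>norm (u - w) < 1 / real (Suc d)\<close>
  persists nearby, so it stays admissible.\<close>

lemma generated_cone_normal_constraints_stable:
  assumes "z \<in> generated_cone (normal_constraints J R U w)"
  shows "\<exists>J' U' \<zeta>. finite J' \<and> J' \<subseteq> J \<and> finite U' \<and> U' \<subseteq> U \<and> \<zeta> w = z \<and> isCont \<zeta> w \<and>
    (\<forall>\<^sub>F w' in nhds w. \<zeta> w' \<in> generated_cone (normal_constraints J' R U' w'))"
  using assms
proof induction
  case zero
  show ?case by (intro exI[of _ "{}"] exI[of _ "\<lambda>_. 0"]) (simp add: generated_cone.zero)
next
  case (step x t y)
  then obtain J' U' \<zeta> where IH: "finite J'" "J' \<subseteq> J" "finite U'" "U' \<subseteq> U" "\<zeta> w = y" "isCont \<zeta> w"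
    "\<forall>\<^sub>F w' in nhds w. \<zeta> w' \<in> generated_cone (normal_constraints J' R U' w')" by blast
  consider "x \<in> R" | u j d where "x = (u - w, norm (u - w) / real (Suc j))" "u \<in> U" "(j, d) \<in> J" "norm (u - w) < 1 / real (Suc d)"
    using step.hyps(1) unfolding normal_constraints_def by blast
  then show ?case
  proof cases
    case 1
    have "\<forall>\<^sub>F w' in nhds w. t *\<^sub>R x + \<zeta> w' \<in> generated_cone (normal_constraints J' R U' w')"
      using IH(7)
    proof eventually_elim
      case (elim w')
      show ?case by (rule generated_cone.step[OF _ step.hyps(2) elim]) (use 1 in \<open>simp add: normal_constraints_def\<close>)
    qed
    moreover have "isCont (\<lambda>w'. t *\<^sub>R x + \<zeta> w') w" by (intro continuous_intros IH)
    ultimately show ?thesis using IH by (intro exI[of _ J'] exI[of _ U'] exI[of _ "\<lambda>w'. t *\<^sub>R x + \<zeta> w'"]) auto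
  next
    case 2
    define \<xi> where "\<xi> w' = (u - w', norm (u - w') / real (Suc j))" for w'
    have "isCont (\<lambda>w'. norm (u - w')) w" by (intro continuous_intros)
    then have "((\<lambda>w'. norm (u - w')) \<longlongrightarrow> norm (u - w)) (nhds w)" by (rule isCont_tendsto_nhds)
    then have "\<forall>\<^sub>F w' in nhds w. norm (u - w') < 1 / real (Suc d)" using 2(4) by (rule order_tendstoD)
    then have "\<forall>\<^sub>F w' in nhds w. t *\<^sub>R \<xi> w' + \<zeta> w' \<in> generated_cone (normal_constraints (insert (j, d) J') R (insert u U') w')"
      using IH(7)
    proof eventually_elim
      case (elim w')
      show ?case
      proof (rule generated_cone.step[OF _ step.hyps(2)])
        show "\<xi> w' \<in> normal_constraints (insert (j, d) J') R (insert u U') w'"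
          using elim(1) unfolding \<xi>_def normal_constraints_def by blast
        show "\<zeta> w' \<in> generated_cone (normal_constraints (insert (j, d) J') R (insert u U') w')"
          using elim(2) by (rule generated_cone_normal_constraints_mono) auto
      qed
    qed
    moreover have "isCont (\<lambda>w'. t *\<^sub>R \<xi> w' + \<zeta> w') w" unfolding \<xi>_def by (intro continuous_intros IH) simp
    ultimately show ?thesis using IH 2
      by (intro exI[of _ "insert (j, d) J'"] exI[of _ "insert u U'"] exI[of _ "\<lambda>w'. t *\<^sub>R \<xi> w' + \<zeta> w'"]) (auto simp: \<xi>_def)
  qed
qed

text \<open>The certificate inequality is strict, so it survives the continuous change of the
  certificate.\<close>

lemma infeasible_stable:
  assumes "infeasible c J R U w"
  obtains J' U' where "finite J'" "J' \<subseteq> J" "finite U'" "U' \<subseteq> U" "\<forall>\<^sub>F w' in nhds w. infeasible c J' R U' w'"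
proof -
  obtain z where z: "z \<in> generated_cone (normal_constraints J R U w)" "snd z + c * norm (fst z) < 0"
    using assms unfolding infeasible_def by blast
  obtain J' U' \<zeta> where J': "finite J'" "J' \<subseteq> J" "finite U'" "U' \<subseteq> U" and \<zeta>: "\<zeta> w = z" "isCont \<zeta> w"
    "\<forall>\<^sub>F w' in nhds w. \<zeta> w' \<in> generated_cone (normal_constraints J' R U' w')"
    using generated_cone_normal_constraints_stable[OF z(1)] by blast
  have "isCont (\<lambda>w'. snd (\<zeta> w') + c * norm (fst (\<zeta> w'))) w" by (intro continuous_intros \<zeta>)
  then have "((\<lambda>w'. snd (\<zeta> w') + c * norm (fst (\<zeta> w'))) \<longlongrightarrow> snd z + c * norm (fst z)) (nhds w)"
    using isCont_tendsto_nhds \<zeta>(1) by fastforce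
  then have "\<forall>\<^sub>F w' in nhds w. snd (\<zeta> w') + c * norm (fst (\<zeta> w')) < 0" using z(2) by (rule order_tendstoD)
  with \<zeta>(3) have "\<forall>\<^sub>F w' in nhds w. infeasible c J' R U' w'"
    by eventually_elim (auto simp: infeasible_def)
  then show ?thesis using that J' by blast
qed

lemma not_infeasible:
  fixes xs :: "'a::real_normed_vector \<Rightarrow>\<^sub>L real"
  assumes "norm xs \<le> c" "\<And>x b. (x, b) \<in> R \<Longrightarrow> xs x \<le> b"
    and "\<And>u j d. u \<in> U \<Longrightarrow> (j, d) \<in> J \<Longrightarrow> norm (u - w) < 1 / real (Suc d) \<Longrightarrow> xs (u - w) \<le> norm (u - w) / real (Suc j)"
  shows "\<not> infeasible c J R U w"
proof -
  have le: "xs (fst z) \<le> snd z" if "z \<in> generated_cone (normal_constraints J R U w)" for z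
    using that
  proof induction
    case (step x t y)
    have "xs (fst x) \<le> snd x" using step.hyps(1) assms(2,3) unfolding normal_constraints_def by force
    then have "t * xs (fst x) \<le> t * snd x" using step.hyps(2) by (rule mult_left_mono)
    then show ?case using step.IH by (simp add: blinfun.add_right blinfun.scaleR_right)
  qed simp
  have "0 \<le> snd z + c * norm (fst z)" if "z \<in> generated_cone (normal_constraints J R U w)" for z
  proof -
    have "- xs (fst z) \<le> norm xs * norm (fst z)" using norm_blinfun[of xs "fst z"] by simp
    also have "\<dots> \<le> c * norm (fst z)" by (rule mult_right_mono[OF assms(1)]) simp
    finally show ?thesis using le[OF that] by linarith
  qed
  then show ?thesis unfolding infeasible_def by (auto simp: not_less)
qed

section \<open>Countable saturation and separable subspaces\<close>

lemma countable_closed_under: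
  fixes N :: "'a \<Rightarrow> 'a \<Rightarrow> 'a set"
  assumes "countable S" "\<And>x y. countable (N x y)"
  shows "\<exists>C. countable C \<and> S \<subseteq> C \<and> (\<forall>x\<in>C. \<forall>y\<in>C. N x y \<subseteq> C)"
proof -
  define step where "step C = C \<union> (\<Union>x\<in>C. \<Union>y\<in>C. N x y)" for C
  define C where "C n = (step ^^ n) S" for n
  have C_Suc: "C (Suc n) = C n \<union> (\<Union>x\<in>C n. \<Union>y\<in>C n. N x y)" for n by (simp add: C_def step_def)
  have "countable (C n)" for n
  proof (induction n)
    case 0 then show ?case by (simp add: C_def assms(1))
  next
    case (Suc n) then show ?case unfolding C_Suc using assms(2) by (intro countable_Un countable_UN)
  qed
  then have "countable (\<Union>n. C n)" by simp
  moreover have "S \<subseteq> (\<Union>n. C n)" using UN_upper[of 0 UNIV C] by (simp add: C_def)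
  moreover have "N x y \<subseteq> (\<Union>n. C n)" if xy: "x \<in> (\<Union>n. C n)" "y \<in> (\<Union>n. C n)" for x y
  proof -
    have inc: "C m \<subseteq> C n" if "m \<le> n" for m n using that by (rule lift_Suc_mono_le[of C, rotated]) (auto simp: C_Suc)
    obtain m n where "x \<in> C m" "y \<in> C n" using xy by blast
    then have "x \<in> C (max m n)" "y \<in> C (max m n)" using inc[of m "max m n"] inc[of n "max m n"] by auto
    then have "N x y \<subseteq> C (Suc (max m n))" unfolding C_Suc by blast
    then show ?thesis by blast
  qed
  ultimately show ?thesis by (intro exI[of _ "\<Union>n. C n"]) blast
qed

lemma subspace_closure_rational:
  fixes C :: "'a::real_normed_vector set"
  assumes "C \<noteq> {}" "\<And>x y r. x \<in> C \<Longrightarrow> y \<in> C \<Longrightarrow> r \<in> \<rat> \<Longrightarrow> x + r *\<^sub>R y \<in> C"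
  shows "subspace (closure C)"
proof -
  have comb: "x + r *\<^sub>R y \<in> closure C" if xy: "x \<in> closure C" "y \<in> closure C" for x y and r :: real
  proof -
    have "r \<in> closure \<rat>" by (simp add: Rats_closure_real)
    then obtain rn where rn: "\<And>n. rn n \<in> \<rat>" "rn \<longlonglongrightarrow> r" unfolding closure_sequential by blast
    obtain xn yn where "\<And>n. xn n \<in> C" "xn \<longlonglongrightarrow> x" "\<And>n. yn n \<in> C" "yn \<longlonglongrightarrow> y"
      using xy unfolding closure_sequential by blast
    then have "\<forall>n. xn n + rn n *\<^sub>R yn n \<in> C" "(\<lambda>n. xn n + rn n *\<^sub>R yn n) \<longlonglongrightarrow> x + r *\<^sub>R y"
      using assms(2) rn by (auto intro!: tendsto_intros)
    then show ?thesis unfolding closure_sequential by (intro exI[of _ "\<lambda>n. xn n + rn n *\<^sub>R yn n"] conjI)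
  qed
  obtain x where "x \<in> closure C" using assms(1) closure_subset by blast
  from comb[OF this this, of "- 1"] have 0: "0 \<in> closure C" by simp
  then show ?thesis
    unfolding subspace_def using comb[of _ _ 1] comb[of 0] by auto
qed

theorem separable_reduction:
  fixes \<S> :: "'a::real_normed_vector set set"
  assumes "countable \<S>" "finite E" "countable S0" "S0 \<noteq> {}"
  obtains Y where "subspace Y" "closed Y" "separable_space (top_of_set Y)" "S0 \<subseteq> Y"
    "\<And>A w xs \<eta>. A \<in> \<S> \<Longrightarrow> xs \<in> frechet_normal (A \<inter> Y) w \<Longrightarrow> 0 < \<eta> \<Longrightarrow>
      \<exists>ys\<in>frechet_normal A w. \<forall>e\<in>E. \<bar>blinfun_apply ys e - blinfun_apply xs e\<bar> \<le> \<eta>"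
proof -
  \<comment> \<open>Countability dictates the data: natural norm bounds \<open>c\<close>, finite
    \<open>J\<close>, rational right-hand sides on \<open>E\<close> and its negatives, and radii
    \<open>1 / real (Suc n)\<close>.\<close>
  define params where "params = \<S> \<times> (UNIV :: nat set) \<times> {J :: (nat \<times> nat) set. finite J} \<times>
    {R. finite R \<and> R \<subseteq> (E \<union> uminus ` E) \<times> (\<rat> :: real set)} \<times> (UNIV :: nat set)"
  have params: "countable params" unfolding params_def
    by (intro countable_SIGMA countable_Collect_finite countable_Collect_finite_subset assms(1) countable_rat countableI_type
        countable_finite finite_UnI finite_imageI assms(2))
  \<comment> \<open>The witness must work on a whole ball, because it is selected at a point of the
    countable set but used at the limit point \<open>w\<close>.\<close>
  define good where "good k w U = (case k of (A, c, J, R, n) \<Rightarrow> U \<subseteq> A \<and> finite U \<and>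
    (\<forall>w'\<in>ball w (1 / real (Suc n)). infeasible (real (c::nat)) J R U w'))"
    for k :: "'a set \<times> nat \<times> (nat \<times> nat) set \<times> ('a \<times> real) set \<times> nat" and w U
  define sel where "sel k w = (if \<exists>U. good k w U then SOME U. good k w U else {})" for k w
  have sel: "good k w (sel k w)" if "good k w U" for k w U
    using that unfolding sel_def by (metis someI)
  have "countable (sel k w)" for k w
  proof (cases "\<exists>U. good k w U")
    case True
    then have "good k w (sel k w)" using sel by blast
    then have "finite (sel k w)" unfolding good_def by (auto split: prod.splits)
    then show ?thesis by (rule countable_finite)
  qed (simp add: sel_def)
  then have N: "countable ((\<lambda>r. x + r *\<^sub>R y) ` \<rat> \<union> (\<Union>k\<in>params. sel k x))" for x y
    using params by (intro countable_Un countable_UN countable_image countable_rat)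
  obtain C where C: "countable C" "S0 \<subseteq> C"
    and "\<forall>x\<in>C. \<forall>y\<in>C. (\<lambda>r. x + r *\<^sub>R y) ` \<rat> \<union> (\<Union>k\<in>params. sel k x) \<subseteq> C"
    using countable_closed_under[of S0 "\<lambda>x y. (\<lambda>r. x + r *\<^sub>R y) ` \<rat> \<union> (\<Union>k\<in>params. sel k x)", OF assms(3) N]
    by (elim exE conjE)
  then have C3: "x + r *\<^sub>R y \<in> C" "k \<in> params \<Longrightarrow> sel k x \<subseteq> C" if "x \<in> C" "y \<in> C" "r \<in> \<rat>" for x y r k
    using that by blast+
  define Y where "Y = closure C"
  have CY: "C \<subseteq> Y" unfolding Y_def by (rule closure_subset)
  show ?thesis
  proof (rule that)
    show "subspace Y" unfolding Y_def
      by (rule subspace_closure_rational) (use C(2) C3(1) assms(4) in auto)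
    show "closed Y" by (simp add: Y_def)
    show "S0 \<subseteq> Y" using C(2) CY by blast
    have "top_of_set Y closure_of C = Y" using CY by (simp add: closure_of_subtopology Y_def inf.absorb2)
    then show "separable_space (top_of_set Y)" unfolding separable_space_def using C(1) CY by auto
    fix A w and \<eta> :: real and xs :: "'a \<Rightarrow>\<^sub>L real"
    assume A: "A \<in> \<S>" and xs: "xs \<in> frechet_normal (A \<inter> Y) w" and \<eta>: "0 < \<eta>"
    have w: "w \<in> A" "w \<in> Y" using xs by (auto simp: frechet_normal_iff)
    obtain c :: nat where c: "norm xs \<le> real c" using real_arch_simple by blast
    have "\<exists>r\<in>\<rat>. xs x < r \<and> r < xs x + \<eta>" for x
      by (rule Rats_dense_in_real) (use \<eta> in simp)
    \<comment> \<open>Rational upper bounds at both \<open>e\<close> and \<open>- e\<close> give the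
      two-sided estimate on \<open>E\<close>; exceeding \<open>xs\<close> keeps \<open>xs\<close>
      itself admissible.\<close>
    then obtain r where r: "\<And>x. r x \<in> \<rat>" "\<And>x. xs x < r x" "\<And>x. r x < xs x + \<eta>" by metis
    define R where "R = (\<lambda>x. (x, r x)) ` (E \<union> uminus ` E)"
    have "\<exists>d. \<forall>u\<in>A \<inter> Y. norm (u - w) < 1 / real (Suc d) \<longrightarrow> xs (u - w) \<le> norm (u - w) / real (Suc j)" for j
    proof -
      obtain s where s: "s > 0" "\<And>u. u \<in> A \<inter> Y \<Longrightarrow> norm (u - w) < s \<Longrightarrow> xs (u - w) \<le> 1 / real (Suc j) * norm (u - w)"
        using xs[unfolded frechet_normal_iff, THEN conjunct2, rule_format, of "1 / real (Suc j)"] by auto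
      obtain d where "1 / real (Suc d) < s" using nat_approx_posE[OF s(1)] by blast
      then show ?thesis using s(2) by (intro exI[of _ d]) force
    qed
    then obtain d where d: "\<And>j u. u \<in> A \<inter> Y \<Longrightarrow> norm (u - w) < 1 / real (Suc (d j)) \<Longrightarrow> xs (u - w) \<le> norm (u - w) / real (Suc j)"
      by metis
    define J where "J = range (\<lambda>j. (j, d j))"
    have "\<not> infeasible (real c) J R A w"
    proof
      assume "infeasible (real c) J R A w"
      then obtain J' U' where J': "finite J'" "J' \<subseteq> J" "finite U'" "U' \<subseteq> A"
        "\<forall>\<^sub>F w' in nhds w. infeasible (real c) J' R U' w'" by (rule infeasible_stable)
      then obtain s where s: "s > 0" "\<And>w'. dist w' w < s \<Longrightarrow> infeasible (real c) J' R U' w'"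
        unfolding eventually_nhds_metric by blast
      \<comment> \<open>With radius below \<open>s / 2\<close>, the ball about the approximating
        point \<open>w'\<close> contains \<open>w\<close> and stays inside the region of
        infeasibility around \<open>w\<close>.\<close>
      obtain n where n: "1 / real (Suc n) < s / 2" using nat_approx_posE[of "s / 2"] s(1) by auto
      obtain w' where w': "w' \<in> C" "dist w' w < 1 / real (Suc n)"
        using w(2) unfolding Y_def closure_approachable by (metis of_nat_0_less_iff zero_less_Suc zero_less_divide_1_iff)
      define k where "k = (A, c, J', R, n)"
      have "infeasible (real c) J' R U' v" if "v \<in> ball w' (1 / real (Suc n))" for v
      proof -
        have "dist v w < s" using that w'(2) n dist_triangle[of v w w'] by (simp add: dist_commute)
        then show ?thesis by (rule s(2))
      qed
      then have "good k w' U'" using J' unfolding good_def k_def by simp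
      then have "good k w' (sel k w')" by (rule sel)
      moreover have "w \<in> ball w' (1 / real (Suc n))" using w'(2) by simp
      ultimately have U: "sel k w' \<subseteq> A" "infeasible (real c) J' R (sel k w') w" unfolding good_def k_def by auto
      have "k \<in> params" unfolding params_def k_def R_def using A J'(1) assms(2) r(1) by auto
      then have "sel k w' \<subseteq> A \<inter> Y" using C3(2)[OF w'(1) w'(1) Rats_0] U(1) CY by blast
      then have "infeasible (real c) J R (A \<inter> Y) w" using infeasible_mono[OF U(2) J'(2)] by blast
      \<comment> \<open>On \<open>A \<inter> Y\<close> the functional \<open>xs\<close> solves the
        system, which contradicts a certificate with points in \<open>Y\<close>.\<close>
      moreover have "\<not> infeasible (real c) J R (A \<inter> Y) w"
        by (rule not_infeasible[OF c]) (use d r(2) in \<open>auto simp: R_def J_def less_imp_le\<close>)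
      ultimately show False by blast
    qed
    then have "snd z + real c * norm (fst z) \<ge> 0" if "z \<in> generated_cone (normal_constraints J R A w)" for z
      using that unfolding infeasible_def by (auto simp: not_less)
    then obtain ys :: "'a \<Rightarrow>\<^sub>L real" where ys: "\<And>x b. (x, b) \<in> normal_constraints J R A w \<Longrightarrow> ys x \<le> b"
      using exists_blinfun_constraints[of "normal_constraints J R A w" "real c"] of_nat_0_le_iff by blast
    have "ys \<in> frechet_normal A w"
      unfolding frechet_normal_iff
    proof (intro conjI allI impI w)
      fix e :: real assume "e > 0"
      then obtain j where j: "1 / real (Suc j) < e" using nat_approx_posE by blast
      have "ys (u - w) \<le> e * norm (u - w)" if "u \<in> A" "norm (u - w) < 1 / real (Suc (d j))" for u
      proof -
        have "ys (u - w) \<le> norm (u - w) / real (Suc j)"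
          by (rule ys) (use that in \<open>unfold normal_constraints_def J_def, blast\<close>)
        also have "\<dots> \<le> e * norm (u - w)" using mult_right_mono[OF less_imp_le[OF j], of "norm (u - w)"] by simp
        finally show ?thesis .
      qed
      then show "\<exists>s>0. \<forall>u\<in>A. norm (u - w) < s \<longrightarrow> ys (u - w) \<le> e * norm (u - w)"
        by (intro exI[of _ "1 / real (Suc (d j))"]) auto
    qed
    moreover have "\<bar>ys e - xs e\<bar> \<le> \<eta>" if "e \<in> E" for e
    proof -
      have "ys e \<le> r e" "ys (- e) \<le> r (- e)"
        by (rule ys; use that in \<open>simp add: normal_constraints_def R_def\<close>)+
      then show ?thesis using r(3)[of e] r(3)[of "- e"] by (simp add: blinfun.minus_right)
    qed
    ultimately show "\<exists>ys\<in>frechet_normal A w. \<forall>e\<in>E. \<bar>blinfun_apply ys e - blinfun_apply xs e\<bar> \<le> \<eta>" by blast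
  qed
qed

section \<open>Two sets\<close>

lemma smooth_gaugeD:
  assumes "smooth_gauge Y Q"
  shows "Q 0 = 0" "x \<in> Y \<Longrightarrow> 0 \<le> Q x" "x \<in> Y \<Longrightarrow> Q x < 2 \<Longrightarrow> norm x < 3"
    "x \<in> Y \<Longrightarrow> y \<in> Y \<Longrightarrow> \<bar>Q x - Q y\<bar> \<le> 2 * norm (x - y)"
  using assms unfolding smooth_gauge_def by (blast, blast, force, blast)

lemma smooth_gauge_le:
  assumes "smooth_gauge Y Q" "subspace Y" "x \<in> Y"
  shows "Q x \<le> 2 * norm x"
  using smooth_gaugeD(4)[OF assms(1,3) subspace_0[OF assms(2)]] smooth_gaugeD(1)[OF assms(1)] by simp

text \<open>One \<open>G\<close> serves every affine substitution that hits the argument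
  \<open>z\<close>. The penalty is later differentiated at the same argument once in
  \<open>x\<close> and once in \<open>h\<close>, and the two results cancel only because they come
  from the same \<open>G\<close>.\<close>

lemma smooth_gauge_derivative:
  assumes Q: "smooth_gauge Y Q" and Y: "subspace Y" and z: "z \<in> Y"
  obtains G :: "'a::real_normed_vector \<Rightarrow>\<^sub>L real" where "norm G \<le> 2"
    "\<And>c x p. x \<in> Y \<Longrightarrow> p \<in> Y \<Longrightarrow> c *\<^sub>R (x - p) = z \<Longrightarrow>
      ((\<lambda>x. Q (c *\<^sub>R (x - p))) has_derivative (\<lambda>h. c * blinfun_apply G h)) (at x within Y)"
proof -
  obtain G :: "'a \<Rightarrow>\<^sub>L real" where G: "norm G \<le> 2" "(Q has_derivative blinfun_apply G) (at z within Y)"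
    using Q z unfolding smooth_gauge_def by blast
  have "((\<lambda>x. Q (c *\<^sub>R (x - p))) has_derivative (\<lambda>h. c * blinfun_apply G h)) (at x within Y)"
    if x: "x \<in> Y" and p: "p \<in> Y" and cz: "c *\<^sub>R (x - p) = z" for c x p
  proof -
    have "((\<lambda>x. Q (c *\<^sub>R (x - p))) has_derivative (\<lambda>h. blinfun_apply G (c *\<^sub>R h))) (at x within Y)"
    proof (rule has_derivative_in_compose[where f = "\<lambda>x. c *\<^sub>R (x - p)"])
      show "((\<lambda>x. c *\<^sub>R (x - p)) has_derivative (\<lambda>h. c *\<^sub>R h)) (at x within Y)"
        by (auto intro!: derivative_eq_intros)
      show "(Q has_derivative blinfun_apply G) (at (c *\<^sub>R (x - p)) within (\<lambda>x. c *\<^sub>R (x - p)) ` Y)"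
        unfolding cz by (rule has_derivative_subset[OF G(2)]) (use Y p in \<open>auto intro: subspace_scale subspace_diff\<close>)
    qed
    then show ?thesis by (simp add: blinfun.scaleR_right)
  qed
  then show ?thesis using that G(1) by blast
qed

text \<open>The factor \<open>2^n\<close> localises at scale \<open>(1/2)^n\<close>: a gauge value
  below \<open>2\<close> forces a distance below \<open>3 * (1/2)^n\<close>. The weight
  \<open>(1/4)^n\<close> still leaves derivatives of norm at most \<open>2 * (1/2)^n\<close>, which
  are summable.\<close>

definition gauge_sum :: "('a::real_normed_vector \<Rightarrow> real) \<Rightarrow> (nat \<Rightarrow> 'a) \<Rightarrow> 'a \<Rightarrow> real" where
  "gauge_sum Q P x = (\<Sum>n. (1/4)^n * Q (2^n *\<^sub>R (x - P n)))"

lemma gauge_term_bounds: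
  assumes "smooth_gauge Y Q" "subspace Y" "x \<in> Y" "p \<in> Y"
  shows "0 \<le> (1/4)^n * Q (2^n *\<^sub>R (x - p))" "(1/4)^n * Q (2^n *\<^sub>R (x - p)) \<le> 2 * norm (x - p) * (1/2)^n"
proof -
  have z: "2^n *\<^sub>R (x - p) \<in> Y" using assms by (intro subspace_scale subspace_diff)
  show "0 \<le> (1/4)^n * Q (2^n *\<^sub>R (x - p))" using smooth_gaugeD(2)[OF assms(1) z] by simp
  have "Q (2^n *\<^sub>R (x - p)) \<le> 2 * norm (2^n *\<^sub>R (x - p))" by (rule smooth_gauge_le[OF assms(1,2) z])
  then have "Q (2^n *\<^sub>R (x - p)) \<le> 2 * (2^n * norm (x - p))" by simp
  then have "(1/4)^n * Q (2^n *\<^sub>R (x - p)) \<le> (1/4)^n * (2 * (2^n * norm (x - p)))" by (rule mult_left_mono) simp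
  also have "\<dots> = 2 * norm (x - p) * ((1/4)^n * 2^n)" by simp
  also have "(1/4)^n * 2^n = (1/2::real)^n" by (simp flip: power_mult_distrib)
  finally show "(1/4)^n * Q (2^n *\<^sub>R (x - p)) \<le> 2 * norm (x - p) * (1/2)^n" .
qed

lemma gauge_sum_bounds:
  assumes "smooth_gauge Y Q" "subspace Y" "x \<in> Y" "\<And>n. P n \<in> Y" "\<And>n. norm (x - P n) \<le> r"
  shows "summable (\<lambda>n. (1/4)^n * Q (2^n *\<^sub>R (x - P n)))" "0 \<le> gauge_sum Q P x" "gauge_sum Q P x \<le> 4 * r"
proof -
  note b = gauge_term_bounds[OF assms(1-3) assms(4)]
  have le: "(1/4)^n * Q (2^n *\<^sub>R (x - P n)) \<le> 2 * r * (1/2)^n" for n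
  proof -
    have "2 * norm (x - P n) * (1/2)^n \<le> 2 * r * (1/2)^n" using assms(5)[of n] by simp
    then show ?thesis using b(2)[of n n] by linarith
  qed
  have geo: "(\<lambda>n. 2 * r * (1/2)^n) sums (4 * r)"
    using sums_mult[OF geometric_sums[of "1/2::real"], of "2 * r"] by simp
  show s: "summable (\<lambda>n. (1/4)^n * Q (2^n *\<^sub>R (x - P n)))"
    by (rule summable_comparison_test'[OF sums_summable[OF geo]]) (use b(1) le in simp)
  show "0 \<le> gauge_sum Q P x" unfolding gauge_sum_def by (intro suminf_nonneg s b)
  show "gauge_sum Q P x \<le> 4 * r" unfolding gauge_sum_def sums_unique[OF geo]
    by (intro suminf_le le s sums_summable[OF geo])
qed

text \<open>The derivatives of the terms sum uniformly on the convex set \<open>Y\<close>, which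
  permits termwise differentiation; \<open>4\<close> is the sum of
  \<open>2 * (1/2)^n\<close>.\<close>

lemma gauge_sum_derivative:
  assumes Q: "smooth_gauge Y Q" and Y: "subspace Y" and P: "\<And>n. P n \<in> Y" and x0: "x0 \<in> Y"
    and bd: "\<And>n. norm (x0 - P n) \<le> r"
  obtains H :: "'a::real_normed_vector \<Rightarrow>\<^sub>L real" where "norm H \<le> 4"
    "(gauge_sum Q P has_derivative blinfun_apply H) (at x0 within Y)"
proof -
  define f where "f n x = (1/4)^n * Q (2^n *\<^sub>R (x - P n))" for n x
  have ex: "\<exists>G :: 'a \<Rightarrow>\<^sub>L real. norm G \<le> 2 * (1/2)^n \<and> (f n has_derivative blinfun_apply G) (at x within Y)"
    if x: "x \<in> Y" for n x
  proof -
    have "2^n *\<^sub>R (x - P n) \<in> Y" using Y x P by (intro subspace_scale subspace_diff)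
    then obtain G :: "'a \<Rightarrow>\<^sub>L real" where G: "norm G \<le> 2"
      "((\<lambda>x. Q (2^n *\<^sub>R (x - P n))) has_derivative (\<lambda>h. 2^n * blinfun_apply G h)) (at x within Y)"
      using smooth_gauge_derivative[OF Q Y] x P by metis
    have "(f n has_derivative (\<lambda>h. (1/4)^n * (2^n * blinfun_apply G h))) (at x within Y)"
      unfolding f_def by (intro derivative_intros G(2))
    moreover have "(1/4)^n * (2^n * b) = (1/2)^n * b" for b :: real
      by (simp add: mult.assoc[symmetric] flip: power_mult_distrib)
    moreover have "blinfun_apply ((1/2)^n *\<^sub>R G) = (\<lambda>h. (1/2)^n * blinfun_apply G h)"
      by (auto simp: blinfun.scaleR_left)
    ultimately have "(f n has_derivative blinfun_apply ((1/2)^n *\<^sub>R G)) (at x within Y)" by simp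
    moreover have "norm ((1/2)^n *\<^sub>R G) \<le> 2 * (1/2)^n" using G(1) by simp
    ultimately show ?thesis by blast
  qed
  define G :: "nat \<Rightarrow> 'a \<Rightarrow> 'a \<Rightarrow>\<^sub>L real" where
    "G n x = (SOME G. norm G \<le> 2 * (1/2)^n \<and> (f n has_derivative blinfun_apply G) (at x within Y))" for n x
  have G: "norm (G n x) \<le> 2 * (1/2)^n" "(f n has_derivative blinfun_apply (G n x)) (at x within Y)" if "x \<in> Y" for n x
    using someI_ex[OF ex[OF that, of n]] unfolding G_def by blast+
  have geo: "(\<lambda>n. 2 * (1/2)^(n + m)) sums (4 * (1/2)^m :: real)" for m
    using sums_mult[OF geometric_sums[of "1/2::real"], of "2 * (1/2)^m"] by (simp add: power_add mult_ac)
  have sumG: "summable (\<lambda>n. G n x)" if "x \<in> Y" for x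
    by (rule summable_comparison_test'[of "\<lambda>n. 2 * (1/2)^n"]) (use sums_summable[OF geo[of 0]] G(1)[OF that] in auto)
  define g where "g x = (\<Sum>n. G n x)" for x
  have tail: "norm (g x - (\<Sum>i<m. G i x)) \<le> 4 * (1/2)^m" if x: "x \<in> Y" for x m
  proof -
    have "g x - (\<Sum>i<m. G i x) = (\<Sum>n. G (n + m) x)"
      unfolding g_def by (rule suminf_minus_initial_segment[OF sumG[OF x], symmetric])
    moreover have "norm (\<Sum>n. G (n + m) x) \<le> (\<Sum>n. 2 * (1/2)^(n + m))"
      by (rule norm_suminf_le[OF G(1)[OF x] sums_summable[OF geo]])
    ultimately show ?thesis using sums_unique[OF geo[of m]] by simp
  qed
  have "\<exists>J. \<forall>x\<in>Y. (\<lambda>n. f n x) sums (J x) \<and> (J has_derivative blinfun_apply (g x)) (at x within Y)"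
  proof (rule has_derivative_series[where f' = "\<lambda>n x. blinfun_apply (G n x)"])
    show "convex Y" using Y by (rule subspace_imp_convex)
    show "(f n has_derivative blinfun_apply (G n x)) (at x within Y)" if "x \<in> Y" for n x by (rule G(2)[OF that])
    show "\<forall>\<^sub>F n in sequentially. \<forall>x\<in>Y. \<forall>h. norm ((\<Sum>i<n. blinfun_apply (G i x) h) - blinfun_apply (g x) h) \<le> e * norm h"
      if "e > 0" for e
    proof -
      have "(\<lambda>m. 4 * (1/2)^m) \<longlonglongrightarrow> (4 * 0 :: real)" by (intro tendsto_intros LIMSEQ_power_zero) simp
      then have "\<forall>\<^sub>F m in sequentially. 4 * (1/2)^m < e" using that by (intro order_tendstoD) auto
      then show ?thesis
      proof eventually_elim
        case (elim m)
        show ?case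
        proof (intro ballI allI)
          fix x h assume x: "x \<in> Y"
          have "norm ((\<Sum>i<m. blinfun_apply (G i x) h) - blinfun_apply (g x) h) = norm (blinfun_apply (g x - (\<Sum>i<m. G i x)) h)"
            by (simp add: blinfun.diff_left blinfun.sum_left abs_minus_commute)
          also have "\<dots> \<le> norm (g x - (\<Sum>i<m. G i x)) * norm h" by (rule norm_blinfun)
          also have "\<dots> \<le> e * norm h" using tail[OF x, of m] elim by (intro mult_right_mono) auto
          finally show "norm ((\<Sum>i<m. blinfun_apply (G i x) h) - blinfun_apply (g x) h) \<le> e * norm h" .
        qed
      qed
    qed
    show "x0 \<in> Y" by (rule x0)
    show "(\<lambda>n. f n x0) sums (\<Sum>n. f n x0)"
      unfolding f_def by (rule summable_sums[OF gauge_sum_bounds(1)[OF Q Y x0 P bd]])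
  qed
  then obtain J where J: "\<And>x. x \<in> Y \<Longrightarrow> (\<lambda>n. f n x) sums (J x)"
    "(J has_derivative blinfun_apply (g x0)) (at x0 within Y)" using x0 by blast
  have "gauge_sum Q P x = J x" if "x \<in> Y" for x
    using sums_unique[OF J(1)[OF that]] unfolding gauge_sum_def f_def by simp
  then have "(gauge_sum Q P has_derivative blinfun_apply (g x0)) (at x0 within Y)"
    by (intro has_derivative_transform[OF x0 _ J(2)])
  moreover have "norm (g x0) \<le> 4" using tail[OF x0, of 0] by simp
  ultimately show ?thesis using that by blast
qed

text \<open>Fermat's rule: since \<open>F u \<le> F x\<close>, the differentiability error bounds
  \<open>- H\<close> from above along the set.\<close>

lemma frechet_normal_of_min:
  assumes "u \<in> A \<inter> Y" "(F has_derivative blinfun_apply H) (at u within Y)" "r > 0"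
    and "\<And>x. x \<in> A \<inter> Y \<Longrightarrow> norm (x - u) < r \<Longrightarrow> F u \<le> F x"
  shows "- H \<in> frechet_normal (A \<inter> Y) u"
  unfolding frechet_normal_iff
proof (intro conjI allI impI assms(1))
  fix e :: real assume "e > 0"
  then obtain d where d: "d > 0" "\<And>y. y \<in> Y \<Longrightarrow> norm (y - u) < d \<Longrightarrow> norm (F y - F u - blinfun_apply H (y - u)) \<le> e * norm (y - u)"
    using assms(2) unfolding has_derivative_within_alt by blast
  have "blinfun_apply (- H) (x - u) \<le> e * norm (x - u)" if x: "x \<in> A \<inter> Y" "norm (x - u) < min d r" for x
    using d(2)[of x] assms(4)[of x] x by (simp add: blinfun.minus_left)
  then show "\<exists>d>0. \<forall>x\<in>A \<inter> Y. norm (x - u) < d \<longrightarrow> blinfun_apply (- H) (x - u) \<le> e * norm (x - u)"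
    using d(1) assms(3) by (intro exI[of _ "min d r"]) auto
qed

text \<open>The number \<open>b\<close> absorbs a non-differentiable part of the objective, of which
  only a linear growth bound along the ray is known.\<close>

lemma directional_derivative_min:
  fixes F R :: "'a::real_normed_vector \<Rightarrow> real"
  assumes R: "(R has_derivative blinfun_apply D) (at h within Y)" and Y: "subspace Y" and h: "h \<in> Y" and v: "v \<in> Y" and r: "r > 0"
    and min: "\<And>t. 0 < t \<Longrightarrow> norm (t *\<^sub>R v) < r \<Longrightarrow> R h \<le> R (h + t *\<^sub>R v) + t * b"
  shows "0 \<le> b + blinfun_apply D v"
proof -
  have "0 \<le> (b + blinfun_apply D v) + e" if e: "e > 0" for e
  proof -
    \<comment> \<open>The added \<open>1\<close> avoids division by zero at
      \<open>v = 0\<close>.\<close>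
    obtain N where N: "N = 1 + norm v" by blast
    have N0: "N > 0" "norm v \<le> N" using norm_ge_zero[of v] unfolding N by linarith+
    define e' where "e' = e / N"
    have "e' > 0" using e N0 by (simp add: e'_def)
    then obtain d where d: "d > 0" "\<And>y. y \<in> Y \<Longrightarrow> norm (y - h) < d \<Longrightarrow> norm (R y - R h - blinfun_apply D (y - h)) \<le> e' * norm (y - h)"
      using R unfolding has_derivative_within_alt by blast
    define t where "t = min d r / (2 * N)"
    have t: "t > 0" using d(1) r N0 by (simp add: t_def)
    have "norm (t *\<^sub>R v) \<le> t * N" using t N0 by simp
    also have "\<dots> = min d r / 2" using N0 by (simp add: t_def)
    also have "\<dots> < min d r" using d(1) r by (auto simp: min_def)
    finally have tv: "norm (t *\<^sub>R v) < d" "norm (t *\<^sub>R v) < r" by auto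
    have "h + t *\<^sub>R v \<in> Y" using Y h v by (intro subspace_add subspace_scale)
    from d(2)[OF this] tv(1) have "R (h + t *\<^sub>R v) - R h - t * blinfun_apply D v \<le> e' * (t * norm v)"
      using t by (simp add: blinfun.scaleR_right)
    then have "0 \<le> t * b + t * blinfun_apply D v + e' * (t * norm v)" using min[OF t tv(2)] by linarith
    also have "\<dots> = t * (b + blinfun_apply D v + e' * norm v)" by (simp add: algebra_simps)
    finally have "0 \<le> b + blinfun_apply D v + e' * norm v" using t by (simp add: zero_le_mult_iff)
    also have "e' * norm v \<le> e" using mult_left_mono[OF N0(2) less_imp_le[OF \<open>e' > 0\<close>]] N0(1) by (simp add: e'_def)
    finally show ?thesis by simp
  qed
  then show ?thesis by (rule field_le_epsilon)
qed

section \<open>Penalised minimisation for two sets\<close>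

locale two_sets =
  fixes Y :: "'a::banach set" and Q :: "'a \<Rightarrow> real" and A C E :: "'a set" and x0 :: 'a and xs :: "'a \<Rightarrow>\<^sub>L real" and \<delta> \<gamma> :: real
  assumes Y: "subspace Y" "closed Y" and Q: "smooth_gauge Y Q" and AC: "closed A" "closed C"
    and E: "finite E" "E \<subseteq> Y" and x0: "x0 \<in> A" "x0 \<in> C" "x0 \<in> Y" and pos: "\<delta> > 0" "\<gamma> > 0"
    and sphere: "\<And>h. h \<in> span E \<Longrightarrow> norm h = \<delta> \<Longrightarrow> x0 + h \<in> A \<Longrightarrow> x0 + h \<in> C \<Longrightarrow> xs h < \<gamma> * norm h"
begin

text \<open>The outer \<open>k\<close> weights the penalty. The inner \<open>k\<close> is there
  because \<open>Q\<close> gives no information near \<open>0\<close>: with it, a gauge value below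
  \<open>2\<close> means a distance below \<open>3 / k\<close>.\<close>

definition objective :: "real \<Rightarrow> 'a \<times> 'a \<times> 'a \<Rightarrow> real" where
  "objective k = (\<lambda>(x, y, h). \<gamma> * norm h - xs h + k * (Q (k *\<^sub>R (x - (x0 + h))) + Q (k *\<^sub>R (y - (x0 + h)))))"

definition box :: "('a \<times> 'a \<times> 'a) set" where
  "box = (A \<inter> Y \<inter> cball x0 \<delta>) \<times> (C \<inter> Y \<inter> cball x0 \<delta>) \<times> (cball 0 \<delta> \<inter> span E)"

definition perturbation :: "(nat \<Rightarrow> 'a \<times> 'a \<times> 'a) \<Rightarrow> 'a \<times> 'a \<times> 'a \<Rightarrow> real" where
  "perturbation P = (\<lambda>(x, y, h). gauge_sum Q (\<lambda>n. fst (P n)) x + gauge_sum Q (\<lambda>n. fst (snd (P n))) y +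
     gauge_sum Q (\<lambda>n. snd (snd (P n))) h)"

lemma span_Y: "span E \<subseteq> Y"
  by (rule span_minimal[OF E(2) Y(1)])

lemma boxD:
  assumes "p \<in> box"
  shows "fst p \<in> Y" "fst (snd p) \<in> Y" "snd (snd p) \<in> Y" "fst p \<in> A" "fst (snd p) \<in> C" "snd (snd p) \<in> span E"
    "norm (fst p - x0) \<le> \<delta>" "norm (fst (snd p) - x0) \<le> \<delta>" "norm (snd (snd p)) \<le> \<delta>"
  using assms span_Y unfolding box_def by (auto simp: dist_norm norm_minus_commute)

lemma base_in_box: "(x0, x0, 0) \<in> box"
  using x0 pos unfolding box_def by (auto simp: span_zero)

lemma complete_box: "complete box"
  unfolding box_def complete_eq_closed
  by (intro closed_Times closed_Int closed_cball AC Y(2) compact_imp_closed compact_ball_span_finite E(1))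

lemma box_diff:
  assumes "p \<in> box" "p' \<in> box"
  shows "norm (fst p - fst p') \<le> 2 * \<delta>" "norm (fst (snd p) - fst (snd p')) \<le> 2 * \<delta>" "norm (snd (snd p) - snd (snd p')) \<le> 2 * \<delta>"
proof -
  have t: "norm (a - b) \<le> norm (a - c) + norm (b - c)" for a b c :: 'a
    using norm_triangle_ineq4[of "a - c" "b - c"] by simp
  show "norm (fst p - fst p') \<le> 2 * \<delta>"
    using t[of "fst p" "fst p'" x0] boxD(7)[OF assms(1)] boxD(7)[OF assms(2)] by linarith
  show "norm (fst (snd p) - fst (snd p')) \<le> 2 * \<delta>"
    using t[of "fst (snd p)" "fst (snd p')" x0] boxD(8)[OF assms(1)] boxD(8)[OF assms(2)] by linarith
  show "norm (snd (snd p) - snd (snd p')) \<le> 2 * \<delta>"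
    using norm_triangle_ineq4[of "snd (snd p)" "snd (snd p')"] boxD(9)[OF assms(1)] boxD(9)[OF assms(2)] by linarith
qed

lemma shift_in_Y: "x \<in> Y \<Longrightarrow> h \<in> Y \<Longrightarrow> k *\<^sub>R (x - (x0 + h)) \<in> Y"
  using x0(3) Y(1) by (intro subspace_scale subspace_diff subspace_add)

lemma xs_le: "norm h \<le> \<delta> \<Longrightarrow> \<bar>xs h\<bar> \<le> norm xs * \<delta>"
  using norm_blinfun[of xs h] mult_left_mono[of "norm h" \<delta> "norm xs"] by simp

lemma objective_lower:
  assumes "p \<in> box" "k \<ge> 0"
  shows "- (norm xs * \<delta>) + k * (Q (k *\<^sub>R (fst p - (x0 + snd (snd p)))) + Q (k *\<^sub>R (fst (snd p) - (x0 + snd (snd p))))) \<le> objective k p"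
proof -
  have "0 \<le> \<gamma> * norm (snd (snd p))" using pos(2) by simp
  moreover have "xs (snd (snd p)) \<le> norm xs * \<delta>" by (rule abs_le_D1[OF xs_le[OF boxD(9)[OF assms(1)]]])
  ultimately show ?thesis unfolding objective_def case_prod_unfold by linarith
qed

lemma objective_ge:
  assumes "p \<in> box" "k \<ge> 0"
  shows "\<gamma> * norm (snd (snd p)) - xs (snd (snd p)) \<le> objective k p"
proof -
  have "0 \<le> k * (Q (k *\<^sub>R (fst p - (x0 + snd (snd p)))) + Q (k *\<^sub>R (fst (snd p) - (x0 + snd (snd p)))))"
    using boxD[OF assms(1)] by (intro mult_nonneg_nonneg add_nonneg_nonneg smooth_gaugeD(2)[OF Q] shift_in_Y assms(2))
  then show ?thesis unfolding objective_def by (simp add: case_prod_unfold)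
qed

lemma continuous_Q: "continuous_on Y Q"
proof (rule continuous_onI)
  fix e :: real and z assume z: "z \<in> Y" and e: "e > 0"
  have "dist (Q y) (Q z) \<le> e" if "y \<in> Y" "dist y z < e / 2" for y
    using smooth_gaugeD(4)[OF Q that(1) z] that(2) by (simp add: dist_norm)
  then show "\<exists>d>0. \<forall>y\<in>Y. dist y z < d \<longrightarrow> dist (Q y) (Q z) \<le> e"
    using e by (intro exI[of _ "e / 2"]) auto
qed

lemma continuous_objective: "continuous_on box (objective k)"
proof -
  have 1: "continuous_on box (\<lambda>p. Q (k *\<^sub>R (fst p - (x0 + snd (snd p)))))"
    by (rule continuous_on_compose2[OF continuous_Q]) (auto intro!: continuous_intros shift_in_Y boxD)
  have 2: "continuous_on box (\<lambda>p. Q (k *\<^sub>R (fst (snd p) - (x0 + snd (snd p)))))"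
    by (rule continuous_on_compose2[OF continuous_Q]) (auto intro!: continuous_intros shift_in_Y boxD)
  show ?thesis unfolding objective_def case_prod_unfold by (intro continuous_intros 1 2)
qed

text \<open>Each of the three sums is at most four times the largest distance, which is
  \<open>2 * \<delta>\<close> in \<open>box\<close>; hence \<open>24 * \<delta>\<close>.\<close>

lemma perturbation_bounds:
  assumes P: "\<And>n. P n \<in> box" and p: "p \<in> box"
  shows "summable (\<lambda>n. (1/4)^n * Q (2^n *\<^sub>R (fst p - fst (P n))))"
    "summable (\<lambda>n. (1/4)^n * Q (2^n *\<^sub>R (fst (snd p) - fst (snd (P n)))))"
    "summable (\<lambda>n. (1/4)^n * Q (2^n *\<^sub>R (snd (snd p) - snd (snd (P n)))))"
    "0 \<le> perturbation P p" "perturbation P p \<le> 24 * \<delta>"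
proof -
  note 1 = gauge_sum_bounds[where P = "\<lambda>n. fst (P n)", OF Q Y(1) boxD(1)[OF p] boxD(1)[OF P] box_diff(1)[OF p P]]
  note 2 = gauge_sum_bounds[where P = "\<lambda>n. fst (snd (P n))", OF Q Y(1) boxD(2)[OF p] boxD(2)[OF P] box_diff(2)[OF p P]]
  note 3 = gauge_sum_bounds[where P = "\<lambda>n. snd (snd (P n))", OF Q Y(1) boxD(3)[OF p] boxD(3)[OF P] box_diff(3)[OF p P]]
  show "summable (\<lambda>n. (1/4)^n * Q (2^n *\<^sub>R (fst p - fst (P n))))" by (rule 1)
  show "summable (\<lambda>n. (1/4)^n * Q (2^n *\<^sub>R (fst (snd p) - fst (snd (P n)))))" by (rule 2)
  show "summable (\<lambda>n. (1/4)^n * Q (2^n *\<^sub>R (snd (snd p) - snd (snd (P n)))))" by (rule 3)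
  show "0 \<le> perturbation P p" "perturbation P p \<le> 24 * \<delta>"
    using 1(2,3) 2(2,3) 3(2,3) unfolding perturbation_def case_prod_unfold by linarith+
qed

lemma exists_perturbed_min:
  assumes k: "k \<ge> 0" and \<mu>: "\<mu> > 0"
  obtains P p where "\<And>n. P n \<in> box" "p \<in> box" "\<And>u. u \<in> box \<Longrightarrow> objective k p + \<mu> * perturbation P p \<le> objective k u + \<mu> * perturbation P u"
proof -
  define q where "q n x y = (1/4)^n * Q (2^n *\<^sub>R (x - y))" for n x y
  define \<rho> where "\<rho> n p p' = \<mu> * (q n (fst p) (fst p') + q n (fst (snd p)) (fst (snd p')) + q n (snd (snd p)) (snd (snd p')))" for n p p'
  have q: "0 \<le> q n x y" "q n x y \<le> 2 * norm (x - y) * (1/2)^n" if "x \<in> Y" "y \<in> Y" for n x y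
    unfolding q_def using gauge_term_bounds[OF Q Y(1) that] by auto
  have q_lip: "\<bar>q n x z - q n y z\<bar> \<le> 2 * (1/2)^n * norm (x - y)" if xyz: "x \<in> Y" "y \<in> Y" "z \<in> Y" for n x y z
  proof -
    have "\<bar>Q (2^n *\<^sub>R (x - z)) - Q (2^n *\<^sub>R (y - z))\<bar> \<le> 2 * norm (2^n *\<^sub>R (x - z) - 2^n *\<^sub>R (y - z))"
      using xyz Y(1) by (intro smooth_gaugeD(4)[OF Q] subspace_scale subspace_diff)
    also have "2^n *\<^sub>R (x - z) - 2^n *\<^sub>R (y - z) = 2^n *\<^sub>R (x - y)" by (simp add: algebra_simps)
    finally have "\<bar>Q (2^n *\<^sub>R (x - z)) - Q (2^n *\<^sub>R (y - z))\<bar> \<le> 2 * (2^n * norm (x - y))" by simp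
    then have "(1/4)^n * \<bar>Q (2^n *\<^sub>R (x - z)) - Q (2^n *\<^sub>R (y - z))\<bar> \<le> (1/4)^n * (2 * (2^n * norm (x - y)))"
      by (rule mult_left_mono) simp
    also have "\<dots> = 2 * ((1/4)^n * 2^n) * norm (x - y)" by simp
    also have "(1/4)^n * 2^n = (1/2::real)^n" by (simp flip: power_mult_distrib)
    finally show ?thesis unfolding q_def by (simp add: abs_mult flip: right_diff_distrib)
  qed
  have q_sep: "norm (x - y) \<le> 3 * (1/2)^n" if xy: "x \<in> Y" "y \<in> Y" "q n x y < 2 * (1/4)^n" for n x y
  proof -
    have "(1/4)^n * Q (2^n *\<^sub>R (x - y)) < (1/4)^n * 2" using xy(3) unfolding q_def by (simp add: mult.commute)
    then have "Q (2^n *\<^sub>R (x - y)) < 2" by simp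
    then have "norm (2^n *\<^sub>R (x - y)) < 3" using xy Y(1) by (intro smooth_gaugeD(3)[OF Q] subspace_scale subspace_diff)
    then have "2^n * norm (x - y) < 3" by simp
    then show ?thesis by (simp add: power_one_over field_simps)
  qed
  have norm3: "norm (fst v) \<le> norm v" "norm (fst (snd v)) \<le> norm v" "norm (snd (snd v)) \<le> norm v"
    "norm v \<le> norm (fst v) + norm (fst (snd v)) + norm (snd (snd v))" for v :: "'a \<times> 'a \<times> 'a"
  proof -
    have *: "norm (fst z) \<le> norm z" "norm (snd z) \<le> norm z" for z :: "'b::real_normed_vector \<times> 'c::real_normed_vector"
      using norm_fst_le[of "fst z" "snd z"] norm_snd_le[of "snd z" "fst z"] by simp_all
    show "norm (fst v) \<le> norm v" by (rule *)
    show "norm (fst (snd v)) \<le> norm v" by (rule order_trans[OF *(1) *(2)])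
    show "norm (snd (snd v)) \<le> norm v" by (rule order_trans[OF *(2) *(2)])
    show "norm v \<le> norm (fst v) + norm (fst (snd v)) + norm (snd (snd v))"
      using norm_Pair_le[of "fst v" "snd v"] norm_Pair_le[of "fst (snd v)" "snd (snd v)"] by simp
  qed
  have \<rho>_nonneg: "0 \<le> \<rho> n u v" if "u \<in> box" "v \<in> box" for n u v
    unfolding \<rho>_def using \<mu> boxD[OF that(1)] boxD[OF that(2)] by (intro mult_nonneg_nonneg add_nonneg_nonneg q(1)) auto
  obtain P p where P: "\<And>n. P n \<in> box" and p: "p \<in> box"
    and min: "\<And>u. u \<in> box \<Longrightarrow> objective k p + (\<Sum>n. \<rho> n p (P n)) \<le> objective k u + (\<Sum>n. \<rho> n u (P n))"
  \<comment> \<open>All constants add up three coordinates: bounds \<open>4 * \<delta>\<close>,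
    Lipschitz constants \<open>2\<close>, and separations \<open>3 * (1/2)^n\<close>, the last
    because the threshold \<open>2 * (1/4)^n\<close> means a gauge value below
    \<open>2\<close>.\<close>
  proof (rule perturbed_minimizer[of box "objective k" "- (norm xs * \<delta>)" \<rho> "12 * \<delta> * \<mu>" "6 * \<mu>" "\<lambda>n. \<mu> * (2 * (1/4)^n)" 9])
    show "complete box" by (rule complete_box)
    show "box \<noteq> {}" using base_in_box by blast
    show "continuous_on box (objective k)" by (rule continuous_objective)
    show "- (norm xs * \<delta>) \<le> objective k u" if "u \<in> box" for u
    proof -
      have "0 \<le> k * (Q (k *\<^sub>R (fst u - (x0 + snd (snd u)))) + Q (k *\<^sub>R (fst (snd u) - (x0 + snd (snd u)))))"
        using boxD[OF that] by (intro mult_nonneg_nonneg add_nonneg_nonneg smooth_gaugeD(2)[OF Q] shift_in_Y k)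
      then show ?thesis using objective_lower[OF that k] by linarith
    qed
    show "0 \<le> \<rho> n u v" if "u \<in> box" "v \<in> box" for n u v by (rule \<rho>_nonneg[OF that])
    show "\<rho> n u u = 0" for n u by (simp add: \<rho>_def q_def smooth_gaugeD(1)[OF Q])
    show "\<rho> n u v \<le> 12 * \<delta> * \<mu> * (1/2)^n" if u: "u \<in> box" and v: "v \<in> box" for n u v
    proof -
      have *: "q n x y \<le> 4 * \<delta> * (1/2)^n" if "x \<in> Y" "y \<in> Y" "norm (x - y) \<le> 2 * \<delta>" for x y
      proof -
        have "2 * norm (x - y) * (1/2)^n \<le> 4 * \<delta> * (1/2)^n" using that(3) by (intro mult_right_mono) auto
        then show ?thesis using q(2)[OF that(1,2), of n] by linarith
      qed
      have "q n (fst u) (fst v) + q n (fst (snd u)) (fst (snd v)) + q n (snd (snd u)) (snd (snd v)) \<le> 12 * \<delta> * (1/2)^n"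
        using *[OF boxD(1)[OF u] boxD(1)[OF v] box_diff(1)[OF u v]] *[OF boxD(2)[OF u] boxD(2)[OF v] box_diff(2)[OF u v]]
          *[OF boxD(3)[OF u] boxD(3)[OF v] box_diff(3)[OF u v]] by linarith
      from mult_left_mono[OF this less_imp_le[OF \<mu>]] show ?thesis unfolding \<rho>_def by (simp add: mult_ac)
    qed
    show "\<bar>\<rho> n u w - \<rho> n v w\<bar> \<le> 6 * \<mu> * (1/2)^n * dist u v" if u: "u \<in> box" and v: "v \<in> box" and w: "w \<in> box" for n u v w
    proof -
      have *: "\<bar>q n x z - q n y z\<bar> \<le> 2 * (1/2)^n * dist u v" if "x \<in> Y" "y \<in> Y" "z \<in> Y" "norm (x - y) \<le> norm (u - v)" for x y z
      proof -
        have "2 * (1/2)^n * norm (x - y) \<le> 2 * (1/2)^n * dist u v" using that(4) by (intro mult_left_mono) (auto simp: dist_norm)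
        then show ?thesis using q_lip[OF that(1-3), of n] by linarith
      qed
      have "\<bar>(q n (fst u) (fst w) + q n (fst (snd u)) (fst (snd w)) + q n (snd (snd u)) (snd (snd w))) -
          (q n (fst v) (fst w) + q n (fst (snd v)) (fst (snd w)) + q n (snd (snd v)) (snd (snd w)))\<bar> \<le> 6 * (1/2)^n * dist u v"
        using *[OF boxD(1)[OF u] boxD(1)[OF v] boxD(1)[OF w] norm3(1)[of "u - v", unfolded fst_diff]]
          *[OF boxD(2)[OF u] boxD(2)[OF v] boxD(2)[OF w] norm3(2)[of "u - v", unfolded fst_diff snd_diff]]
          *[OF boxD(3)[OF u] boxD(3)[OF v] boxD(3)[OF w] norm3(3)[of "u - v", unfolded snd_diff]] by linarith
      from mult_left_mono[OF this less_imp_le[OF \<mu>]] show ?thesis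
        unfolding \<rho>_def right_diff_distrib[symmetric] abs_mult using \<mu> by (simp add: mult_ac)
    qed
    show "dist u v \<le> 9 * (1/2)^n" if u: "u \<in> box" and v: "v \<in> box" and l: "\<rho> n u v < \<mu> * (2 * (1/4)^n)" for n u v
    proof -
      have "q n (fst u) (fst v) + q n (fst (snd u)) (fst (snd v)) + q n (snd (snd u)) (snd (snd v)) < 2 * (1/4)^n"
        using l \<mu> unfolding \<rho>_def by simp
      then have "q n (fst u) (fst v) < 2 * (1/4)^n" "q n (fst (snd u)) (fst (snd v)) < 2 * (1/4)^n" "q n (snd (snd u)) (snd (snd v)) < 2 * (1/4)^n"
        using q(1)[OF boxD(1)[OF u] boxD(1)[OF v], of n] q(1)[OF boxD(2)[OF u] boxD(2)[OF v], of n] q(1)[OF boxD(3)[OF u] boxD(3)[OF v], of n] by linarith+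
      then have "norm (fst u - fst v) \<le> 3 * (1/2)^n" "norm (fst (snd u) - fst (snd v)) \<le> 3 * (1/2)^n" "norm (snd (snd u) - snd (snd v)) \<le> 3 * (1/2)^n"
        using boxD[OF u] boxD[OF v] by (auto intro: q_sep)
      then show ?thesis using norm3(4)[of "u - v"] unfolding dist_norm fst_diff snd_diff by linarith
    qed
    show "0 < \<mu> * (2 * (1/4)^n)" for n using \<mu> by simp
    show "\<mu> * (2 * (1/4)^(Suc n)) \<le> \<mu> * (2 * (1/4)^n)" for n using \<mu> by simp
    have "(\<lambda>n. \<mu> * (2 * (1/4)^n)) \<longlonglongrightarrow> \<mu> * (2 * 0)" by (intro tendsto_intros LIMSEQ_power_zero) simp
    then show "(\<lambda>n. \<mu> * (2 * (1/4)^n)) \<longlonglongrightarrow> 0" by simp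
  qed blast
  have "(\<Sum>n. \<rho> n u (P n)) = \<mu> * perturbation P u" if u: "u \<in> box" for u
  proof -
    note s = perturbation_bounds(1-3)[OF P u, folded q_def]
    show ?thesis unfolding \<rho>_def perturbation_def gauge_sum_def q_def[symmetric] case_prod_unfold
      using suminf_mult[OF summable_add[OF summable_add[OF s(1,2)] s(3)], of \<mu>]
        suminf_add[OF summable_add[OF s(1,2)] s(3)] suminf_add[OF s(1,2)] by simp
  qed
  then show ?thesis using that[of P p] P p min by simp
qed

text \<open>Interiority allows each variable to move alone. Moving \<open>u\<close> and
  \<open>w\<close> gives normals containing \<open>- (k * k) *\<^sub>R G1\<close> and
  \<open>- (k * k) *\<^sub>R G2\<close>; moving \<open>h\<close> produces the same terms in
  \<open>D\<close>, so \<open>D\<close> exceeds \<open>a + c\<close> only by the perturbation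
  derivatives. These have norm at most \<open>4\<close> each, hence
  \<open>12 * \<mu>\<close>.\<close>

lemma perturbed_min_normals:
  assumes k: "k \<ge> 0" and \<mu>: "\<mu> > 0" and P: "\<And>n. P n \<in> box" and p: "(u, w, h) \<in> box"
    and min: "\<And>p'. p' \<in> box \<Longrightarrow> objective k (u, w, h) + \<mu> * perturbation P (u, w, h) \<le> objective k p' + \<mu> * perturbation P p'"
    and int: "norm (u - x0) < \<delta>" "norm (w - x0) < \<delta>" "norm h < \<delta>"
  obtains a c where "a \<in> frechet_normal (A \<inter> Y) u" "c \<in> frechet_normal (C \<inter> Y) w"
    "\<And>v. v \<in> span E \<Longrightarrow> xs v - blinfun_apply a v - blinfun_apply c v \<le> (\<gamma> + 12 * \<mu>) * norm v"
proof -
  note m = boxD[OF p, simplified] and d = box_diff[OF p P, simplified]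
  have m': "u \<in> Y" "w \<in> Y" "h \<in> Y" "u \<in> A" "w \<in> C" "h \<in> span E" using m by auto
  define J1 where "J1 = gauge_sum Q (\<lambda>n. fst (P n))"
  define J2 where "J2 = gauge_sum Q (\<lambda>n. fst (snd (P n)))"
  define J3 where "J3 = gauge_sum Q (\<lambda>n. snd (snd (P n)))"
  obtain H1 :: "'a \<Rightarrow>\<^sub>L real" where H1: "norm H1 \<le> 4" "(J1 has_derivative blinfun_apply H1) (at u within Y)"
    unfolding J1_def using gauge_sum_derivative[where P = "\<lambda>n. fst (P n)", OF Q Y(1) boxD(1)[OF P] m'(1) d(1)] by blast
  obtain H2 :: "'a \<Rightarrow>\<^sub>L real" where H2: "norm H2 \<le> 4" "(J2 has_derivative blinfun_apply H2) (at w within Y)"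
    unfolding J2_def using gauge_sum_derivative[where P = "\<lambda>n. fst (snd (P n))", OF Q Y(1) boxD(2)[OF P] m'(2) d(2)] by blast
  obtain H3 :: "'a \<Rightarrow>\<^sub>L real" where H3: "norm H3 \<le> 4" "(J3 has_derivative blinfun_apply H3) (at h within Y)"
    unfolding J3_def using gauge_sum_derivative[where P = "\<lambda>n. snd (snd (P n))", OF Q Y(1) boxD(3)[OF P] m'(3) d(3)] by blast
  have sY: "x0 + h \<in> Y" "u - x0 \<in> Y" "w - x0 \<in> Y"
    using m' x0(3) Y(1) by (auto intro: subspace_add subspace_diff)
  obtain G1 :: "'a \<Rightarrow>\<^sub>L real" where G1: "\<And>c x p. x \<in> Y \<Longrightarrow> p \<in> Y \<Longrightarrow> c *\<^sub>R (x - p) = k *\<^sub>R (u - (x0 + h)) \<Longrightarrow>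
      ((\<lambda>x. Q (c *\<^sub>R (x - p))) has_derivative (\<lambda>h. c * blinfun_apply G1 h)) (at x within Y)"
    using smooth_gauge_derivative[OF Q Y(1) shift_in_Y[OF m'(1) m'(3), of k]] by metis
  obtain G2 :: "'a \<Rightarrow>\<^sub>L real" where G2: "\<And>c x p. x \<in> Y \<Longrightarrow> p \<in> Y \<Longrightarrow> c *\<^sub>R (x - p) = k *\<^sub>R (w - (x0 + h)) \<Longrightarrow>
      ((\<lambda>x. Q (c *\<^sub>R (x - p))) has_derivative (\<lambda>h. c * blinfun_apply G2 h)) (at x within Y)"
    using smooth_gauge_derivative[OF Q Y(1) shift_in_Y[OF m'(2) m'(3), of k]] by metis
  define a where "a = - ((k * k) *\<^sub>R G1 + \<mu> *\<^sub>R H1)"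
  define c where "c = - ((k * k) *\<^sub>R G2 + \<mu> *\<^sub>R H2)"
  have near: "norm (x - x0) \<le> \<delta>" if "norm (x - y) < \<delta> - norm (y - x0)" for x y
    using norm_triangle_ineq[of "x - y" "y - x0"] that by simp
  have a: "a \<in> frechet_normal (A \<inter> Y) u"
    unfolding a_def
  proof (rule frechet_normal_of_min[where F = "\<lambda>x. k * Q (k *\<^sub>R (x - (x0 + h))) + \<mu> * J1 x" and r = "\<delta> - norm (u - x0)"])
    have "((\<lambda>x. k * Q (k *\<^sub>R (x - (x0 + h))) + \<mu> * J1 x) has_derivative (\<lambda>v. k * (k * blinfun_apply G1 v) + \<mu> * blinfun_apply H1 v)) (at u within Y)"
      by (intro has_derivative_add has_derivative_mult_right G1 H1 m' sY refl)
    moreover have "(\<lambda>v. k * (k * blinfun_apply G1 v) + \<mu> * blinfun_apply H1 v) = blinfun_apply ((k * k) *\<^sub>R G1 + \<mu> *\<^sub>R H1)"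
      by (auto simp: blinfun.add_left blinfun.scaleR_left)
    ultimately show "((\<lambda>x. k * Q (k *\<^sub>R (x - (x0 + h))) + \<mu> * J1 x) has_derivative blinfun_apply ((k * k) *\<^sub>R G1 + \<mu> *\<^sub>R H1)) (at u within Y)"
      by simp
    fix x assume x: "x \<in> A \<inter> Y" "norm (x - u) < \<delta> - norm (u - x0)"
    have "(x, w, h) \<in> box" using p x near[OF x(2)] unfolding box_def by (auto simp: dist_norm norm_minus_commute)
    from min[OF this] show "k * Q (k *\<^sub>R (u - (x0 + h))) + \<mu> * J1 u \<le> k * Q (k *\<^sub>R (x - (x0 + h))) + \<mu> * J1 x"
      unfolding objective_def perturbation_def J1_def by (simp add: algebra_simps)
  qed (use m' int in auto)
  have c: "c \<in> frechet_normal (C \<inter> Y) w"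
    unfolding c_def
  proof (rule frechet_normal_of_min[where F = "\<lambda>x. k * Q (k *\<^sub>R (x - (x0 + h))) + \<mu> * J2 x" and r = "\<delta> - norm (w - x0)"])
    have "((\<lambda>x. k * Q (k *\<^sub>R (x - (x0 + h))) + \<mu> * J2 x) has_derivative (\<lambda>v. k * (k * blinfun_apply G2 v) + \<mu> * blinfun_apply H2 v)) (at w within Y)"
      by (intro has_derivative_add has_derivative_mult_right G2 H2 m' sY refl)
    moreover have "(\<lambda>v. k * (k * blinfun_apply G2 v) + \<mu> * blinfun_apply H2 v) = blinfun_apply ((k * k) *\<^sub>R G2 + \<mu> *\<^sub>R H2)"
      by (auto simp: blinfun.add_left blinfun.scaleR_left)
    ultimately show "((\<lambda>x. k * Q (k *\<^sub>R (x - (x0 + h))) + \<mu> * J2 x) has_derivative blinfun_apply ((k * k) *\<^sub>R G2 + \<mu> *\<^sub>R H2)) (at w within Y)"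
      by simp
    fix x assume x: "x \<in> C \<inter> Y" "norm (x - w) < \<delta> - norm (w - x0)"
    have "(u, x, h) \<in> box" using p x near[OF x(2)] unfolding box_def by (auto simp: dist_norm norm_minus_commute)
    from min[OF this] show "k * Q (k *\<^sub>R (w - (x0 + h))) + \<mu> * J2 w \<le> k * Q (k *\<^sub>R (x - (x0 + h))) + \<mu> * J2 x"
      unfolding objective_def perturbation_def J2_def by (simp add: algebra_simps)
  qed (use m' int in auto)
  have "xs v - blinfun_apply a v - blinfun_apply c v \<le> (\<gamma> + 12 * \<mu>) * norm v" if v: "v \<in> span E" for v
  proof -
    \<comment> \<open>The gauge arguments are rewritten with \<open>h\<close> as the moving
      variable, so that \<open>G1\<close> and \<open>G2\<close> apply with factor
      \<open>- k\<close>.\<close>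
    define R where "R = (\<lambda>h. k * Q ((- k) *\<^sub>R (h - (u - x0))) + k * Q ((- k) *\<^sub>R (h - (w - x0))) + \<mu> * J3 h)"
    define D where "D = - ((k * k) *\<^sub>R G1) - (k * k) *\<^sub>R G2 + \<mu> *\<^sub>R H3"
    have "(R has_derivative (\<lambda>v. k * ((- k) * blinfun_apply G1 v) + k * ((- k) * blinfun_apply G2 v) + \<mu> * blinfun_apply H3 v)) (at h within Y)"
      unfolding R_def by (intro has_derivative_add has_derivative_mult_right G1 G2 H3 m' sY) (simp_all add: algebra_simps)
    moreover have "(\<lambda>v. k * ((- k) * blinfun_apply G1 v) + k * ((- k) * blinfun_apply G2 v) + \<mu> * blinfun_apply H3 v) = blinfun_apply D"
      unfolding D_def by (auto simp: blinfun.add_left blinfun.diff_left blinfun.minus_left blinfun.scaleR_left)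
    ultimately have R: "(R has_derivative blinfun_apply D) (at h within Y)" by simp
    have Rf: "objective k (u, w, h') + \<mu> * perturbation P (u, w, h') = \<gamma> * norm h' - xs h' + R h' + \<mu> * (J1 u + J2 w)" for h'
      unfolding objective_def perturbation_def R_def J1_def J2_def J3_def by (simp add: algebra_simps)
    have "0 \<le> (\<gamma> * norm v - xs v) + blinfun_apply D v"
    proof (rule directional_derivative_min[OF R Y(1) m'(3)])
      show "v \<in> Y" using v span_Y by blast
      show "\<delta> - norm h > 0" using int by simp
      fix t assume t: "(0::real) < t" "norm (t *\<^sub>R v) < \<delta> - norm h"
      have "norm (h + t *\<^sub>R v) \<le> \<delta>" using norm_triangle_ineq[of h "t *\<^sub>R v"] t(2) by linarith
      then have "(u, w, h + t *\<^sub>R v) \<in> box" using p v unfolding box_def by (auto intro: span_add span_scale)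
      from min[OF this] have "\<gamma> * norm h - xs h + R h \<le> \<gamma> * norm (h + t *\<^sub>R v) - xs (h + t *\<^sub>R v) + R (h + t *\<^sub>R v)"
        unfolding Rf by simp
      \<comment> \<open>The norm need not be differentiable; the triangle inequality bounds its
        increment linearly in \<open>t\<close>.\<close>
      moreover have "\<gamma> * norm (h + t *\<^sub>R v) \<le> \<gamma> * (norm h + t * norm v)"
        using norm_triangle_ineq[of h "t *\<^sub>R v"] t(1) pos(2) by (intro mult_left_mono) auto
      ultimately show "R h \<le> R (h + t *\<^sub>R v) + t * (\<gamma> * norm v - xs v)"
        by (simp add: blinfun.add_right blinfun.scaleR_right algebra_simps)
    qed
    moreover have "blinfun_apply D v = blinfun_apply a v + blinfun_apply c v + \<mu> * (blinfun_apply H1 v + blinfun_apply H2 v + blinfun_apply H3 v)"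
      unfolding D_def a_def c_def by (simp add: blinfun.add_left blinfun.diff_left blinfun.minus_left blinfun.scaleR_left algebra_simps)
    moreover have "\<mu> * (blinfun_apply H1 v + blinfun_apply H2 v + blinfun_apply H3 v) \<le> \<mu> * (12 * norm v)"
    proof (rule mult_left_mono)
      have *: "blinfun_apply H v \<le> 4 * norm v" if "norm H \<le> 4" for H :: "'a \<Rightarrow>\<^sub>L real"
        using norm_blinfun[of H v] mult_right_mono[OF that, of "norm v"] by simp
      show "blinfun_apply H1 v + blinfun_apply H2 v + blinfun_apply H3 v \<le> 12 * norm v"
        using *[OF H1(1)] *[OF H2(1)] *[OF H3(1)] by linarith
    qed (use \<mu> in simp)
    ultimately show ?thesis by (simp add: algebra_simps)
  qed
  then show ?thesis using that a c by blast
qed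

text \<open>The penalty parameter tends to infinity while the perturbation is multiplied by its
  inverse. Compactness supplies a limit \<open>l\<close> of the \<open>h\<close>, and then
  \<open>u\<close> and \<open>w\<close> tend to \<open>x0 + l\<close>, a point of both closed
  sets.\<close>

lemma approximate_normals_in_subspace:
  obtains u w a c where "u \<in> A" "w \<in> C" "norm (u - x0) < \<delta>" "norm (w - x0) < \<delta>"
    "a \<in> frechet_normal (A \<inter> Y) u" "c \<in> frechet_normal (C \<inter> Y) w"
    "\<And>v. v \<in> span E \<Longrightarrow> \<bar>xs v - blinfun_apply a v - blinfun_apply c v\<bar> \<le> 2 * \<gamma> * norm v"
proof -
  define \<kappa> where "\<kappa> n = real (Suc n)" for n
  have \<kappa>: "\<kappa> n > 0" "\<kappa> n \<ge> 1" for n by (simp_all add: \<kappa>_def)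
  \<comment> \<open>An upper bound of the weighted penalty at the minimisers: comparison with
    \<open>(x0, x0, 0)\<close>, where the objective vanishes, gives \<open>24 * \<delta>\<close>,
    and \<open>- xs\<close> contributes at most \<open>norm xs * \<delta>\<close>.\<close>
  define K0 where "K0 = 24 * \<delta> + norm xs * \<delta>"
  have "\<exists>P p. (\<forall>n. P n \<in> box) \<and> p \<in> box \<and> (\<forall>p'\<in>box. objective (\<kappa> n) p + 1 / \<kappa> n * perturbation P p \<le> objective (\<kappa> n) p' + 1 / \<kappa> n * perturbation P p')" for n
    using exists_perturbed_min[of "\<kappa> n" "1 / \<kappa> n"] \<kappa>(1)[of n] by (metis less_imp_le zero_less_divide_1_iff)
  then obtain P p where P: "\<And>n m. P n m \<in> box" and p: "\<And>n. p n \<in> box"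
    and min: "\<And>n p'. p' \<in> box \<Longrightarrow> objective (\<kappa> n) (p n) + 1 / \<kappa> n * perturbation (P n) (p n) \<le> objective (\<kappa> n) p' + 1 / \<kappa> n * perturbation (P n) p'"
    by metis
  define u where "u n = fst (p n)" for n
  define w where "w n = fst (snd (p n))" for n
  define h where "h n = snd (snd (p n))" for n
  have p_eq: "p n = (u n, w n, h n)" for n by (simp add: u_def w_def h_def)
  note m = boxD[OF p, folded u_def w_def h_def]
  have fle: "objective (\<kappa> n) (p n) \<le> 24 * \<delta> * (1 / \<kappa> n)" for n
  proof -
    define i where "i = 1 / \<kappa> n"
    have i: "i \<ge> 0" using \<kappa>(1)[of n] by (simp add: i_def)
    have "objective (\<kappa> n) (x0, x0, 0) = 0" unfolding objective_def by (simp add: smooth_gaugeD(1)[OF Q])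
    moreover have "i * perturbation (P n) (x0, x0, 0) \<le> i * (24 * \<delta>)"
      by (rule mult_left_mono[OF perturbation_bounds(5)[where P = "P n", OF P base_in_box] i])
    moreover have "0 \<le> i * perturbation (P n) (p n)"
      by (rule mult_nonneg_nonneg[OF i perturbation_bounds(4)[where P = "P n", OF P p[of n]]])
    ultimately show ?thesis using min[OF base_in_box, of n] unfolding i_def[symmetric] by (simp only: mult.commute[of i])
  qed
  have inv0: "(\<lambda>n. c * (1 / \<kappa> n)) \<longlonglongrightarrow> 0" for c
    using tendsto_mult[OF tendsto_const LIMSEQ_inverse_real_of_nat, of c] by (simp add: \<kappa>_def inverse_eq_divide)
  have close: "norm (u n - (x0 + h n)) \<le> 3 * (1 / \<kappa> n)" "norm (w n - (x0 + h n)) \<le> 3 * (1 / \<kappa> n)" if n: "\<kappa> n > K0" for n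
  proof -
    let ?a = "Q (\<kappa> n *\<^sub>R (u n - (x0 + h n)))" and ?b = "Q (\<kappa> n *\<^sub>R (w n - (x0 + h n)))"
    have "24 * \<delta> * (1 / \<kappa> n) \<le> 24 * \<delta> * 1" using \<kappa>[of n] pos by (intro mult_left_mono) auto
    then have "\<kappa> n * (?a + ?b) \<le> K0"
      using objective_lower[OF p, of "\<kappa> n" n] fle[of n] \<kappa>(1)[of n] unfolding K0_def u_def w_def h_def by linarith
    then have "\<kappa> n * (?a + ?b) < \<kappa> n * 1" using n by linarith
    then have "?a + ?b < 1" using \<kappa>(1)[of n] by simp
    moreover have "0 \<le> ?a" "0 \<le> ?b" by (intro smooth_gaugeD(2)[OF Q] shift_in_Y m)+
    ultimately have "?a < 2" "?b < 2" by linarith+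
    then have "norm (\<kappa> n *\<^sub>R (u n - (x0 + h n))) < 3" "norm (\<kappa> n *\<^sub>R (w n - (x0 + h n))) < 3"
      using smooth_gaugeD(3)[OF Q shift_in_Y[OF m(1) m(3)]] smooth_gaugeD(3)[OF Q shift_in_Y[OF m(2) m(3)]] by blast+
    then show "norm (u n - (x0 + h n)) \<le> 3 * (1 / \<kappa> n)" "norm (w n - (x0 + h n)) \<le> 3 * (1 / \<kappa> n)"
      using \<kappa>(1)[of n] unfolding norm_scaleR by (simp_all add: pos_le_divide_eq mult.commute)
  qed
  have "compact (cball 0 \<delta> \<inter> span E)" by (rule compact_ball_span_finite[OF E(1)])
  moreover have "h n \<in> cball 0 \<delta> \<inter> span E" for n using m by simp
  ultimately obtain l r where l: "l \<in> cball 0 \<delta> \<inter> span E" and r: "strict_mono r" "(\<lambda>n. h (r n)) \<longlonglongrightarrow> l"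
    unfolding compact_def comp_def by metis
  have inv0r: "(\<lambda>n. c * (1 / \<kappa> (r n))) \<longlonglongrightarrow> 0" for c
    using LIMSEQ_subseq_LIMSEQ[OF inv0 r(1)] by (simp add: comp_def)
  have "\<forall>\<^sub>F n in sequentially. 1 * (1 / \<kappa> (r n)) < 1 / (\<bar>K0\<bar> + 1)" by (intro order_tendstoD(2)[OF inv0r]) simp
  then have large: "\<forall>\<^sub>F n in sequentially. \<kappa> (r n) > K0"
  proof eventually_elim
    case (elim n)
    then show ?case using \<kappa>(1)[of "r n"] by (simp add: field_simps)
  qed
  have "(\<lambda>n. u (r n) - (x0 + h (r n))) \<longlonglongrightarrow> 0" "(\<lambda>n. w (r n) - (x0 + h (r n))) \<longlonglongrightarrow> 0"
    by (rule Lim_null_comparison[OF _ inv0r[of 3]], use large in eventually_elim, erule close)+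
  moreover have "(\<lambda>n. x0 + h (r n)) \<longlonglongrightarrow> x0 + l" by (intro tendsto_intros r(2))
  ultimately have ul: "(\<lambda>n. u (r n)) \<longlonglongrightarrow> x0 + l" and wl: "(\<lambda>n. w (r n)) \<longlonglongrightarrow> x0 + l"
    using tendsto_add[of "\<lambda>n. u (r n) - (x0 + h (r n))" 0 sequentially "\<lambda>n. x0 + h (r n)" "x0 + l"]
      tendsto_add[of "\<lambda>n. w (r n) - (x0 + h (r n))" 0 sequentially "\<lambda>n. x0 + h (r n)" "x0 + l"] by simp_all
  have lA: "x0 + l \<in> A" using closed_sequentially[OF AC(1) _ ul] m(4) by simp
  have lC: "x0 + l \<in> C" using closed_sequentially[OF AC(2) _ wl] m(5) by simp
  \<comment> \<open>This limit inequality is what the strict \<open>sphere\<close> assumption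
    contradicts if \<open>norm l = \<delta>\<close>.\<close>
  have "\<gamma> * norm l - xs l \<le> 0"
  proof (rule LIMSEQ_le)
    show "(\<lambda>n. \<gamma> * norm (h (r n)) - xs (h (r n))) \<longlonglongrightarrow> \<gamma> * norm l - xs l" by (intro tendsto_intros r(2))
    show "(\<lambda>n. 24 * \<delta> * (1 / \<kappa> (r n))) \<longlonglongrightarrow> 0" by (rule inv0r)
    show "\<exists>N. \<forall>n\<ge>N. \<gamma> * norm (h (r n)) - xs (h (r n)) \<le> 24 * \<delta> * (1 / \<kappa> (r n))"
      using order_trans[OF objective_ge[OF p less_imp_le[OF \<kappa>(1)]] fle] unfolding h_def by blast
  qed
  then have "norm l \<noteq> \<delta>" using sphere[of l] l lA lC by force
  then have ld: "norm l < \<delta>" using l by simp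
  have "\<forall>\<^sub>F n in sequentially. norm (h (r n)) < \<delta>" by (intro order_tendstoD(2)[OF tendsto_norm[OF r(2)]] ld)
  moreover have "\<forall>\<^sub>F n in sequentially. norm (u (r n) - x0) < \<delta>"
    by (intro order_tendstoD(2)[OF tendsto_norm[OF tendsto_diff[OF ul tendsto_const]]]) (use ld in simp)
  moreover have "\<forall>\<^sub>F n in sequentially. norm (w (r n) - x0) < \<delta>"
    by (intro order_tendstoD(2)[OF tendsto_norm[OF tendsto_diff[OF wl tendsto_const]]]) (use ld in simp)
  moreover have "\<forall>\<^sub>F n in sequentially. 12 * (1 / \<kappa> (r n)) < \<gamma>" by (intro order_tendstoD(2)[OF inv0r] pos)
  ultimately have "\<forall>\<^sub>F n in sequentially. norm (h (r n)) < \<delta> \<and> norm (u (r n) - x0) < \<delta> \<and> norm (w (r n) - x0) < \<delta> \<and> 12 * (1 / \<kappa> (r n)) < \<gamma>"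
    by eventually_elim blast
  then obtain n0 where n0: "norm (h (r n0)) < \<delta>" "norm (u (r n0) - x0) < \<delta>" "norm (w (r n0) - x0) < \<delta>" "12 * (1 / \<kappa> (r n0)) < \<gamma>"
    by (auto simp: eventually_sequentially)
  define n where "n = r n0"
  have "1 / \<kappa> n > 0" using \<kappa>(1) by simp
  obtain a c where ac: "a \<in> frechet_normal (A \<inter> Y) (u n)" "c \<in> frechet_normal (C \<inter> Y) (w n)"
    "\<And>v. v \<in> span E \<Longrightarrow> xs v - blinfun_apply a v - blinfun_apply c v \<le> (\<gamma> + 12 * (1 / \<kappa> n)) * norm v"
    using perturbed_min_normals[OF less_imp_le[OF \<kappa>(1)] \<open>1 / \<kappa> n > 0\<close> P[of n] p[of n, unfolded p_eq] min[where n = n, unfolded p_eq]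
        n0(2,3,1)[folded n_def]] by blast
  have up: "xs v - blinfun_apply a v - blinfun_apply c v \<le> 2 * \<gamma> * norm v" if "v \<in> span E" for v
  proof -
    have "(\<gamma> + 12 * (1 / \<kappa> n)) * norm v \<le> (2 * \<gamma>) * norm v" using n0(4) unfolding n_def by (intro mult_right_mono) auto
    then show ?thesis using ac(3)[OF that] by linarith
  qed
  \<comment> \<open>The span is symmetric, so the bound at \<open>- v\<close> gives the absolute
    value.\<close>
  have "\<bar>xs v - blinfun_apply a v - blinfun_apply c v\<bar> \<le> 2 * \<gamma> * norm v" if "v \<in> span E" for v
    using up[OF that] up[OF span_neg[OF that]] by (simp add: blinfun.minus_right abs_le_iff)
  then show ?thesis using that[OF m(4,5) _ _ ac(1,2)] n0(2,3) unfolding n_def by blast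
qed

end

section \<open>Families of sets\<close>

text \<open>Including \<open>x0\<close> and \<open>E\<close> in \<open>Y\<close> places the whole
  finite-dimensional test space there. Lifting each normal from the trace on \<open>Y\<close> back
  to the full set costs \<open>\<eta> / 2\<close>.\<close>

lemma approximate_normals_two_sets:
  fixes A C :: "'a::banach set"
  assumes asp: "asplund_space TYPE('a)" and AC: "closed A" "closed C" and E: "finite E"
    and x0: "x0 \<in> A" "x0 \<in> C" and gt0: "\<delta> > 0" "\<gamma> > 0" "\<eta> > 0"
    and sphere: "\<And>h. h \<in> span E \<Longrightarrow> norm h = \<delta> \<Longrightarrow> x0 + h \<in> A \<Longrightarrow> x0 + h \<in> C \<Longrightarrow> blinfun_apply xs h < \<gamma> * norm h"
  obtains u w a c where "norm (u - x0) < \<delta>" "norm (w - x0) < \<delta>" "a \<in> frechet_normal A u" "c \<in> frechet_normal C w"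
    "\<And>e. e \<in> E \<Longrightarrow> \<bar>blinfun_apply xs e - blinfun_apply a e - blinfun_apply c e\<bar> \<le> 2 * \<gamma> * norm e + \<eta>"
proof -
  obtain Y where Y: "subspace Y" "closed Y" "separable_space (top_of_set Y)" "insert x0 E \<subseteq> Y"
    and ext: "\<And>B w ys \<eta>. B \<in> {A, C} \<Longrightarrow> ys \<in> frechet_normal (B \<inter> Y) w \<Longrightarrow> 0 < \<eta> \<Longrightarrow>
      \<exists>zs\<in>frechet_normal B w. \<forall>e\<in>E. \<bar>blinfun_apply zs e - blinfun_apply ys e\<bar> \<le> \<eta>"
    using separable_reduction[of "{A, C}" E "insert x0 E"] E
    by (metis countable_finite finite.emptyI finite.insertI insert_not_empty)
  have "separable_dual_on Y" using asp Y(1,3) unfolding asplund_space_def by blast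
  then obtain Q where Q: "smooth_gauge Y Q" using exists_smooth_gauge Y(1) by blast
  interpret two_sets Y Q A C E x0 xs \<delta> \<gamma>
    by unfold_locales (use Y Q AC E x0 gt0 sphere in auto)
  obtain u w a c where uw: "u \<in> A" "w \<in> C" "norm (u - x0) < \<delta>" "norm (w - x0) < \<delta>"
    "a \<in> frechet_normal (A \<inter> Y) u" "c \<in> frechet_normal (C \<inter> Y) w"
    "\<And>v. v \<in> span E \<Longrightarrow> \<bar>blinfun_apply xs v - blinfun_apply a v - blinfun_apply c v\<bar> \<le> 2 * \<gamma> * norm v"
    using approximate_normals_in_subspace by blast
  have \<eta>2: "\<eta> / 2 > 0" using gt0 by simp
  obtain a' where a': "a' \<in> frechet_normal A u" "\<And>e. e \<in> E \<Longrightarrow> \<bar>blinfun_apply a' e - blinfun_apply a e\<bar> \<le> \<eta> / 2"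
    using ext[OF _ uw(5) \<eta>2] by blast
  obtain c' where c': "c' \<in> frechet_normal C w" "\<And>e. e \<in> E \<Longrightarrow> \<bar>blinfun_apply c' e - blinfun_apply c e\<bar> \<le> \<eta> / 2"
    using ext[OF _ uw(6) \<eta>2] by blast
  have "\<bar>blinfun_apply xs e - blinfun_apply a' e - blinfun_apply c' e\<bar> \<le> 2 * \<gamma> * norm e + \<eta>" if e: "e \<in> E" for e
    using uw(7)[OF span_base[OF e]] a'(2)[OF e] c'(2)[OF e] by linarith
  then show ?thesis using that uw(3,4) a'(1) c'(1) by blast
qed

lemma exists_small_slope:
  assumes "finite E" "(\<eta>::real) > 0"
  obtains \<gamma> where "\<gamma> > 0" "\<And>e. e \<in> E \<Longrightarrow> 2 * \<gamma> * norm e \<le> \<eta>"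
proof -
  define N where "N = 1 + (\<Sum>e\<in>E. norm e)"
  have N: "N > 0" unfolding N_def by (intro add_pos_nonneg sum_nonneg) auto
  have "2 * (\<eta> / (2 * N)) * norm e \<le> \<eta>" if "e \<in> E" for e
  proof -
    have "norm e \<le> N" using member_le_sum[OF that, of norm] assms(1) unfolding N_def by simp
    then have "\<eta> * norm e \<le> \<eta> * N" using assms(2) by (intro mult_left_mono) auto
    then show ?thesis using N by (simp add: field_simps)
  qed
  then show ?thesis using that[of "\<eta> / (2 * N)"] N assms(2) by simp
qed

text \<open>Halving the slope gives the strict inequality that the compactness and limit arguments
  rely on.\<close>

lemma frechet_normal_sphere:
  assumes "xs \<in> frechet_normal A x" "\<gamma> > 0" "\<epsilon> > 0"
  obtains \<delta> where "0 < \<delta>" "\<delta> \<le> \<epsilon>" "\<And>h. norm h = \<delta> \<Longrightarrow> x + h \<in> A \<Longrightarrow> blinfun_apply xs h < \<gamma> * norm h"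
proof -
  obtain d where d: "d > 0" "\<And>u. u \<in> A \<Longrightarrow> norm (u - x) < d \<Longrightarrow> blinfun_apply xs (u - x) \<le> \<gamma> / 2 * norm (u - x)"
    using assms(1)[unfolded frechet_normal_iff, THEN conjunct2, rule_format, of "\<gamma> / 2"] assms(2) by auto
  define \<delta> where "\<delta> = min (d / 2) \<epsilon>"
  have \<delta>: "0 < \<delta>" "\<delta> \<le> \<epsilon>" "\<delta> < d" using d(1) assms(3) by (auto simp: \<delta>_def)
  have "blinfun_apply xs h < \<gamma> * norm h" if h: "norm h = \<delta>" "x + h \<in> A" for h
  proof -
    have "blinfun_apply xs h \<le> \<gamma> / 2 * norm h" using d(2)[OF h(2)] h(1) \<delta>(3) by simp
    also have "\<dots> < \<gamma> * norm h" using h(1) \<delta>(1) assms(2) by simp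
    finally show ?thesis .
  qed
  then show ?thesis using that \<delta> by blast
qed

text \<open>One set is split off and the remaining ones are intersected. The normal \<open>c\<close>
  to that intersection is exact, so it passes the sphere test about its own base point
  \<open>w\<close> and the induction hypothesis applies there.\<close>

lemma approximate_normals_finite_family:
  fixes S :: "'t \<Rightarrow> 'a::banach set" and xs :: "'a \<Rightarrow>\<^sub>L real"
  assumes asp: "asplund_space TYPE('a)" and E: "finite E" and F: "finite F"
    and "\<And>t. t \<in> F \<Longrightarrow> closed (S t)" "\<And>t. t \<in> F \<Longrightarrow> x0 \<in> S t" "\<delta> > 0" "\<gamma> > 0" "\<eta> > 0"
    and "\<And>h. h \<in> span E \<Longrightarrow> norm h = \<delta> \<Longrightarrow> (\<And>t. t \<in> F \<Longrightarrow> x0 + h \<in> S t) \<Longrightarrow> blinfun_apply xs h < \<gamma> * norm h"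
  shows "\<exists>w ws. (\<forall>t\<in>F. norm (w t - x0) \<le> \<delta> \<and> ws t \<in> frechet_normal (S t) (w t)) \<and>
    (\<forall>e\<in>E. \<bar>blinfun_apply xs e - blinfun_apply (\<Sum>t\<in>F. ws t) e\<bar> \<le> 2 * \<gamma> * norm e + \<eta>)"
  using F assms(4-)
proof (induction F arbitrary: x0 xs \<delta> \<gamma> \<eta> rule: finite_induct)
  case empty
  \<comment> \<open>Without sets the sphere condition concerns every direction of
    \<open>span E\<close>; scaling extends it to all lengths, so the empty sum already approximates
    \<open>xs\<close>.\<close>
  have le: "blinfun_apply xs v \<le> \<gamma> * norm v" if v: "v \<in> span E" for v
  proof (cases "v = 0")
    case False
    define h where "h = (\<delta> / norm v) *\<^sub>R v"
    have "h \<in> span E" "norm h = \<delta>" using v False empty.prems(3) by (auto simp: h_def intro: span_scale)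
    then have "blinfun_apply xs h < \<gamma> * norm h" using empty.prems(6) by blast
    then have "\<delta> / norm v * blinfun_apply xs v < \<gamma> * \<delta>" using \<open>norm h = \<delta>\<close> by (simp add: h_def blinfun.scaleR_right)
    then have "\<delta> * blinfun_apply xs v < \<delta> * (\<gamma> * norm v)" using False by (simp add: field_simps)
    then show ?thesis using empty.prems(3) by simp
  qed simp
  have "\<bar>blinfun_apply xs e\<bar> \<le> 2 * \<gamma> * norm e + \<eta>" if e: "e \<in> E" for e
  proof -
    have "\<bar>blinfun_apply xs e\<bar> \<le> \<gamma> * norm e"
      using le[OF span_base[OF e]] le[OF span_neg[OF span_base[OF e]]] by (simp add: blinfun.minus_right abs_le_iff)
    moreover have "0 \<le> \<gamma> * norm e" using empty.prems(4) by simp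
    ultimately show ?thesis using empty.prems(5) by linarith
  qed
  then show ?case by simp
next
  case (insert t F)
  define C where "C = (\<Inter>s\<in>F. S s)"
  have C: "closed C" unfolding C_def using insert.prems(1) by (intro closed_INT) auto
  have \<eta>3: "\<eta> / 3 > 0" using insert.prems(5) by simp
  obtain u w a c where uw: "norm (u - x0) < \<delta>" "norm (w - x0) < \<delta>" "a \<in> frechet_normal (S t) u" "c \<in> frechet_normal C w"
    "\<And>e. e \<in> E \<Longrightarrow> \<bar>blinfun_apply xs e - blinfun_apply a e - blinfun_apply c e\<bar> \<le> 2 * \<gamma> * norm e + \<eta> / 3"
  proof (rule approximate_normals_two_sets[OF asp _ C E, of "S t" x0 \<delta> \<gamma> "\<eta> / 3" xs])
    show "closed (S t)" "x0 \<in> S t" "x0 \<in> C" "\<delta> > 0" "\<gamma> > 0" "\<eta> / 3 > 0"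
      using insert.prems by (auto simp: C_def)
    show "blinfun_apply xs h < \<gamma> * norm h" if "h \<in> span E" "norm h = \<delta>" "x0 + h \<in> S t" "x0 + h \<in> C" for h
      using insert.prems(6)[OF that(1,2)] that(3,4) by (auto simp: C_def)
  qed blast
  \<comment> \<open>The error \<open>\<eta>\<close> is split into thirds: the two-set step, the
    slope term with \<open>\<gamma>'\<close>, and the tolerance of the induction hypothesis.\<close>
  obtain \<gamma>' where \<gamma>': "\<gamma>' > 0" "\<And>e. e \<in> E \<Longrightarrow> 2 * \<gamma>' * norm e \<le> \<eta> / 3"
    using exists_small_slope[OF E \<eta>3] by blast
  \<comment> \<open>The new radius is limited to this gap, which keeps the remaining points within
    \<open>\<delta>\<close> of \<open>x0\<close>.\<close>
  have "\<delta> - norm (w - x0) > 0" using uw(2) by simp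
  then obtain \<delta>' where \<delta>': "0 < \<delta>'" "\<delta>' \<le> \<delta> - norm (w - x0)"
    "\<And>h. norm h = \<delta>' \<Longrightarrow> w + h \<in> C \<Longrightarrow> blinfun_apply c h < \<gamma>' * norm h"
    using frechet_normal_sphere[OF uw(4) \<gamma>'(1)] by blast
  have wC: "w \<in> C" using uw(4) by (simp add: frechet_normal_iff)
  have "\<exists>v vs. (\<forall>s\<in>F. norm (v s - w) \<le> \<delta>' \<and> vs s \<in> frechet_normal (S s) (v s)) \<and>
      (\<forall>e\<in>E. \<bar>blinfun_apply c e - blinfun_apply (\<Sum>s\<in>F. vs s) e\<bar> \<le> 2 * \<gamma>' * norm e + \<eta> / 3)"
  proof (rule insert.IH[OF _ _ \<delta>'(1) \<gamma>'(1) \<eta>3])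
    show "closed (S s)" "w \<in> S s" if "s \<in> F" for s using insert.prems(1) that wC by (auto simp: C_def)
    show "blinfun_apply c h < \<gamma>' * norm h" if "norm h = \<delta>'" "\<And>s. s \<in> F \<Longrightarrow> w + h \<in> S s" for h
      using \<delta>'(3)[OF that(1)] that(2) by (auto simp: C_def)
  qed
  then obtain v vs where v: "\<And>s. s \<in> F \<Longrightarrow> norm (v s - w) \<le> \<delta>'" "\<And>s. s \<in> F \<Longrightarrow> vs s \<in> frechet_normal (S s) (v s)"
    "\<And>e. e \<in> E \<Longrightarrow> \<bar>blinfun_apply c e - blinfun_apply (\<Sum>s\<in>F. vs s) e\<bar> \<le> 2 * \<gamma>' * norm e + \<eta> / 3" by blast
  have near: "norm (v s - x0) \<le> \<delta>" if "s \<in> F" for s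
    using norm_triangle_ineq[of "v s - w" "w - x0"] v(1)[OF that] \<delta>'(2) by simp
  have "(\<Sum>s\<in>insert t F. (vs(t := a)) s) = a + (\<Sum>s\<in>F. (vs(t := a)) s)" using insert.hyps by simp
  also have "(\<Sum>s\<in>F. (vs(t := a)) s) = (\<Sum>s\<in>F. vs s)" by (rule sum.cong) (use insert.hyps in auto)
  finally have sum: "(\<Sum>s\<in>insert t F. (vs(t := a)) s) = a + (\<Sum>s\<in>F. vs s)" .
  have est: "\<bar>blinfun_apply xs e - blinfun_apply (a + (\<Sum>s\<in>F. vs s)) e\<bar> \<le> 2 * \<gamma> * norm e + \<eta>" if e: "e \<in> E" for e
    using uw(5)[OF e] v(3)[OF e] \<gamma>'(2)[OF e] unfolding blinfun.add_left by linarith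
  show ?case
  proof (intro exI[of _ "v(t := u)"] exI[of _ "vs(t := a)"] conjI ballI)
    show "norm ((v(t := u)) s - x0) \<le> \<delta>" if "s \<in> insert t F" for s using uw(1) near that by auto
    show "(vs(t := a)) s \<in> frechet_normal (S s) ((v(t := u)) s)" if "s \<in> insert t F" for s using uw(3) v(2) that by auto
  qed (unfold sum, rule est)
qed

lemma approximate_normals_family:
  fixes S :: "'t \<Rightarrow> 'a::banach set"
  assumes asp: "asplund_space TYPE('a)" and S: "\<And>t. t \<in> T \<Longrightarrow> closed (S t)"
    and xs: "xs \<in> frechet_normal (\<Inter>t\<in>T. S t) x" and E: "finite E" and pos: "\<epsilon> > 0" "\<eta> > 0"
  shows "\<exists>F w ws. finite F \<and> F \<subseteq> T \<and> (\<forall>t\<in>F. w t \<in> cball x \<epsilon> \<and> ws t \<in> frechet_normal (S t) (w t)) \<and>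
    (\<forall>e\<in>E. \<bar>blinfun_apply (\<Sum>t\<in>F. ws t) e - blinfun_apply xs e\<bar> < \<eta>)"
proof -
  have "\<eta> / 3 > 0" using pos by simp
  then obtain \<gamma> where \<gamma>: "\<gamma> > 0" "\<And>e. e \<in> E \<Longrightarrow> 2 * \<gamma> * norm e \<le> \<eta> / 3"
    using exists_small_slope[OF E] by blast
  obtain \<delta> where \<delta>: "0 < \<delta>" "\<delta> \<le> \<epsilon>"
    "\<And>h. norm h = \<delta> \<Longrightarrow> x + h \<in> (\<Inter>t\<in>T. S t) \<Longrightarrow> blinfun_apply xs h < \<gamma> * norm h"
    using frechet_normal_sphere[OF xs \<gamma>(1) pos(1)] by blast
  have x: "x \<in> S t" if "t \<in> T" for t using xs that by (simp add: frechet_normal_iff)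
  \<comment> \<open>The directions violating the sphere test; none of them leads into the full
    intersection.\<close>
  define K where "K = (cball 0 \<delta> \<inter> span E) \<inter> {h. norm h = \<delta> \<and> \<gamma> * norm h \<le> blinfun_apply xs h}"
  have "closed {h. norm h = \<delta> \<and> \<gamma> * norm h \<le> blinfun_apply xs h}"
    by (intro closed_Collect_conj closed_Collect_eq closed_Collect_le continuous_intros)
  then have K: "compact K" unfolding K_def by (intro compact_Int_closed compact_ball_span_finite E)
  have "\<exists>F. finite F \<and> F \<subseteq> T \<and> K \<inter> (\<Inter>t\<in>F. {h. x + h \<in> S t}) = {}"
  proof (rule ccontr)
    assume no: "\<not> ?thesis"
    have "K \<inter> (\<Inter>t\<in>T. {h. x + h \<in> S t}) \<noteq> {}"
    proof (rule compact_imp_fip_image[OF K])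
      fix t assume "t \<in> T"
      have "closed ((\<lambda>h. x + h) -` S t)" by (rule closed_vimage[OF S[OF \<open>t \<in> T\<close>]]) (intro continuous_intros)
      then show "closed {h. x + h \<in> S t}" by (simp add: vimage_def)
    qed (use no in blast)
    then obtain h where "h \<in> K" "\<And>t. t \<in> T \<Longrightarrow> x + h \<in> S t" by blast
    then show False using \<delta>(3)[of h] unfolding K_def by auto
  qed
  then obtain F where F: "finite F" "F \<subseteq> T" "K \<inter> (\<Inter>t\<in>F. {h. x + h \<in> S t}) = {}" by blast
  have "\<exists>w ws. (\<forall>t\<in>F. norm (w t - x) \<le> \<delta> \<and> ws t \<in> frechet_normal (S t) (w t)) \<and>
    (\<forall>e\<in>E. \<bar>blinfun_apply xs e - blinfun_apply (\<Sum>t\<in>F. ws t) e\<bar> \<le> 2 * \<gamma> * norm e + \<eta> / 3)"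
  proof (rule approximate_normals_finite_family[OF asp E F(1) _ _ \<delta>(1) \<gamma>(1) \<open>\<eta> / 3 > 0\<close>])
    show "closed (S t)" "x \<in> S t" if "t \<in> F" for t using that F(2) S x by auto
    fix h assume "h \<in> span E" "norm h = \<delta>" "\<And>t. t \<in> F \<Longrightarrow> x + h \<in> S t"
    then have "h \<notin> K" "h \<in> cball 0 \<delta> \<inter> span E" using F(3) by auto
    then show "blinfun_apply xs h < \<gamma> * norm h" using \<open>norm h = \<delta>\<close> unfolding K_def by auto
  qed
  then obtain w ws where w: "\<And>t. t \<in> F \<Longrightarrow> norm (w t - x) \<le> \<delta>" "\<And>t. t \<in> F \<Longrightarrow> ws t \<in> frechet_normal (S t) (w t)"
    "\<And>e. e \<in> E \<Longrightarrow> \<bar>blinfun_apply xs e - blinfun_apply (\<Sum>t\<in>F. ws t) e\<bar> \<le> 2 * \<gamma> * norm e + \<eta> / 3" by blast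
  show ?thesis
  proof (intro exI[of _ F] exI[of _ w] exI[of _ ws] conjI ballI F(1,2))
    show "\<bar>blinfun_apply (\<Sum>t\<in>F. ws t) e - blinfun_apply xs e\<bar> < \<eta>" if "e \<in> E" for e
      using w(3)[OF that] \<gamma>(2)[OF that] pos(2) by linarith
    show "w t \<in> cball x \<epsilon>" if "t \<in> F" for t
      using w(1)[OF that] \<delta>(2) by (simp add: dist_norm norm_minus_commute)
    show "ws t \<in> frechet_normal (S t) (w t)" if "t \<in> F" for t by (rule w(2)[OF that])
  qed
qed

section \<open>Normals to cones and the final statement\<close>

lemma frechet_normal_scale:
  assumes cone: "pos_cone A" and c: "c > 0" and xs: "xs \<in> frechet_normal A w"
  shows "xs \<in> frechet_normal A (c *\<^sub>R w)"
  unfolding frechet_normal_iff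
proof (intro conjI allI impI)
  show "c *\<^sub>R w \<in> A" using xs cone c by (simp add: frechet_normal_iff pos_cone_def)
  fix e :: real assume "e > 0"
  then obtain d where d: "d > 0" "\<And>u. u \<in> A \<Longrightarrow> norm (u - w) < d \<Longrightarrow> blinfun_apply xs (u - w) \<le> e * norm (u - w)"
    using xs unfolding frechet_normal_iff by blast
  have "blinfun_apply xs (u - c *\<^sub>R w) \<le> e * norm (u - c *\<^sub>R w)" if u: "u \<in> A" "norm (u - c *\<^sub>R w) < c * d" for u
  proof -
    define v where "v = (1 / c) *\<^sub>R u"
    have v: "v \<in> A" "u - c *\<^sub>R w = c *\<^sub>R (v - w)"
      using u(1) cone c by (auto simp: v_def pos_cone_def scaleR_diff_right)
    have "blinfun_apply xs (v - w) \<le> e * norm (v - w)" using d(2)[OF v(1)] u(2) c unfolding v(2) by simp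
    then have "c * blinfun_apply xs (v - w) \<le> c * (e * norm (v - w))" using c by simp
    then show ?thesis unfolding v(2) using c by (simp add: blinfun.scaleR_right mult_ac)
  qed
  then show "\<exists>d>0. \<forall>u\<in>A. norm (u - c *\<^sub>R w) < d \<longrightarrow> blinfun_apply xs (u - c *\<^sub>R w) \<le> e * norm (u - c *\<^sub>R w)"
    using c d(1) by (intro exI[of _ "c * d"]) auto
qed

text \<open>The functional stays normal along the ray through \<open>w\<close>, so at the points
  \<open>w / (n + 1)\<close> a constant sequence of normals works; closedness puts their limit
  \<open>0\<close> into \<open>A\<close>.\<close>

lemma frechet_normal_cone_subset_limiting:
  assumes "closed A" "pos_cone A"
  shows "frechet_normal A w \<subseteq> limiting_normal A 0"
proof
  fix xs assume xs: "xs \<in> frechet_normal A w"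
  define u where "u n = inverse (real (Suc n)) *\<^sub>R w" for n
  have u: "xs \<in> frechet_normal A (u n)" for n
    unfolding u_def by (rule frechet_normal_scale[OF assms(2) _ xs]) simp
  have u0: "u \<longlonglongrightarrow> 0" unfolding u_def using tendsto_scaleR[OF LIMSEQ_inverse_real_of_nat tendsto_const, of w] by simp
  have uA: "u n \<in> A" for n using u by (simp add: frechet_normal_iff)
  have "0 \<in> A" using closed_sequentially[OF assms(1) uA u0] .
  then have "\<bar>ind_fun A 0\<bar> \<noteq> \<infinity>" "(\<lambda>n. ind_fun A (u n)) \<longlonglongrightarrow> ind_fun A 0"
    using uA by (simp_all add: ind_fun_def)
  moreover have "limitin weak_star (\<lambda>n. xs) xs sequentially"
    by (simp add: limitin_const_iff strong_operator_topology_topspace)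
  ultimately show "xs \<in> limiting_normal A 0"
    using u u0 unfolding limiting_normal_def limiting_subdiff_def frechet_normal_def
    by (intro CollectI conjI exI[of _ u] exI[of _ "\<lambda>n. xs"]) auto
qed

theorem theorem4p5:
  fixes \<Lambda>t :: "'t \<Rightarrow> 'a::banach set" and T :: "'t set" and \<Lambda> :: "'a set"
  assumes "asplund_space TYPE('a)"
    and "T \<noteq> {}"
    and "\<And>t. t \<in> T \<Longrightarrow> closed (\<Lambda>t t)"
    and "\<Lambda> = (\<Inter>t\<in>T. \<Lambda>t t)"
  shows "(\<forall>xbar. \<forall>xs \<in> frechet_normal \<Lambda> xbar. \<forall>\<epsilon>>0. \<forall>V.
            (\<exists>U. openin weak_star U \<and> 0 \<in> U \<and> U \<subseteq> V) \<longrightarrow>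
            (\<exists>F w ws. finite F \<and> F \<subseteq> T \<and>
               (\<forall>t\<in>F. w t \<in> cball xbar \<epsilon> \<and> ws t \<in> frechet_normal (\<Lambda>t t) (w t)) \<and>
               (\<exists>v\<in>V. xs = (\<Sum>t\<in>F. ws t) + v)))
       \<and> ((\<forall>t\<in>T. pos_cone (\<Lambda>t t)) \<longrightarrow>
            (\<forall>t\<in>T. \<forall>w\<in>\<Lambda>t t. frechet_normal (\<Lambda>t t) w \<subseteq> limiting_normal (\<Lambda>t t) 0) \<and>
            (\<forall>xbar. frechet_normal \<Lambda> xbar \<subseteq>
               weak_star closure_of
                 {(\<Sum>t\<in>F. ws t) | F ws. finite F \<and> F \<subseteq> T \<and>
                    (\<forall>t\<in>F. ws t \<in> limiting_normal (\<Lambda>t t) 0)}))"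
proof (intro conjI allI ballI impI)
  fix xbar and xs :: "'a \<Rightarrow>\<^sub>L real" and \<epsilon> :: real and V :: "('a \<Rightarrow>\<^sub>L real) set"
  assume xs: "xs \<in> frechet_normal \<Lambda> xbar" and \<epsilon>: "0 < \<epsilon>" and "\<exists>U. openin weak_star U \<and> 0 \<in> U \<and> U \<subseteq> V"
  then obtain U :: "('a \<Rightarrow>\<^sub>L real) set" where U: "openin weak_star U" "0 \<in> U" "U \<subseteq> V" by blast
  obtain E :: "'a set" and \<eta> :: real where E: "finite E" "\<eta> > 0"
    "\<And>ys. (\<And>e. e \<in> E \<Longrightarrow> \<bar>blinfun_apply ys e - blinfun_apply 0 e\<bar> < \<eta>) \<Longrightarrow> ys \<in> U"
    using weak_star_basic_nhd[OF U(1,2)] by blast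
  obtain F w ws where F: "finite F" "F \<subseteq> T" "\<forall>t\<in>F. w t \<in> cball xbar \<epsilon> \<and> ws t \<in> frechet_normal (\<Lambda>t t) (w t)"
    "\<forall>e\<in>E. \<bar>blinfun_apply (\<Sum>t\<in>F. ws t) e - blinfun_apply xs e\<bar> < \<eta>"
    using approximate_normals_family[OF assms(1,3) xs[unfolded assms(4)] E(1) \<epsilon> E(2)] by blast
  \<comment> \<open>This difference is the required \<open>v\<close>: it is small on
    \<open>E\<close>, which is all that membership in \<open>U\<close> tests.\<close>
  have "xs - (\<Sum>t\<in>F. ws t) \<in> U"
    by (rule E(3)) (use F(4) in \<open>simp add: blinfun.diff_left abs_minus_commute\<close>)
  then have "\<exists>v\<in>V. xs = (\<Sum>t\<in>F. ws t) + v" using U(3) by (intro bexI[of _ "xs - (\<Sum>t\<in>F. ws t)"]) auto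
  then show "\<exists>F w ws. finite F \<and> F \<subseteq> T \<and> (\<forall>t\<in>F. w t \<in> cball xbar \<epsilon> \<and> ws t \<in> frechet_normal (\<Lambda>t t) (w t)) \<and>
      (\<exists>v\<in>V. xs = (\<Sum>t\<in>F. ws t) + v)" using F(1-3) by blast
next
  fix t w assume "\<forall>t\<in>T. pos_cone (\<Lambda>t t)" "t \<in> T"
  then show "frechet_normal (\<Lambda>t t) w \<subseteq> limiting_normal (\<Lambda>t t) 0"
    by (intro frechet_normal_cone_subset_limiting assms(3)) auto
next
  fix xbar assume cone: "\<forall>t\<in>T. pos_cone (\<Lambda>t t)"
  define Z where "Z = {(\<Sum>t\<in>F. ws t) | F ws. finite F \<and> F \<subseteq> T \<and> (\<forall>t\<in>F. ws t \<in> limiting_normal (\<Lambda>t t) 0)}"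
  show "frechet_normal \<Lambda> xbar \<subseteq> weak_star closure_of Z"
  proof
    fix xs assume xs: "xs \<in> frechet_normal \<Lambda> xbar"
    have "\<exists>ys\<in>Z. ys \<in> U" if U: "xs \<in> U" "openin weak_star U" for U
    proof -
      obtain E :: "'a set" and \<eta> :: real where E: "finite E" "\<eta> > 0"
        "\<And>ys. (\<And>e. e \<in> E \<Longrightarrow> \<bar>blinfun_apply ys e - blinfun_apply xs e\<bar> < \<eta>) \<Longrightarrow> ys \<in> U"
        using weak_star_basic_nhd[OF U(2,1)] by blast
      \<comment> \<open>Any radius would do, since the base points are forgotten once the normals
        are transferred to \<open>0\<close>.\<close>
      obtain F w ws where F: "finite F" "F \<subseteq> T" "\<forall>t\<in>F. w t \<in> cball xbar 1 \<and> ws t \<in> frechet_normal (\<Lambda>t t) (w t)"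
        "\<forall>e\<in>E. \<bar>blinfun_apply (\<Sum>t\<in>F. ws t) e - blinfun_apply xs e\<bar> < \<eta>"
        using approximate_normals_family[OF assms(1,3) xs[unfolded assms(4)] E(1) zero_less_one E(2)] by blast
      have "ws t \<in> limiting_normal (\<Lambda>t t) 0" if "t \<in> F" for t
        using frechet_normal_cone_subset_limiting[of "\<Lambda>t t" "w t"] assms(3) cone F(2,3) that by blast
      then have "(\<Sum>t\<in>F. ws t) \<in> Z" unfolding Z_def using F(1,2) by blast
      moreover have "(\<Sum>t\<in>F. ws t) \<in> U" by (rule E(3)) (rule F(4)[rule_format])
      ultimately show ?thesis by blast
    qed
    then show "xs \<in> weak_star closure_of Z"
      unfolding in_closure_of strong_operator_topology_topspace by blast
  qed
qed

end
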